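(* Let $\mathcal H$ be a Hilbert space, $k$ a positive integer, $D$ a self-adjoint operator on $\mathcal H$ and $B$ a bounded operator on $\mathcal H$ for which there is $\delta>0$ with $\mathrm{Re}(BDu,Du)\ge\delta\|Du\|^2$ for all $u\in\mathsf D(D)$. Assume that there is a constant $C$ with $$\int_0^\infty\| t^kBD(I+t^{2k}BDBD)^{-1} u \|^2 \, \frac{dt}t \le C \|u\|^2\quad\text{and}\quad \int_0^\infty\| t^kB^*D(I+t^{2k}B^*DB^*D)^{-1} u \|^2 \, \frac{dt}t \le C \|u\|^2$$ for all $u\in\mathcal H$. Then the operator $\mathrm{sgn}(BD)$ is bounded on $\mathcal H$ and invertible on $\overline{\mathsf R(BD)}$.
   Context: $\mathsf D(A),\mathsf N(A),\mathsf R(A)$ denote the domain, null space and range of an operator $A$. Under the stated assumptions on $B,D$ the resolvents $(I+isBD)^{-1}$, $s\in\mathbf R$, are uniformly bounded and $\mathcal H=\overline{\mathsf R(BD)}\oplus\mathsf N(BD)$ as a topological (not necessarily orthogonal) direct sum. The operator $\mathrm{sgn}(BD)$ is defined as follows: $\mathrm{sgn}(BD)=0$ on $\mathsf N(BD)$, and for $f\in\mathsf D(BD)\cap\mathsf R(BD)$ (a dense subspace of $\overline{\mathsf R(BD)}$) $$\mathrm{sgn}(BD)f=c\int_0^\infty (t^kBD)^3(I+t^{2k}BDBD)^{-3}f\,\frac{dt}t,\qquad c^{-1}=\int_0^\infty u^{3k-1}(1+u^{2k})^{-3}\,du,$$ the integral converging in norm. This corresponds, in the holomorphic functional calculus of $BD$,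 to the function equal to $1$ on the open right half-plane, $-1$ on the open left half-plane (and $0$ at $0$). Boundedness of $\mathrm{sgn}(BD)$ means that this densely defined operator extends to a bounded operator on $\mathcal H$. *)

theory Defs
  imports "HOL-Analysis.Analysis"
begin

section \<open>Complex Hilbert spaces\<close>

text \<open>The libraries only provide real inner product spaces. A complex inner product space is a
  real one with a compatible complex structure; \<open>cinner\<close> is linear in the first argument, and its
  real part is the real inner product (hence it induces the norm).\<close>

class complex_inner = real_inner +
  fixes scaleC :: "complex \<Rightarrow> 'a \<Rightarrow> 'a"  (infixr "*\<^sub>C" 75)
    and cinner :: "'a \<Rightarrow> 'a \<Rightarrow> complex"
  assumes scaleC_add_right: "c *\<^sub>C (x + y) = c *\<^sub>C x + c *\<^sub>C y"
    and scaleC_add_left: "(c + d) *\<^sub>C x = c *\<^sub>C x + d *\<^sub>C x"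
    and scaleC_scaleC: "c *\<^sub>C (d *\<^sub>C x) = (c * d) *\<^sub>C x"
    and scaleC_of_real: "complex_of_real r *\<^sub>C x = r *\<^sub>R x"
    and cinner_commute: "cinner x y = cnj (cinner y x)"
    and cinner_add_left: "cinner (x + y) z = cinner x z + cinner y z"
    and cinner_scaleC_left: "cinner (c *\<^sub>C x) y = c * cinner x y"
    and Re_cinner: "Re (cinner x y) = inner x y"

class chilbert = complex_inner + banach

instantiation complex :: chilbert
begin

definition scaleC_complex :: "complex \<Rightarrow> complex \<Rightarrow> complex"
  where "scaleC_complex c x = c * x"

definition cinner_complex :: "complex \<Rightarrow> complex \<Rightarrow> complex"
  where "cinner_complex x y = x * cnj y"

instance
  by standard
    (simp_all add: scaleC_complex_def cinner_complex_def algebra_simps inner_complex_def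
      scaleR_conv_of_real)

end

definition bounded_clinear :: "('a::complex_inner \<Rightarrow> 'a) \<Rightarrow> bool"
  where "bounded_clinear S \<longleftrightarrow> bounded_linear S \<and> (\<forall>c x. S (c *\<^sub>C x) = c *\<^sub>C S x)"


section \<open>Unbounded operators\<close>

text \<open>An operator is identified with its graph. Its domain and range are then \<^const>\<open>Domain\<close>
  and \<^const>\<open>Range\<close>, its inverse is \<^const>\<open>converse\<close>, and powers (with their natural domains)
  are relation powers.\<close>

type_synonym 'a operator = "('a \<times> 'a) set"

definition linear_operator :: "'a::complex_inner operator \<Rightarrow> bool"
  where "linear_operator A \<longleftrightarrow>
    single_valued A \<and> subspace A \<and> (\<forall>c u v. (u, v) \<in> A \<longrightarrow> (c *\<^sub>C u, c *\<^sub>C v) \<in> A)"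

definition op_graph :: "('a \<Rightarrow> 'a) \<Rightarrow> 'a operator"
  where "op_graph S = {(u, S u) |u. True}"

definition op_app :: "'a operator \<Rightarrow> 'a \<Rightarrow> 'a"
  where "op_app A u = (THE v. (u, v) \<in> A)"

definition null_space :: "'a::zero operator \<Rightarrow> 'a set"
  where "null_space A = {u. (u, 0) \<in> A}"

text \<open>Operator product (\<open>T\<close> is applied first); relation composition has the opposite order.\<close>

definition op_mult :: "'a operator \<Rightarrow> 'a operator \<Rightarrow> 'a operator"  (infixr "\<circ>\<^sub>o" 75)
  where "S \<circ>\<^sub>o T = T O S"

definition op_scaleR :: "real \<Rightarrow> 'a::real_vector operator \<Rightarrow> 'a operator"
  where "op_scaleR r A = {(u, r *\<^sub>R v) |u v. (u, v) \<in> A}"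

definition id_plus :: "'a::plus operator \<Rightarrow> 'a operator"
  where "id_plus A = {(u, u + v) |u v. (u, v) \<in> A}"

definition op_adjoint :: "'a::complex_inner operator \<Rightarrow> 'a operator"
  where "op_adjoint A = {(v, w). \<forall>(u, z) \<in> A. cinner z v = cinner u w}"

definition self_adjoint :: "'a::complex_inner operator \<Rightarrow> bool"
  where "self_adjoint A \<longleftrightarrow>
    linear_operator A \<and> closure (Domain A) = UNIV \<and> op_adjoint A = A"


section \<open>The operator \<open>sgn A\<close>\<close>

text \<open>\<open>(I + t\<^sup>2\<^sup>k A\<^sup>2)\<^sup>-\<^sup>1\<close>\<close>

definition sq_resolvent :: "nat \<Rightarrow> 'a::real_vector operator \<Rightarrow> real \<Rightarrow> 'a operator"
  where "sq_resolvent k A t = converse (id_plus (op_scaleR (t ^ (2 * k)) (A \<circ>\<^sub>o A)))"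

definition sgn_const :: "nat \<Rightarrow> real"
  where "sgn_const k = inverse (integral {0<..} (\<lambda>u. u ^ (3 * k - 1) / (1 + u ^ (2 * k)) ^ 3))"

definition sgn_integrand :: "nat \<Rightarrow> 'a::real_vector operator \<Rightarrow> 'a \<Rightarrow> real \<Rightarrow> 'a"
  where "sgn_integrand k A f t =
    (1 / t) *\<^sub>R op_app ((op_scaleR (t ^ k) A ^^ 3) \<circ>\<^sub>o (sq_resolvent k A t ^^ 3)) f"

text \<open>Norm convergence of an integral over the open half-line: the integrals over \<open>[a, b]\<close>
  converge in norm as \<open>a\<close> tends to \<open>0\<close> and \<open>b\<close> tends to infinity, independently.\<close>

definition has_improper_integral :: "(real \<Rightarrow> 'a::real_normed_vector) \<Rightarrow> 'a \<Rightarrow> bool"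
  where "has_improper_integral \<phi> g \<longleftrightarrow>
    (\<forall>a b. 0 < a \<longrightarrow> \<phi> integrable_on {a..b}) \<and>
    ((\<lambda>(a, b). integral {a..b} \<phi>) \<longlongrightarrow> g) (at_right 0 \<times>\<^sub>F at_top)"

text \<open>\<open>S\<close> is a bounded operator on the whole space extending \<open>sgn A\<close>, where \<open>sgn A\<close> is
  \<open>0\<close> on the null space of \<open>A\<close> and is given by the integral formula on
  \<open>Domain A \<inter> Range A\<close>. In particular, the integral is required to converge there.\<close>

definition bounded_extension_sgn ::
    "nat \<Rightarrow> 'a::complex_inner operator \<Rightarrow> ('a \<Rightarrow> 'a) \<Rightarrow> bool"
  where "bounded_extension_sgn k A S \<longleftrightarrow> bounded_clinear S \<and>
    (\<forall>n \<in> null_space A. S n = 0) \<and>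
    (\<forall>f \<in> Domain A \<inter> Range A.
      \<exists>g. has_improper_integral (sgn_integrand k A f) g \<and> S f = sgn_const k *\<^sub>R g)"

text \<open>\<open>S\<close> restricts to a bijection of \<open>V\<close> with bounded inverse.\<close>

definition invertible_on :: "'a::real_normed_vector set \<Rightarrow> ('a \<Rightarrow> 'a) \<Rightarrow> bool"
  where "invertible_on V S \<longleftrightarrow>
    bij_betw S V V \<and> (\<exists>M. \<forall>v \<in> V. norm v \<le> M * norm (S v))"

end

theory Submission
  imports Defs
begin

text \<open>Let \<open>A = BD\<close>, \<open>R\<^sub>t = (I + t\<^sup>2 A\<^sup>2)\<^sup>-\<^sup>1\<close> and \<open>Q\<^sub>t = t A R\<^sub>t\<close>. The integrand defining \<open>sgn A\<close> is the cube of \<open>Q\<close>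
at the parameter \<open>t\<^sup>k\<close>. Substituting \<open>t\<^sup>k = e\<^sup>x\<close> turns every integral with respect to \<open>dt/t\<close> into \<open>1/k\<close> times an
integral over the real line with respect to \<open>dx\<close>, so that \<open>k\<close> disappears; \<open>R\<close> and \<open>Q\<close> are written as functions
of \<open>x\<close> below.

Resolvent bounds. The quadratic form \<open>(u, Du)\<close> is real. Testing \<open>f = u + isBDu\<close> against \<open>iDu\<close>
therefore leaves only \<open>s Re (BDu, Du)\<close>, which controls \<open>s Du\<close> and hence \<open>u\<close> by \<open>f\<close>. The range of
\<open>I + isBD\<close> is thus closed, and reality of the form together with accretivity also excludes a nonzero vector
orthogonal to it. So \<open>A\<close> is bisectorial (\<open>product_bisectorial\<close>), and \<open>R\<close> and \<open>Q\<close> are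
uniformly bounded.

Boundedness. Pair \<open>Q\<^sup>3 f\<close> with a vector \<open>g\<close> and move one factor \<open>Q\<close> to \<open>g\<close>. The adjoint of \<open>Q\<close> belongs to
\<open>DB*\<close>, which \<open>B*\<close> intertwines with \<open>B*D\<close>; as \<open>B*\<close> is bounded below on the range of \<open>D\<close>, the adjoint
of \<open>Q\<close> at \<open>g\<close> is dominated by the \<open>Q\<close> of \<open>B*D\<close> at \<open>B*g\<close> (\<open>quo_duality\<close>). The two square function
estimates and the Cauchy-Schwarz inequality give
\<open>\<parallel>\<integral> Q\<^sup>3 f dx\<parallel>\<^sup>2 \<le> const \<integral> \<parallel>Q f\<parallel>\<^sup>2 dx\<close> over every interval. The right-hand side has small tails, so the
integral over the line converges for every \<open>f\<close>, to a bounded operator \<open>T\<close> applied to \<open>f\<close>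
(\<open>cubed_integral_operator\<close>).

Invertibility. On the closure \<open>V\<close> of the range of \<open>A\<close>, the integral of \<open>Q\<^sup>3\<close> is \<open>1/8\<close> of the integral \<open>G\<close> of \<open>Q\<close>,
since \<open>Q\<^sup>3 - Q/8\<close> is an exact derivative (\<open>has_line_integral_Q\<close>). By partial fractions,
\<open>Q(x) Q(x + u) = (R(x) - R(x + u)) / (2 sinh u)\<close>. On \<open>V\<close>, \<open>R(x)\<close> tends strongly to \<open>I\<close> as \<open>x \<rightarrow> -\<infinity>\<close> and to \<open>0\<close>
as \<open>x \<rightarrow> \<infinity>\<close>; the integral of \<open>R(x) - R(x + u)\<close> over \<open>x\<close> is then \<open>u I\<close>, as in Frullani's formula. Fubini's theorem
gives \<open>G\<^sup>2 = \<kappa> I\<close> on \<open>V\<close> with \<open>\<kappa> = \<integral> u / (2 sinh u) du > 0\<close> (\<open>integrated_family_square\<close>). Hence \<open>sgn A\<close> is, up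
to a positive factor, its own inverse on \<open>V\<close>. An arbitrary bounded extension agrees with a multiple of \<open>G\<close>
on \<open>V\<close> because the intersection of the domain and the range of \<open>A\<close> is dense in \<open>V\<close>.\<close>

section \<open>Complex Hilbert spaces\<close>

lemma scaleC_diff_right: "c *\<^sub>C (x - y) = c *\<^sub>C x - c *\<^sub>C (y::'a::complex_inner)"
  by (metis add_diff_cancel diff_add_cancel scaleC_add_right)

lemma scaleC_zero_right: "c *\<^sub>C (0::'a::complex_inner) = 0"
  by (metis scaleC_diff_right cancel_comm_monoid_add_class.diff_cancel)

lemma scaleC_scaleR: "c *\<^sub>C (r *\<^sub>R x) = r *\<^sub>R (c *\<^sub>C (x::'a::complex_inner))"
  by (metis mult.commute scaleC_of_real scaleC_scaleC)

lemma scaleC_minus_one: "(-1) *\<^sub>C x = - (x::'a::complex_inner)"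
  using scaleC_of_real[of "-1" x] by simp

lemma ii_ii [simp]: "\<i> *\<^sub>C \<i> *\<^sub>C x = - (x::'a::complex_inner)"
  by (simp add: scaleC_scaleC scaleC_minus_one)

lemma inner_ii_left: "inner (\<i> *\<^sub>C x) y = - inner x (\<i> *\<^sub>C (y::'a::complex_inner))"
proof -
  have *: "Re (cinner (\<i> *\<^sub>C x) y) = - Im (cinner x y)" for x y :: 'a
    by (simp add: cinner_scaleC_left)
  have "inner x (\<i> *\<^sub>C y) = Re (cinner (\<i> *\<^sub>C y) x)"
    by (simp add: Re_cinner inner_commute)
  also have "\<dots> = Im (cinner x y)"
    using *[of y x] cinner_commute[of x y] by (metis cnj.sel(2) minus_minus)
  finally show ?thesis using *[of x y] by (simp add: Re_cinner)
qed

lemma norm_ii [simp]: "norm (\<i> *\<^sub>C x) = norm (x::'a::complex_inner)"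
  by (simp add: norm_eq_sqrt_inner inner_ii_left)

lemma cinner_eq_inner: "cinner x y = Complex (inner x y) (inner x (\<i> *\<^sub>C (y::'a::complex_inner)))"
proof (rule complex_eqI)
  have "inner x (\<i> *\<^sub>C y) = - Re (cinner (\<i> *\<^sub>C x) y)"
    by (simp add: Re_cinner inner_ii_left)
  then show "Im (cinner x y) = Im (Complex (inner x y) (inner x (\<i> *\<^sub>C y)))"
    by (simp add: cinner_scaleC_left)
qed (simp add: Re_cinner)

lemma scaleC_conv: "c *\<^sub>C x = Re c *\<^sub>R x + Im c *\<^sub>R (\<i> *\<^sub>C (x::'a::complex_inner))"
proof -
  have "c = of_real (Re c) + of_real (Im c) * \<i>" by (simp add: complex_eq_iff)
  then have "c *\<^sub>C x = (of_real (Re c) + of_real (Im c) * \<i>) *\<^sub>C x" by simp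
  also have "\<dots> = of_real (Re c) *\<^sub>C x + of_real (Im c) *\<^sub>C \<i> *\<^sub>C x"
    by (simp only: scaleC_add_left scaleC_scaleC)
  finally show ?thesis by (simp add: scaleC_of_real)
qed

lemma bounded_clinearI:
  fixes S :: "'a::complex_inner \<Rightarrow> 'a"
  assumes "bounded_linear S" "\<And>x. S (\<i> *\<^sub>C x) = \<i> *\<^sub>C S x"
  shows "bounded_clinear S"
proof -
  interpret bounded_linear S by fact
  show ?thesis
    unfolding bounded_clinear_def using assms
    by (metis add scaleR scaleC_conv)
qed

text \<open>The vector from the best approximation of \<open>x\<close> in \<open>S\<close> to \<open>x\<close>. A minimising sequence is Cauchy by the
parallelogram law, because midpoints of points of \<open>S\<close> are again in \<open>S\<close>.\<close>

lemma orthogonal_vector_exists: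
  fixes S :: "'a::{real_inner, banach} set"
  assumes S: "subspace S" "closed S" and x: "x \<notin> S"
  shows "\<exists>g. inner x g \<noteq> 0 \<and> (\<forall>s\<in>S. inner s g = 0)"
proof -
  have ne: "S \<noteq> {}" using S(1) subspace_0 by blast
  define d where "d = infdist x S"
  have d0: "d \<ge> 0" by (simp add: d_def infdist_nonneg)
  have dle: "d \<le> norm (x - s)" if "s \<in> S" for s
    using infdist_le[OF that, of x] by (simp add: d_def dist_norm)
  have "\<exists>s\<in>S. norm (x - s) < d + e" if "e > 0" for e
  proof (rule ccontr)
    assume "\<not> ?thesis"
    then have "d + e \<le> infdist x S"
      unfolding infdist_notempty[OF ne] by (intro cINF_greatest[OF ne]) (auto simp: dist_norm)
    with that show False by (simp add: d_def)
  qed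
  then have "\<forall>n::nat. \<exists>s. s \<in> S \<and> norm (x - s) < d + inverse (real (Suc n))"
    by (meson inverse_positive_iff_positive of_nat_0_less_iff zero_less_Suc)
  then obtain s where s: "\<And>n. s n \<in> S" "\<And>n. norm (x - s n) < d + inverse (real (Suc n))"
    by metis
  have par: "(norm (s m - s n))\<^sup>2 \<le> 2 * (norm (x - s m))\<^sup>2 + 2 * (norm (x - s n))\<^sup>2 - 4 * d\<^sup>2" for m n
  proof -
    have "(1/2) *\<^sub>R (s m + s n) \<in> S"
      using S(1) s(1) by (simp add: subspace_add subspace_scale)
    then have "d\<^sup>2 \<le> (norm (x - (1/2) *\<^sub>R (s m + s n)))\<^sup>2"
      using dle d0 by (simp add: power_mono)
    then have "4 * d\<^sup>2 \<le> 4 * (norm (x - (1/2) *\<^sub>R (s m + s n)))\<^sup>2" by simp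
    moreover have "(norm (s m - s n))\<^sup>2 + 4 * (norm (x - (1/2) *\<^sub>R (s m + s n)))\<^sup>2
        = 2 * (norm (x - s m))\<^sup>2 + 2 * (norm (x - s n))\<^sup>2"
      by (simp add: power2_norm_eq_inner inner_diff_left inner_diff_right inner_add_left
          inner_add_right inner_commute algebra_simps)
    ultimately show ?thesis by linarith
  qed
  have "Cauchy s"
  proof (rule metric_CauchyI)
    fix e :: real assume "e > 0"
    define h where "h n = 2 * (d + inverse (real (Suc n)))\<^sup>2 - 2 * d\<^sup>2" for n
    have "h \<longlonglongrightarrow> 2 * (d + 0)\<^sup>2 - 2 * d\<^sup>2"
      unfolding h_def by (intro tendsto_intros LIMSEQ_inverse_real_of_nat)
    then have "eventually (\<lambda>n. h n < e\<^sup>2 / 2) sequentially"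
      using \<open>e > 0\<close> by (intro order_tendstoD(2)[where y = 0]) auto
    then obtain N where N: "\<And>n. n \<ge> N \<Longrightarrow> h n < e\<^sup>2 / 2"
      by (auto simp: eventually_sequentially)
    show "\<exists>N. \<forall>m\<ge>N. \<forall>n\<ge>N. dist (s m) (s n) < e"
    proof (intro exI allI impI)
      fix m n assume mn: "m \<ge> N" "n \<ge> N"
      have "(norm (x - s i))\<^sup>2 \<le> (d + inverse (real (Suc i)))\<^sup>2" for i
        using s(2)[of i] by (intro power_mono) auto
      from this[of m] this[of n] par[of m n] N[OF mn(1)] N[OF mn(2)]
      have "(norm (s m - s n))\<^sup>2 < e\<^sup>2" unfolding h_def by linarith
      then show "dist (s m) (s n) < e"
        using \<open>e > 0\<close> by (simp add: dist_norm power_less_imp_less_base)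
    qed
  qed
  then obtain y where y: "s \<longlonglongrightarrow> y" using Cauchy_convergent convergent_def by blast
  have yS: "y \<in> S" using S(2) s(1) y closed_sequentially by blast
  have "(\<lambda>n. norm (x - s n)) \<longlonglongrightarrow> norm (x - y)" by (intro tendsto_intros y)
  moreover have "(\<lambda>n. d + inverse (real (Suc n))) \<longlonglongrightarrow> d + 0"
    by (intro tendsto_intros LIMSEQ_inverse_real_of_nat)
  ultimately have "norm (x - y) \<le> d + 0"
    using s(2) by (intro LIMSEQ_le) (auto intro!: exI[of _ 0] less_imp_le)
  then have yd: "norm (x - y) = d" using dle[OF yS] by simp
  define g where "g = x - y"
  have orth: "inner t g = 0" if "t \<in> S" for t
  proof (cases "t = 0")
    case False
    \<comment> \<open>\<open>r t\<close> is the orthogonal projection of \<open>g\<close> onto the line spanned by \<open>t\<close>\<close>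
    define r where "r = inner t g / inner t t"
    have "y + r *\<^sub>R t \<in> S" using S(1) yS that by (simp add: subspace_add subspace_scale)
    then have "norm g \<le> norm (g - r *\<^sub>R t)"
      using dle yd by (simp add: g_def algebra_simps)
    then have "(norm g)\<^sup>2 \<le> (norm (g - r *\<^sub>R t))\<^sup>2" by (simp add: power_mono)
    also have "\<dots> = (norm g)\<^sup>2 - 2 * r * inner t g + r * r * inner t t"
      by (simp add: power2_norm_eq_inner inner_diff_left inner_diff_right inner_commute algebra_simps)
    also have "\<dots> = (norm g)\<^sup>2 - (inner t g)\<^sup>2 / inner t t"
      using False by (simp add: r_def field_simps power2_eq_square)
    finally have "(inner t g)\<^sup>2 / inner t t \<le> 0" by simp
    moreover have "0 < inner t t" using False by simp
    ultimately show ?thesis by (simp add: divide_le_0_iff not_le[symmetric] del: inner_gt_zero_iff)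
  qed simp
  have "inner x g = inner g g" using orth[OF yS] by (simp add: g_def inner_diff_left)
  moreover have "g \<noteq> 0" using x yS by (auto simp: g_def)
  ultimately have "inner x g \<noteq> 0" by simp
  with orth show ?thesis by blast
qed

text \<open>A multiple of a vector orthogonal to the kernel represents the functional.\<close>

lemma riesz_representation:
  fixes \<phi> :: "'a::{real_inner, banach} \<Rightarrow> real"
  assumes "bounded_linear \<phi>"
  shows "\<exists>w. \<forall>u. \<phi> u = inner u w"
proof (cases "\<forall>u. \<phi> u = 0")
  case True
  then show ?thesis by (intro exI[of _ 0]) auto
next
  case False
  then obtain x where x: "\<phi> x \<noteq> 0" by blast
  interpret bounded_linear \<phi> by fact
  have "subspace {u. \<phi> u = 0}" by (auto simp: subspace_def add scaleR zero)
  moreover have "closed {u. \<phi> u = 0}"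
    by (intro closed_Collect_eq continuous_on continuous_on_id continuous_on_const)
  ultimately obtain g where g: "inner x g \<noteq> 0" "\<And>u. \<phi> u = 0 \<Longrightarrow> inner u g = 0"
    using orthogonal_vector_exists[of "{u. \<phi> u = 0}" x] x by blast
  have "\<phi> u = inner u ((\<phi> g / inner g g) *\<^sub>R g)" for u
  proof -
    have "\<phi> (\<phi> g *\<^sub>R u - \<phi> u *\<^sub>R g) = 0" by (simp add: diff scaleR)
    then have "inner (\<phi> g *\<^sub>R u - \<phi> u *\<^sub>R g) g = 0" by (rule g(2))
    moreover have "g \<noteq> 0" using g(1) by auto
    ultimately show ?thesis by (simp add: inner_diff_left field_simps)
  qed
  then show ?thesis by blast
qed

lemma bounded_clinear_adjoint_exists:
  fixes B :: "'a::chilbert \<Rightarrow> 'a"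
  assumes "bounded_clinear B"
  shows "\<exists>B'. bounded_clinear B' \<and> (\<forall>u v. inner (B u) v = inner u (B' v))"
proof -
  interpret bounded_linear B using assms by (simp add: bounded_clinear_def)
  have "\<exists>w. \<forall>u. inner (B u) v = inner u w" for v
    using riesz_representation[of "\<lambda>u. inner (B u) v"]
      bounded_linear_compose[OF bounded_linear_inner_left[of v] bounded_linear_axioms] by blast
  then obtain B' where B': "\<And>u v. inner (B u) v = inner u (B' v)" by metis
  obtain K where K: "K > 0" "\<And>x. norm (B x) \<le> norm x * K" using pos_bounded by blast
  have lin: "bounded_linear B'"
  proof (rule bounded_linear_intro)
    show "B' (x + y) = B' x + B' y" for x y
      by (subst vector_eq_ldot[symmetric]) (simp add: inner_add_right flip: B')
    show "B' (r *\<^sub>R x) = r *\<^sub>R B' x" for r x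
      by (subst vector_eq_ldot[symmetric]) (simp flip: B')
    show "norm (B' x) \<le> norm x * K" for x
    proof -
      have "norm (B' x) * norm (B' x) = inner (B (B' x)) x"
        by (simp add: B' flip: power2_norm_eq_inner power2_eq_square)
      also have "\<dots> \<le> norm (B (B' x)) * norm x" by (rule norm_cauchy_schwarz)
      also have "\<dots> \<le> norm (B' x) * (norm x * K)"
        using mult_right_mono[OF K(2) norm_ge_zero] by (simp add: mult_ac)
      finally show ?thesis
        using K(1) by (cases "norm (B' x) = 0") (auto simp: mult_le_cancel_left)
    qed
  qed
  have "B' (\<i> *\<^sub>C x) = \<i> *\<^sub>C B' x" for x
  proof (subst vector_eq_ldot[symmetric], intro allI)
    fix u
    have "inner u (B' (\<i> *\<^sub>C x)) = - inner (\<i> *\<^sub>C B u) x" by (simp add: inner_ii_left flip: B')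
    also have "\<dots> = - inner (B (\<i> *\<^sub>C u)) x" using assms by (simp add: bounded_clinear_def)
    also have "\<dots> = inner u (\<i> *\<^sub>C B' x)" by (simp add: B' inner_ii_left)
    finally show "inner u (B' (\<i> *\<^sub>C x)) = inner u (\<i> *\<^sub>C B' x)" .
  qed
  with lin B' show ?thesis using bounded_clinearI by blast
qed

text \<open>Identifies the adjoint of a bounded operator, given as a relation, with the bounded operator \<open>B'\<close>. It
suffices to test with real inner products: the imaginary part of \<open>cinner u v\<close> is a real inner product with
\<open>\<i>v\<close>.\<close>

lemma op_adjoint_op_graph:
  fixes B :: "'a::chilbert \<Rightarrow> 'a"
  assumes "bounded_clinear B" "\<And>u v. inner (B u) v = inner u (B' v)"
  shows "op_adjoint (op_graph B) = op_graph B'"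
proof -
  have "cinner (B u) v = cinner u w \<longleftrightarrow>
     inner u (B' v) = inner u w \<and> inner (\<i> *\<^sub>C u) (B' v) = inner (\<i> *\<^sub>C u) w" for u v w
  proof -
    have "inner (B u) (\<i> *\<^sub>C v) = - inner (B (\<i> *\<^sub>C u)) v"
      using assms(1) by (simp add: bounded_clinear_def inner_ii_left)
    then show ?thesis by (auto simp: cinner_eq_inner assms(2) inner_ii_left)
  qed
  then have "(\<forall>u. cinner (B u) v = cinner u w) \<longleftrightarrow> w = B' v" for v w
    using vector_eq_ldot[of w "B' v"] by metis
  then show ?thesis by (auto simp: op_adjoint_def op_graph_def)
qed

section \<open>Bisectorial operators\<close>

lemma linear_operator_add:
  "linear_operator A \<Longrightarrow> (u, v) \<in> A \<Longrightarrow> (u', v') \<in> A \<Longrightarrow> (u + u', v + v') \<in> A"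
  unfolding linear_operator_def by (metis add_Pair subspace_add)

lemma linear_operator_scaleR:
  "linear_operator A \<Longrightarrow> (u, v) \<in> A \<Longrightarrow> (r *\<^sub>R u, r *\<^sub>R v) \<in> A"
  unfolding linear_operator_def by (metis scaleC_of_real)

lemma linear_operator_scaleC:
  "linear_operator A \<Longrightarrow> (u, v) \<in> A \<Longrightarrow> (c *\<^sub>C u, c *\<^sub>C v) \<in> A"
  unfolding linear_operator_def by metis

lemma linear_operator_diff:
  "linear_operator A \<Longrightarrow> (u, v) \<in> A \<Longrightarrow> (u', v') \<in> A \<Longrightarrow> (u - u', v - v') \<in> A"
  using linear_operator_add[of A u v "(-1) *\<^sub>R u'" "(-1) *\<^sub>R v'"] linear_operator_scaleR[of A u' v' "-1"]
  by simp

lemma linear_operator_fun: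
  "linear_operator A \<Longrightarrow> (u, v) \<in> A \<Longrightarrow> (u, v') \<in> A \<Longrightarrow> v = v'"
  unfolding linear_operator_def single_valued_def by blast

lemma op_app_eq: "linear_operator A \<Longrightarrow> (u, v) \<in> A \<Longrightarrow> op_app A u = v"
  unfolding op_app_def by (blast intro: linear_operator_fun)

text \<open>For real \<open>s\<close> the operator \<open>I + isA\<close> has a bounded inverse with a bound uniform in \<open>s\<close>. It yields the inverse of
\<open>I + t\<^sup>2 A\<^sup>2\<close>, because \<open>I + t\<^sup>2 A\<^sup>2 = (I + itA)(I - itA)\<close>.\<close>

locale bisectorial =
  fixes A :: "'a::chilbert operator" and M :: real
  assumes lin: "linear_operator A"
    and dense_domain: "closure (Domain A) = UNIV"
    and M_ge_1: "1 \<le> M"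
    and lower_bound: "(u, v) \<in> A \<Longrightarrow> norm u \<le> M * norm (u + s *\<^sub>R (\<i> *\<^sub>C v))"
    and surj: "s \<noteq> 0 \<Longrightarrow> \<exists>u v. (u, v) \<in> A \<and> u + s *\<^sub>R (\<i> *\<^sub>C v) = f"
begin

lemmas add = linear_operator_add[OF lin]
  and scaleR = linear_operator_scaleR[OF lin]
  and scaleC = linear_operator_scaleC[OF lin]
  and diff = linear_operator_diff[OF lin]

lemma sq_chain_exists:
  assumes "t \<noteq> 0"
  shows "\<exists>u v w. (u, v) \<in> A \<and> (v, w) \<in> A \<and> u + t\<^sup>2 *\<^sub>R w = f"
proof -
  obtain p p' where p: "(p, p') \<in> A" "p + t *\<^sub>R (\<i> *\<^sub>C p') = f" using surj[OF assms] by blast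
  obtain u v where u: "(u, v) \<in> A" "u + (-t) *\<^sub>R (\<i> *\<^sub>C v) = p" using surj[of "-t" p] assms by auto
  \<comment> \<open>\<open>itv = u - p\<close> lies in the domain of \<open>A\<close>, hence so does \<open>v\<close>\<close>
  have "(u - p, v - p') \<in> A" by (rule diff[OF u(1) p(1)])
  moreover have "u - p = t *\<^sub>R (\<i> *\<^sub>C v)" using u(2) by (simp add: algebra_simps)
  ultimately have "(t *\<^sub>R (\<i> *\<^sub>C v), v - p') \<in> A" by simp
  then have "(\<i> *\<^sub>C ((1/t) *\<^sub>R (t *\<^sub>R (\<i> *\<^sub>C v))), \<i> *\<^sub>C ((1/t) *\<^sub>R (v - p'))) \<in> A"
    by (intro scaleC scaleR)
  then have "(- v, (1/t) *\<^sub>R (\<i> *\<^sub>C (v - p'))) \<in> A" using assms by (simp add: scaleC_scaleR)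
  from scaleR[OF this, of "-1"]
  have "(v, - (1/t) *\<^sub>R (\<i> *\<^sub>C (v - p'))) \<in> A" by simp
  moreover have "u + t\<^sup>2 *\<^sub>R (- (1/t) *\<^sub>R (\<i> *\<^sub>C (v - p'))) = f"
    using assms p(2) u(2)
    by (simp add: scaleC_diff_right power2_eq_square algebra_simps)
  ultimately show ?thesis using u(1) by blast
qed

text \<open>The vector \<open>p = (I - itA)u\<close> satisfies \<open>(I + itA)p = (I + t\<^sup>2 A\<^sup>2)u\<close>, so the lower bound applies twice.\<close>

lemma sq_chain_bound:
  assumes "(u, v) \<in> A" "(v, w) \<in> A"
  shows "norm u \<le> M\<^sup>2 * norm (u + t\<^sup>2 *\<^sub>R w)"
    and "norm (t *\<^sub>R v) \<le> 2 * M\<^sup>2 * norm (u + t\<^sup>2 *\<^sub>R w)"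
proof -
  define p where "p = u - t *\<^sub>R (\<i> *\<^sub>C v)"
  have "(p, v - t *\<^sub>R (\<i> *\<^sub>C w)) \<in> A"
    unfolding p_def by (intro diff scaleR scaleC assms)
  from lower_bound[OF this, of t]
  have p: "norm p \<le> M * norm (u + t\<^sup>2 *\<^sub>R w)"
    by (simp add: p_def scaleC_diff_right scaleC_scaleR power2_eq_square algebra_simps)
  have "norm u \<le> M * norm p" using lower_bound[OF assms(1), of "-t"] by (simp add: p_def)
  also have "\<dots> \<le> M * (M * norm (u + t\<^sup>2 *\<^sub>R w))"
    using p M_ge_1 by (intro mult_left_mono) auto
  finally show u: "norm u \<le> M\<^sup>2 * norm (u + t\<^sup>2 *\<^sub>R w)" by (simp add: power2_eq_square)
  have "norm (t *\<^sub>R v) = norm (u - p)" by (simp add: p_def)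
  also have "\<dots> \<le> norm u + norm p" by (rule norm_triangle_ineq4)
  also have "norm p \<le> M * (M * norm (u + t\<^sup>2 *\<^sub>R w))"
    using p M_ge_1 mult_right_mono[of 1 M "M * norm (u + t\<^sup>2 *\<^sub>R w)"] by (simp add: order_trans)
  finally show "norm (t *\<^sub>R v) \<le> 2 * M\<^sup>2 * norm (u + t\<^sup>2 *\<^sub>R w)"
    using u by (simp add: power2_eq_square)
qed

text \<open>The bounded operators \<open>(I + t\<^sup>2 A\<^sup>2)\<^sup>-\<^sup>1\<close> and \<open>t A (I + t\<^sup>2 A\<^sup>2)\<^sup>-\<^sup>1\<close>.\<close>

definition res :: "real \<Rightarrow> 'a \<Rightarrow> 'a"
  where "res t f = (THE u. \<exists>v w. (u, v) \<in> A \<and> (v, w) \<in> A \<and> u + t\<^sup>2 *\<^sub>R w = f)"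

definition quo :: "real \<Rightarrow> 'a \<Rightarrow> 'a"
  where "quo t f = t *\<^sub>R op_app A (res t f)"

lemma res_eq:
  assumes "(u, v) \<in> A" "(v, w) \<in> A" "u + t\<^sup>2 *\<^sub>R w = f"
  shows "res t f = u" "quo t f = t *\<^sub>R v"
proof -
  show "res t f = u" unfolding res_def
  proof (rule the_equality)
    show "\<exists>v w. (u, v) \<in> A \<and> (v, w) \<in> A \<and> u + t\<^sup>2 *\<^sub>R w = f" using assms by blast
    fix u' assume "\<exists>v w. (u', v) \<in> A \<and> (v, w) \<in> A \<and> u' + t\<^sup>2 *\<^sub>R w = f"
    then obtain v' w' where *: "(u', v') \<in> A" "(v', w') \<in> A" "u' + t\<^sup>2 *\<^sub>R w' = f" by blast
    have "(u' - u) + t\<^sup>2 *\<^sub>R (w' - w) = 0" using * assms by (simp add: algebra_simps)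
    then have "norm (u' - u) \<le> 0"
      using sq_chain_bound(1)[OF diff[OF *(1) assms(1)] diff[OF *(2) assms(2)], of t] by simp
    then show "u' = u" by simp
  qed
  then show "quo t f = t *\<^sub>R v" unfolding quo_def using op_app_eq[OF lin assms(1)] by simp
qed

text \<open>Identities between the operators \<open>res\<close> and \<open>quo\<close> are checked on such chains \<open>u, v = Au, w = A\<^sup>2u\<close> with
\<open>u + t\<^sup>2 w = f\<close>, since a chain determines \<open>res t f\<close> and \<open>quo t f\<close>.\<close>

lemma res_chain:
  assumes "t \<noteq> 0"
  obtains v w where "(res t f, v) \<in> A" "(v, w) \<in> A" "res t f + t\<^sup>2 *\<^sub>R w = f" "quo t f = t *\<^sub>R v"
  using sq_chain_exists[OF assms, of f] res_eq by metis

lemma res_quo_in: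
  assumes "t \<noteq> 0"
  shows "(res t f, (1/t) *\<^sub>R quo t f) \<in> A" "(quo t f, (1/t) *\<^sub>R (f - res t f)) \<in> A"
proof -
  obtain v w where *: "(res t f, v) \<in> A" "(v, w) \<in> A" "res t f + t\<^sup>2 *\<^sub>R w = f" "quo t f = t *\<^sub>R v"
    by (rule res_chain[OF assms])
  then show "(res t f, (1/t) *\<^sub>R quo t f) \<in> A" using assms by simp
  have "f - res t f = t\<^sup>2 *\<^sub>R w" using *(3) by (simp add: algebra_simps)
  then have "(1/t) *\<^sub>R (f - res t f) = t *\<^sub>R w" using assms by (simp add: power2_eq_square)
  then show "(quo t f, (1/t) *\<^sub>R (f - res t f)) \<in> A" using scaleR[OF *(2), of t] *(4) by simp
qed

lemma bounded_clinear_res_quo: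
  assumes t: "t \<noteq> 0"
  shows "bounded_clinear (res t)"
    and bounded_clinear_quo: "bounded_clinear (quo t)"
proof -
  have add': "res t (f + g) = res t f + res t g \<and> quo t (f + g) = quo t f + quo t g" for f g
  proof -
    obtain v w where f: "(res t f, v) \<in> A" "(v, w) \<in> A" "res t f + t\<^sup>2 *\<^sub>R w = f" "quo t f = t *\<^sub>R v"
      by (rule res_chain[OF t])
    obtain v' w' where g: "(res t g, v') \<in> A" "(v', w') \<in> A" "res t g + t\<^sup>2 *\<^sub>R w' = g" "quo t g = t *\<^sub>R v'"
      by (rule res_chain[OF t])
    have "(res t f + res t g) + t\<^sup>2 *\<^sub>R (w + w') = (res t f + t\<^sup>2 *\<^sub>R w) + (res t g + t\<^sup>2 *\<^sub>R w')"
      by (simp add: algebra_simps)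
    then have "(res t f + res t g) + t\<^sup>2 *\<^sub>R (w + w') = f + g" by (simp only: f(3) g(3))
    from res_eq[OF add[OF f(1) g(1)] add[OF f(2) g(2)] this] show ?thesis
      using f(4) g(4) by (simp add: algebra_simps)
  qed
  have sc: "res t (c *\<^sub>C f) = c *\<^sub>C res t f \<and> quo t (c *\<^sub>C f) = c *\<^sub>C quo t f" for c f
  proof -
    obtain v w where f: "(res t f, v) \<in> A" "(v, w) \<in> A" "res t f + t\<^sup>2 *\<^sub>R w = f" "quo t f = t *\<^sub>R v"
      by (rule res_chain[OF t])
    have "c *\<^sub>C res t f + t\<^sup>2 *\<^sub>R (c *\<^sub>C w) = c *\<^sub>C f"
      by (subst (2) f(3)[symmetric]) (simp add: scaleC_add_right scaleC_scaleR)
    from res_eq[OF scaleC[OF f(1)] scaleC[OF f(2)] this] show ?thesis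
      using f(4) by (simp add: scaleC_scaleR)
  qed
  have scR: "res t (r *\<^sub>R f) = r *\<^sub>R res t f \<and> quo t (r *\<^sub>R f) = r *\<^sub>R quo t f" for r f
    using sc[of "of_real r" f] by (simp add: scaleC_of_real)
  have b: "norm (res t f) \<le> M\<^sup>2 * norm f \<and> norm (quo t f) \<le> 2 * M\<^sup>2 * norm f" for f
  proof -
    obtain v w where f: "(res t f, v) \<in> A" "(v, w) \<in> A" "res t f + t\<^sup>2 *\<^sub>R w = f" "quo t f = t *\<^sub>R v"
      by (rule res_chain[OF t])
    show ?thesis using sq_chain_bound[OF f(1,2), of t] f(3,4) by simp
  qed
  have "bounded_linear (res t)" using add' scR b
    by (intro bounded_linear_intro[where K = "M\<^sup>2"]) (auto simp: mult.commute)
  then show "bounded_clinear (res t)" using sc by (simp add: bounded_clinear_def)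
  have "bounded_linear (quo t)" using add' scR b
    by (intro bounded_linear_intro[where K = "2 * M\<^sup>2"]) (auto simp: mult.commute)
  then show "bounded_clinear (quo t)" using sc by (simp add: bounded_clinear_def)
qed

lemma norm_res: "t \<noteq> 0 \<Longrightarrow> norm (res t f) \<le> 2 * M\<^sup>2 * norm f"
  and norm_quo: "t \<noteq> 0 \<Longrightarrow> norm (quo t f) \<le> 2 * M\<^sup>2 * norm f"
proof -
  assume t: "t \<noteq> 0"
  obtain v w where f: "(res t f, v) \<in> A" "(v, w) \<in> A" "res t f + t\<^sup>2 *\<^sub>R w = f" "quo t f = t *\<^sub>R v"
    by (rule res_chain[OF t])
  show "norm (quo t f) \<le> 2 * M\<^sup>2 * norm f" using sq_chain_bound[OF f(1,2), of t] f(3,4) by simp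
  have "0 \<le> M\<^sup>2 * norm f" by simp
  moreover have "norm (res t f) \<le> M\<^sup>2 * norm f" using sq_chain_bound[OF f(1,2), of t] f(3,4) by simp
  ultimately show "norm (res t f) \<le> 2 * M\<^sup>2 * norm f" by linarith
qed

lemma res_linear: "t \<noteq> 0 \<Longrightarrow> linear (res t)" and quo_linear: "t \<noteq> 0 \<Longrightarrow> linear (quo t)"
  using bounded_clinear_res_quo by (auto simp: bounded_clinear_def bounded_linear.linear)

lemma res_quo_commute_A:
  assumes t: "t \<noteq> 0" and f: "(f, g) \<in> A"
  shows "(res t f, res t g) \<in> A" "(quo t f, quo t g) \<in> A" "quo t f = t *\<^sub>R res t g"
proof -
  obtain v w where *: "(res t f, v) \<in> A" "(v, w) \<in> A" "res t f + t\<^sup>2 *\<^sub>R w = f" "quo t f = t *\<^sub>R v"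
    by (rule res_chain[OF t])
  have "f - res t f = t\<^sup>2 *\<^sub>R w" using *(3) by (simp add: algebra_simps)
  then have w: "w = (1/t\<^sup>2) *\<^sub>R (f - res t f)" using t by simp
  have wA: "(w, (1/t\<^sup>2) *\<^sub>R (g - v)) \<in> A" unfolding w by (intro scaleR diff f *)
  have "v + t\<^sup>2 *\<^sub>R ((1/t\<^sup>2) *\<^sub>R (g - v)) = g" using t by simp
  from res_eq[OF *(2) wA this] have g: "res t g = v" "quo t g = t *\<^sub>R w" by auto
  show "(res t f, res t g) \<in> A" using *(1) g by simp
  show "quo t f = t *\<^sub>R res t g" using * g by simp
  show "(quo t f, quo t g) \<in> A" using scaleR[OF *(2), of t] *(4) g by simp
qed

lemma commutes_with_res_quo:
  assumes t: "t \<noteq> 0" and X: "linear X" "\<And>f g. (f, g) \<in> A \<Longrightarrow> (X f, X g) \<in> A"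
  shows "res t (X f) = X (res t f)" "quo t (X f) = X (quo t f)"
proof -
  obtain v w where *: "(res t f, v) \<in> A" "(v, w) \<in> A" "res t f + t\<^sup>2 *\<^sub>R w = f" "quo t f = t *\<^sub>R v"
    by (rule res_chain[OF t])
  have "X (res t f) + t\<^sup>2 *\<^sub>R X w = X f"
    using *(3) X(1) by (metis linear_add linear_scale)
  from res_eq[OF X(2)[OF *(1)] X(2)[OF *(2)] this] *(4)
  show "res t (X f) = X (res t f)" "quo t (X f) = X (quo t f)"
    using linear_scale[OF X(1)] by auto
qed

lemma quo_res_commute: "s \<noteq> 0 \<Longrightarrow> t \<noteq> 0 \<Longrightarrow> quo t (res s f) = res s (quo t f)"
  and quo_quo_commute: "s \<noteq> 0 \<Longrightarrow> t \<noteq> 0 \<Longrightarrow> quo t (quo s f) = quo s (quo t f)"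
  using commutes_with_res_quo[of t "res s" f] commutes_with_res_quo[of t "quo s" f]
  by (simp_all add: res_linear quo_linear res_quo_commute_A(1,2))

text \<open>The resolvent identity for \<open>A\<^sup>2\<close>, in the form
\<open>R\<^sub>s - R\<^sub>t = (t\<^sup>2 - s\<^sup>2) A\<^sup>2 R\<^sub>s R\<^sub>t\<close>. Read from right to left it is the partial fraction decomposition of a product of
two values of \<open>quo\<close>.\<close>

lemma res_diff:
  assumes s: "s \<noteq> 0" and t: "t \<noteq> 0"
  shows "res s f - res t f = (t / s - s / t) *\<^sub>R quo t (quo s f)"
proof -
  obtain v w where *: "(res s f, v) \<in> A" "(v, w) \<in> A" "res s f + s\<^sup>2 *\<^sub>R w = f" "quo s f = s *\<^sub>R v"
    by (rule res_chain[OF s])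
  have 1: "res t (res s f + t\<^sup>2 *\<^sub>R w) = res s f" by (rule res_eq[OF *(1,2) refl])
  have "res t (res s f + t\<^sup>2 *\<^sub>R w) - res t (res s f + s\<^sup>2 *\<^sub>R w) = res t ((t\<^sup>2 - s\<^sup>2) *\<^sub>R w)"
    by (simp add: algebra_simps flip: linear_diff[OF res_linear[OF t]])
  then have "res s f - res t f = (t\<^sup>2 - s\<^sup>2) *\<^sub>R res t w"
    by (simp add: 1 *(3) linear_scale[OF res_linear[OF t]])
  moreover have "quo t (quo s f) = (s * t) *\<^sub>R res t w"
    by (simp add: *(4) linear_scale[OF quo_linear[OF t]] res_quo_commute_A(3)[OF t *(2)])
  moreover have "(t / s - s / t) * (s * t) = t\<^sup>2 - s\<^sup>2"
    using s t by (simp add: field_simps power2_eq_square)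
  ultimately show ?thesis by simp
qed

lemma quo_quo: "t \<noteq> 0 \<Longrightarrow> quo t (quo t f) = res t f - res t (res t f)"
proof -
  assume t: "t \<noteq> 0"
  have "quo t (quo t f) = t *\<^sub>R res t ((1/t) *\<^sub>R (f - res t f))"
    by (rule res_quo_commute_A(3)[OF t res_quo_in(2)[OF t]])
  also have "\<dots> = res t f - res t (res t f)"
    using t by (simp add: linear_scale[OF res_linear[OF t]] linear_diff[OF res_linear[OF t]])
  finally show ?thesis .
qed

text \<open>Apply \<open>tA\<close> to the resolvent identity \<open>res_diff\<close>. This gives continuity and derivatives of \<open>quo\<close> in \<open>t\<close>.\<close>

lemma quo_diff:
  assumes s: "s \<noteq> 0" and t: "t \<noteq> 0"
  shows "quo t f - quo s f
    = (s / t - t / s) *\<^sub>R (quo s f - res t (quo s f)) + (t / s - 1) *\<^sub>R quo s f"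
proof -
  have 1: "(res t f - res s f, (1/t) *\<^sub>R quo t f - (1/s) *\<^sub>R quo s f) \<in> A"
    by (intro diff res_quo_in s t)
  have "((s / t - t / s) *\<^sub>R quo t (quo s f),
         (s / t - t / s) *\<^sub>R (1/t) *\<^sub>R (quo s f - res t (quo s f))) \<in> A"
    by (intro scaleR res_quo_in t)
  moreover have "(s / t - t / s) *\<^sub>R quo t (quo s f) = res t f - res s f"
    using res_diff[OF t s, of f] quo_quo_commute[OF s t, of f] by simp
  ultimately have "(1/t) *\<^sub>R quo t f - (1/s) *\<^sub>R quo s f
      = (s / t - t / s) *\<^sub>R (1/t) *\<^sub>R (quo s f - res t (quo s f))"
    using linear_operator_fun[OF lin] 1 by metis
  then have "t *\<^sub>R ((1/t) *\<^sub>R quo t f - (1/s) *\<^sub>R quo s f)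
      = t *\<^sub>R ((s / t - t / s) *\<^sub>R (1/t) *\<^sub>R (quo s f - res t (quo s f)))" by simp
  then have "quo t f - (t / s) *\<^sub>R quo s f = (s / t - t / s) *\<^sub>R (quo s f - res t (quo s f))"
    using t by (simp add: scaleR_diff_right)
  then show ?thesis by (simp add: algebra_simps)
qed

end

section \<open>Strong limits and derivatives of the resolvent family\<close>

text \<open>Joint continuity of a uniformly bounded, strongly convergent family.\<close>

lemma tendsto_strong:
  fixes X :: "'b \<Rightarrow> 'a::real_normed_vector \<Rightarrow> 'c::real_normed_vector"
  assumes lin: "\<And>y. linear (X y)" and bd: "\<And>y g. norm (X y g) \<le> C * norm g"
    and p: "(p \<longlongrightarrow> p0) F" and L: "((\<lambda>y. X y p0) \<longlongrightarrow> L) F"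
  shows "((\<lambda>y. X y (p y)) \<longlongrightarrow> L) F"
proof -
  have "((\<lambda>y. C * norm (p y - p0)) \<longlongrightarrow> 0) F"
    using p by (intro tendsto_mult_right_zero tendsto_norm_zero LIM_zero)
  then have "((\<lambda>y. X y (p y) - X y p0) \<longlongrightarrow> 0) F"
    by (rule Lim_null_comparison[rotated])
      (use bd in \<open>simp flip: linear_diff[OF lin]\<close>)
  from tendsto_add[OF this L] show ?thesis by simp
qed

lemma tendsto_zero_closure:
  fixes X :: "'b \<Rightarrow> 'a::real_normed_vector \<Rightarrow> 'c::real_normed_vector"
  assumes lin: "\<And>y. linear (X y)" and bd: "\<And>y g. norm (X y g) \<le> C * norm g"
    and S: "\<And>s. s \<in> S \<Longrightarrow> ((\<lambda>y. X y s) \<longlongrightarrow> 0) F" and f: "f \<in> closure S"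
  shows "((\<lambda>y. X y f) \<longlongrightarrow> 0) F"
proof (rule tendstoI)
  fix e :: real assume "e > 0"
  have C: "0 \<le> \<bar>C\<bar>" by simp
  obtain s where s: "s \<in> S" "dist s f < e / (2 * (\<bar>C\<bar> + 1))"
    using f \<open>e > 0\<close> unfolding closure_approachable
    by (metis C add_nonneg_pos divide_pos_pos mult_pos_pos zero_less_numeral zero_less_one)
  have "eventually (\<lambda>y. dist (X y s) 0 < e / 2) F"
    using S[OF s(1)] \<open>e > 0\<close> by (intro tendstoD) auto
  then show "eventually (\<lambda>y. dist (X y f) 0 < e) F"
  proof eventually_elim
    case (elim y)
    have "norm (X y f) \<le> norm (X y s) + norm (X y (f - s))"
      using norm_triangle_ineq[of "X y s" "X y (f - s)"] by (simp add: linear_diff[OF lin])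
    also have "norm (X y (f - s)) \<le> (\<bar>C\<bar> + 1) * norm (f - s)"
      using bd[of y "f - s"] mult_right_mono[of C "\<bar>C\<bar> + 1" "norm (f - s)"]
      by (meson abs_ge_self add_increasing2 norm_ge_zero order_trans zero_le_one)
    also have "(\<bar>C\<bar> + 1) * norm (f - s) \<le> e / 2"
      using s(2) C by (simp add: dist_norm norm_minus_commute field_simps)
    finally show ?case using elim by simp
  qed
qed

text \<open>A product whose scalar factor vanishes at \<open>x\<close> is differentiable there as soon as the vector factor is
continuous. The difference formulas for \<open>R\<close> and \<open>Q\<close> have this form, so strong continuity alone yields their
derivatives.\<close>

lemma has_vector_derivative_null_factor:
  fixes p :: "real \<Rightarrow> 'a::real_normed_vector"
  assumes c: "(c has_real_derivative c') (at x)" "c x = 0" and p: "isCont p x"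
  shows "((\<lambda>y. c y *\<^sub>R p y) has_vector_derivative c' *\<^sub>R p x) (at x)"
proof -
  have q: "((\<lambda>y. c y / (y - x)) \<longlongrightarrow> c') (at x)"
    using c by (simp add: has_field_derivative_iff)
  have "((\<lambda>y. (c y / (y - x)) *\<^sub>R p y) \<longlongrightarrow> c' *\<^sub>R p x) (at x)"
    by (intro tendsto_scaleR q isContD[OF p])
  then have 1: "((\<lambda>y. norm ((c y / (y - x)) *\<^sub>R p y - c' *\<^sub>R p x)) \<longlongrightarrow> 0) (at x)"
    by (intro tendsto_norm_zero LIM_zero)
  show ?thesis
    unfolding has_vector_derivative_def has_derivative_iff_norm
  proof (intro conjI bounded_linear_scaleR_left)
    show "((\<lambda>y. norm (c y *\<^sub>R p y - c x *\<^sub>R p x - (y - x) *\<^sub>R c' *\<^sub>R p x) / norm (y - x)) \<longlongrightarrow> 0) (at x)"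
    proof (rule Lim_transform_eventually[OF 1])
      show "eventually (\<lambda>y. norm ((c y / (y - x)) *\<^sub>R p y - c' *\<^sub>R p x) =
         norm (c y *\<^sub>R p y - c x *\<^sub>R p x - (y - x) *\<^sub>R c' *\<^sub>R p x) / norm (y - x)) (at x)"
        unfolding eventually_at_filter
      proof (intro always_eventually allI impI)
        fix y assume "y \<noteq> x"
        then have "c y *\<^sub>R p y - (y - x) *\<^sub>R c' *\<^sub>R p x
            = (y - x) *\<^sub>R ((c y / (y - x)) *\<^sub>R p y - c' *\<^sub>R p x)"
          by (simp add: scaleR_diff_right)
        with \<open>y \<noteq> x\<close> c(2) show "norm ((c y / (y - x)) *\<^sub>R p y - c' *\<^sub>R p x) =
            norm (c y *\<^sub>R p y - c x *\<^sub>R p x - (y - x) *\<^sub>R c' *\<^sub>R p x) / norm (y - x)"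
          by simp
      qed
    qed
  qed
qed

context bisectorial
begin

text \<open>In the variable \<open>x = ln t\<close> the measure \<open>dt/t\<close> becomes the translation invariant measure \<open>dx\<close>.\<close>

definition R :: "real \<Rightarrow> 'a \<Rightarrow> 'a" where "R x = res (exp x)"
definition Q :: "real \<Rightarrow> 'a \<Rightarrow> 'a" where "Q x = quo (exp x)"
definition K :: real where "K = 2 * M\<^sup>2"

lemma K_nonneg: "0 \<le> K" by (simp add: K_def)

lemma R_linear: "linear (R x)" and Q_linear: "linear (Q x)"
  by (simp_all add: R_def Q_def res_linear quo_linear)

lemma Q_bounded_linear: "bounded_linear (Q x)"
  using bounded_clinear_res_quo[of "exp x"] by (simp_all add: R_def Q_def bounded_clinear_def)

lemma norm_R: "norm (R x f) \<le> K * norm f" and norm_Q: "norm (Q x f) \<le> K * norm f"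
  by (simp_all add: R_def Q_def K_def norm_res norm_quo)

lemma Q_Q_commute: "Q x (Q y f) = Q y (Q x f)"
  by (simp add: Q_def quo_quo_commute)

lemma Q_Q: "Q x (Q x f) = R x f - R x (R x f)"
  by (simp add: Q_def R_def quo_quo)

lemma R_diff: "R x f - R y f = (exp (y - x) - exp (x - y)) *\<^sub>R Q y (Q x f)"
  using res_diff[of "exp x" "exp y" f] by (simp add: Q_def R_def exp_diff)

lemma Q_diff: "Q y f - Q x f
    = (exp (x - y) - exp (y - x)) *\<^sub>R (Q x f - R y (Q x f)) + (exp (y - x) - 1) *\<^sub>R Q x f"
  using quo_diff[of "exp x" "exp y" f] by (simp add: Q_def R_def exp_diff)

lemma isCont_R: "isCont (\<lambda>y. R y f) x"
proof -
  have "((\<lambda>y. \<bar>exp (y - x) - exp (x - y)\<bar> * (K * (K * norm f))) \<longlongrightarrow> 0) (at x)"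
    by (rule tendsto_eq_intros refl | simp)+
  moreover have "norm (R y f - R x f) \<le> \<bar>exp (y - x) - exp (x - y)\<bar> * (K * (K * norm f))" for y
  proof -
    have "norm (R y f - R x f) = \<bar>exp (y - x) - exp (x - y)\<bar> * norm (Q y (Q x f))"
      unfolding norm_minus_commute[of "R y f"] R_diff[of x f y] by simp
    also have "norm (Q y (Q x f)) \<le> K * (K * norm f)"
      using norm_Q[of y "Q x f"] mult_left_mono[OF norm_Q[of x f] K_nonneg] by linarith
    finally show ?thesis by (simp add: mult_left_mono)
  qed
  ultimately have "((\<lambda>y. R y f - R x f) \<longlongrightarrow> 0) (at x)"
    by (intro Lim_null_comparison[where f = "\<lambda>y. R y f - R x f"] always_eventually allI)
  then show ?thesis by (simp add: isCont_def LIM_zero_iff)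
qed

lemma isCont_Q: "isCont (\<lambda>y. Q y f) x"
proof -
  have "((\<lambda>y. (exp (x - y) - exp (y - x)) *\<^sub>R (Q x f - R y (Q x f)) + (exp (y - x) - 1) *\<^sub>R Q x f)
      \<longlongrightarrow> 0) (at x)"
    by (rule tendsto_eq_intros refl isContD[OF isCont_R] | simp)+
  then show ?thesis
    unfolding isCont_def LIM_zero_iff[symmetric, of _ "Q x f"] by (simp only: Q_diff)
qed

lemma tendsto_R: "(p \<longlongrightarrow> p0) F \<Longrightarrow> (x \<longlongrightarrow> x0) F \<Longrightarrow> ((\<lambda>y. R (x y) (p y)) \<longlongrightarrow> R x0 p0) F"
  and tendsto_Q: "(p \<longlongrightarrow> p0) F \<Longrightarrow> (x \<longlongrightarrow> x0) F \<Longrightarrow> ((\<lambda>y. Q (x y) (p y)) \<longlongrightarrow> Q x0 p0) F"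
  by (rule tendsto_strong[where C = K and p = p and ?p0.0 = p0];
      simp add: R_linear Q_linear norm_R norm_Q isCont_tendsto_compose[OF isCont_R]
        isCont_tendsto_compose[OF isCont_Q])+

lemma continuous_on_R: "continuous_on S x \<Longrightarrow> continuous_on S p \<Longrightarrow> continuous_on S (\<lambda>y. R (x y) (p y))"
  and continuous_on_Q: "continuous_on S x \<Longrightarrow> continuous_on S p \<Longrightarrow> continuous_on S (\<lambda>y. Q (x y) (p y))"
  by (simp_all add: continuous_on_def tendsto_R tendsto_Q)

lemma R_has_vector_derivative:
  "((\<lambda>y. R y f) has_vector_derivative (-2) *\<^sub>R Q x (Q x f)) (at x)"
proof -
  have *: "R y f = R x f + (exp (x - y) - exp (y - x)) *\<^sub>R Q y (Q x f)" for y
    using R_diff[of x f y] by (simp add: algebra_simps)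
  have "((\<lambda>y. (exp (x - y) - exp (y - x)) *\<^sub>R Q y (Q x f)) has_vector_derivative (-2) *\<^sub>R Q x (Q x f)) (at x)"
    by (rule has_vector_derivative_null_factor) (auto intro!: derivative_eq_intros isCont_Q)
  from has_vector_derivative_add[OF has_vector_derivative_const[of "R x f"] this]
  show ?thesis by (subst *) simp
qed

lemma Q_expand: "Q y f = Q x f
    + ((exp (x - y) - exp (y - x)) *\<^sub>R (Q x f - R y (Q x f)) + (exp (y - x) - 1) *\<^sub>R Q x f)"
  using Q_diff[of y f x] by (simp add: algebra_simps)

lemma Q_has_vector_derivative:
  "((\<lambda>y. Q y f) has_vector_derivative 2 *\<^sub>R R x (Q x f) - Q x f) (at x)"
proof -
  have 1: "((\<lambda>y. (exp (x - y) - exp (y - x)) *\<^sub>R (Q x f - R y (Q x f)))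
      has_vector_derivative (-2) *\<^sub>R (Q x f - R x (Q x f))) (at x)"
    by (rule has_vector_derivative_null_factor) (auto intro!: derivative_eq_intros isCont_R continuous_intros)
  have 2: "((\<lambda>y. (exp (y - x) - 1) *\<^sub>R Q x f) has_vector_derivative 1 *\<^sub>R Q x f) (at x)"
    by (rule has_vector_derivative_null_factor) (auto intro!: derivative_eq_intros)
  from has_vector_derivative_add[OF has_vector_derivative_const[of "Q x f"] has_vector_derivative_add[OF 1 2]]
  have "((\<lambda>y. Q y f) has_vector_derivative
     0 + ((-2) *\<^sub>R (Q x f - R x (Q x f)) + 1 *\<^sub>R Q x f)) (at x)"
    by (subst Q_expand[of _ _ x])
  moreover have "0 + ((-2) *\<^sub>R (Q x f - R x (Q x f)) + 1 *\<^sub>R Q x f) = 2 *\<^sub>R R x (Q x f) - Q x f"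
    by (simp add: algebra_simps flip: scaleR_2)
  ultimately show ?thesis by simp
qed

lemma R_Q_has_vector_derivative:
  "((\<lambda>y. R y (Q y f)) has_vector_derivative R x (Q x f) - 4 *\<^sub>R Q x (Q x (Q x f))) (at x)"
proof -
  have *: "R y (Q y f) = R y (Q x f) + ((exp (x - y) - exp (y - x)) *\<^sub>R R y (Q x f - R y (Q x f))
      + (exp (y - x) - 1) *\<^sub>R R y (Q x f))" for y
    by (subst Q_expand[of _ _ x]) (simp add: linear_add[OF R_linear] linear_scale[OF R_linear])
  have 1: "((\<lambda>y. (exp (x - y) - exp (y - x)) *\<^sub>R R y (Q x f - R y (Q x f)))
      has_vector_derivative (-2) *\<^sub>R R x (Q x f - R x (Q x f))) (at x)"
    by (rule has_vector_derivative_null_factor)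
      (auto intro!: derivative_eq_intros tendsto_intros tendsto_R simp: isCont_def)
  have 2: "((\<lambda>y. (exp (y - x) - 1) *\<^sub>R R y (Q x f)) has_vector_derivative 1 *\<^sub>R R x (Q x f)) (at x)"
    by (rule has_vector_derivative_null_factor) (auto intro!: derivative_eq_intros isCont_R)
  from has_vector_derivative_add[OF R_has_vector_derivative[of "Q x f"] has_vector_derivative_add[OF 1 2]]
  have "((\<lambda>y. R y (Q y f)) has_vector_derivative
     (-2) *\<^sub>R Q x (Q x (Q x f)) + ((-2) *\<^sub>R R x (Q x f - R x (Q x f)) + 1 *\<^sub>R R x (Q x f))) (at x)"
    by (subst *)
  moreover have "R x (Q x f - R x (Q x f)) = Q x (Q x (Q x f))"
    unfolding Q_Q[of x "Q x f"] by (simp add: linear_diff[OF R_linear])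
  moreover have "(-2) *\<^sub>R v + ((-2) *\<^sub>R v + 1 *\<^sub>R w) = w - 4 *\<^sub>R v" for v w :: 'a
  proof -
    have "(-2) *\<^sub>R v + ((-2) *\<^sub>R v + 1 *\<^sub>R w) = ((-2) + (-2)) *\<^sub>R v + w"
      by (simp only: scaleR_add_left scaleR_one add.assoc)
    then show ?thesis by simp
  qed
  ultimately show ?thesis by (simp only:)
qed

text \<open>From \<open>Q' = 2RQ - Q\<close> and \<open>(RQ)' = RQ - 4Q\<^sup>3\<close> one gets \<open>(Q/8 - RQ/4)' = Q\<^sup>3 - Q/8\<close>.\<close>

lemma integral_Q_cubed:
  assumes "c \<le> d"
  shows "integral {c..d} (\<lambda>x. Q x (Q x (Q x f))) = (1/8) *\<^sub>R integral {c..d} (\<lambda>x. Q x f)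
    + (((1/8) *\<^sub>R Q d f - (1/4) *\<^sub>R R d (Q d f)) - ((1/8) *\<^sub>R Q c f - (1/4) *\<^sub>R R c (Q c f)))"
proof -
  define E where "E x = (1/8) *\<^sub>R Q x f - (1/4) *\<^sub>R R x (Q x f)" for x
  have "(E has_vector_derivative Q x (Q x (Q x f)) - (1/8) *\<^sub>R Q x f) (at x)" for x
  proof -
    have "(E has_vector_derivative (1/8) *\<^sub>R (2 *\<^sub>R R x (Q x f) - Q x f)
       - (1/4) *\<^sub>R (R x (Q x f) - 4 *\<^sub>R Q x (Q x (Q x f)))) (at x)"
      unfolding E_def
      by (intro has_vector_derivative_diff
          bounded_linear.has_vector_derivative[OF bounded_linear_scaleR_right]
          Q_has_vector_derivative R_Q_has_vector_derivative)
    moreover have "(1/8) *\<^sub>R (2 *\<^sub>R r - q) - (1/4) *\<^sub>R (r - 4 *\<^sub>R q3) = q3 - (1/8) *\<^sub>R q" for r q q3 :: 'a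
      by (simp add: algebra_simps)
    ultimately show ?thesis by simp
  qed
  then have "((\<lambda>x. Q x (Q x (Q x f)) - (1/8) *\<^sub>R Q x f) has_integral (E d - E c)) {c..d}"
    by (intro fundamental_theorem_of_calculus assms) (auto intro: has_vector_derivative_at_within)
  moreover have "((\<lambda>x. (1/8) *\<^sub>R Q x f) has_integral (1/8) *\<^sub>R integral {c..d} (\<lambda>x. Q x f)) {c..d}"
    by (intro has_integral_cmul integrable_integral integrable_continuous_real continuous_on_Q continuous_intros)
  ultimately have "((\<lambda>x. Q x (Q x (Q x f)) - (1/8) *\<^sub>R Q x f + (1/8) *\<^sub>R Q x f) has_integral
     (E d - E c) + (1/8) *\<^sub>R integral {c..d} (\<lambda>x. Q x f)) {c..d}"
    by (rule has_integral_add)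
  then show ?thesis unfolding E_def by (simp add: integral_unique add.commute)
qed

lemma Q_in_range: "Q x f \<in> Range A"
  using scaleR[OF res_quo_in(1)[of "exp x" f], of "exp x"] by (auto simp: Q_def)

lemma R_in_domain: "R x f \<in> Domain A"
  using res_quo_in(1)[of "exp x" f] by (auto simp: R_def)

lemma R_in_range: "f \<in> Range A \<Longrightarrow> R x f \<in> Range A"
  using res_quo_commute_A(1)[of "exp x"] by (force simp: R_def)

lemma Q_null_space: "f \<in> null_space A \<Longrightarrow> Q x f = 0"
  using res_quo_commute_A(3)[of "exp x" f 0] linear_0[OF res_linear[of "exp x"]]
  by (simp add: null_space_def Q_def)

text \<open>On the domain of \<open>A\<close> both \<open>Q(x)f\<close> and \<open>f - R(x)f\<close> are \<open>e\<^sup>x\<close> times a bounded family applied to \<open>Af\<close>; the domain is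
dense.\<close>

lemma tendsto_Q_at_bot: "((\<lambda>x. Q x f) \<longlongrightarrow> 0) at_bot"
  and tendsto_R_at_bot: "((\<lambda>x. R x f) \<longlongrightarrow> f) at_bot"
proof -
  have lim: "((\<lambda>x. exp x * (K * norm g)) \<longlongrightarrow> 0) at_bot" for g :: 'a
    by (intro tendsto_mult_left_zero exp_at_bot)
  have f: "f \<in> closure (Domain A)" by (simp add: dense_domain)
  show "((\<lambda>x. Q x f) \<longlongrightarrow> 0) at_bot"
  proof (rule tendsto_zero_closure[OF Q_linear norm_Q _ f])
    fix f assume "f \<in> Domain A"
    then obtain g where g: "(f, g) \<in> A" by blast
    show "((\<lambda>x. Q x f) \<longlongrightarrow> 0) at_bot"
      by (rule Lim_null_comparison[OF _ lim[of g]])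
        (use g norm_R in \<open>auto simp: Q_def R_def res_quo_commute_A(3)[OF _ g]\<close>)
  qed
  have "((\<lambda>x. f - R x f) \<longlongrightarrow> 0) at_bot"
  proof (rule tendsto_zero_closure[OF _ _ _ f])
    show "linear (\<lambda>f. f - R x f)" for x by (intro linear_compose_sub linear_ident R_linear)
    show "norm (f - R x f) \<le> (1 + K) * norm f" for x f
      using norm_triangle_ineq4[of f "R x f"] norm_R[of x f] by (simp add: algebra_simps)
    fix f assume "f \<in> Domain A"
    then obtain g where g: "(f, g) \<in> A" by blast
    have "(1 / exp x) *\<^sub>R (f - R x f) = Q x g" for x
      using linear_operator_fun[OF lin res_quo_in(2)[of "exp x" f] res_quo_commute_A(2)[OF _ g, of "exp x"]]
      by (simp add: Q_def R_def)
    then have "exp x *\<^sub>R ((1 / exp x) *\<^sub>R (f - R x f)) = exp x *\<^sub>R Q x g" for x by simp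
    then have *: "f - R x f = exp x *\<^sub>R Q x g" for x by simp
    show "((\<lambda>x. f - R x f) \<longlongrightarrow> 0) at_bot"
      by (rule Lim_null_comparison[OF _ lim[of g]]) (use norm_Q in \<open>auto simp: *\<close>)
  qed
  from tendsto_diff[OF tendsto_const this, of f] show "((\<lambda>x. R x f) \<longlongrightarrow> f) at_bot" by simp
qed

text \<open>For \<open>f = Ag\<close> both \<open>Q(x)f\<close> and \<open>R(x)f\<close> are \<open>e\<^sup>-\<^sup>x\<close> times a bounded family applied to \<open>g\<close>.\<close>

lemma tendsto_at_top_on_range:
  assumes f: "f \<in> closure (Range A)"
  shows tendsto_Q_at_top: "((\<lambda>x. Q x f) \<longlongrightarrow> 0) at_top"
    and tendsto_R_at_top: "((\<lambda>x. R x f) \<longlongrightarrow> 0) at_top"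
proof -
  have lim: "((\<lambda>x. exp (- x) * C) \<longlongrightarrow> 0) at_top" for C :: real
    by (intro tendsto_mult_left_zero filterlim_compose[OF exp_at_bot] filterlim_uminus_at_bot_at_top)
  show "((\<lambda>x. Q x f) \<longlongrightarrow> 0) at_top"
  proof (rule tendsto_zero_closure[OF Q_linear norm_Q _ f])
    fix f assume "f \<in> Range A"
    then obtain g where g: "(g, f) \<in> A" by blast
    have "Q x f = (1 / exp x) *\<^sub>R (g - R x g)" for x
      using linear_operator_fun[OF lin res_quo_in(2)[of "exp x" g] res_quo_commute_A(2)[OF _ g, of "exp x"]]
      by (simp add: Q_def R_def)
    then have *: "Q x f = exp (- x) *\<^sub>R (g - R x g)" for x by (simp add: exp_minus inverse_eq_divide)
    have "norm (g - R x g) \<le> (1 + K) * norm g" for x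
      using norm_triangle_ineq4[of g "R x g"] norm_R[of x g] by (simp add: algebra_simps)
    then show "((\<lambda>x. Q x f) \<longlongrightarrow> 0) at_top"
      by (intro Lim_null_comparison[OF _ lim[of "(1 + K) * norm g"]]) (auto simp: *)
  qed
  show "((\<lambda>x. R x f) \<longlongrightarrow> 0) at_top"
  proof (rule tendsto_zero_closure[OF R_linear norm_R _ f])
    fix f assume "f \<in> Range A"
    then obtain g where g: "(g, f) \<in> A" by blast
    have "exp (- x) *\<^sub>R Q x g = exp (- x) *\<^sub>R (exp x *\<^sub>R R x f)" for x
      using res_quo_commute_A(3)[OF _ g, of "exp x"] by (simp add: Q_def R_def)
    then have *: "R x f = exp (- x) *\<^sub>R Q x g" for x by (simp flip: exp_add)
    show "((\<lambda>x. R x f) \<longlongrightarrow> 0) at_top"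
      by (intro Lim_null_comparison[OF _ lim[of "K * norm g"]]) (use norm_Q in \<open>auto simp: *\<close>)
  qed
qed

lemma subspace_closure_range: "subspace (closure (Range A))"
  unfolding subspace_def
proof (intro conjI ballI allI)
  have "(0, 0) \<in> A" using lin by (simp add: linear_operator_def subspace_def zero_prod_def)
  then have "0 \<in> Range A" by (rule RangeI)
  then show "0 \<in> closure (Range A)" by (rule closure_subset[THEN subsetD])
next
  fix x y assume "x \<in> closure (Range A)" "y \<in> closure (Range A)"
  then obtain X Y where *: "\<And>n. X n \<in> Range A" "X \<longlonglongrightarrow> x" "\<And>n. Y n \<in> Range A" "Y \<longlonglongrightarrow> y"
    unfolding closure_sequential by blast
  have "X n + Y n \<in> Range A" for n
  proof -
    obtain u v where "(u, X n) \<in> A" "(v, Y n) \<in> A" using *(1,3) by blast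
    from add[OF this] show ?thesis by blast
  qed
  with tendsto_add[OF *(2,4)] show "x + y \<in> closure (Range A)"
    unfolding closure_sequential by (intro exI[of _ "\<lambda>n. X n + Y n"] conjI allI)
next
  fix c x assume "x \<in> closure (Range A)"
  then obtain X where *: "\<And>n. X n \<in> Range A" "X \<longlonglongrightarrow> x"
    unfolding closure_sequential by blast
  have "c *\<^sub>R X n \<in> Range A" for n
  proof -
    obtain u where "(u, X n) \<in> A" using *(1) by blast
    from scaleR[OF this] show ?thesis by blast
  qed
  with tendsto_scaleR[OF tendsto_const *(2)] show "c *\<^sub>R x \<in> closure (Range A)"
    unfolding closure_sequential by (intro exI[of _ "\<lambda>n. c *\<^sub>R X n"] conjI allI)
qed

text \<open>The vectors \<open>R(x)f\<close> with \<open>f\<close> in the range lie in the domain and in the range, and converge to \<open>f\<close> as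
\<open>x \<rightarrow> -\<infinity>\<close>.\<close>

lemma dense_domain_range: "closure (Domain A \<inter> Range A) = closure (Range A)"
proof
  have "f \<in> closure (Domain A \<inter> Range A)" if "f \<in> Range A" for f
  proof (rule Lim_in_closed_set[OF closed_closure _ _ tendsto_R_at_bot])
    show "eventually (\<lambda>x. R x f \<in> closure (Domain A \<inter> Range A)) at_bot"
      using R_in_domain R_in_range[OF that]
        closure_subset[of "Domain A \<inter> Range A"] by (intro always_eventually) blast
  qed simp
  then show "closure (Range A) \<subseteq> closure (Domain A \<inter> Range A)"
    by (intro closure_minimal) auto
qed (simp add: closure_mono)

end

section \<open>Integrals of continuous vector-valued functions\<close>

text \<open>An antiderivative on the whole line reduces shifts and substitutions of vector-valued integrals to the
chain rule.\<close>

lemma continuous_antiderivative: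
  fixes \<phi> :: "real \<Rightarrow> 'a::banach"
  assumes "continuous_on UNIV \<phi>"
  shows "\<exists>P. (\<forall>x. (P has_vector_derivative \<phi> x) (at x)) \<and>
    (\<forall>c d. c \<le> d \<longrightarrow> integral {c..d} \<phi> = P d - P c)"
proof -
  define P where "P x = integral {0..x} \<phi> - integral {x..0} \<phi>" for x
  have cont: "continuous_on S \<phi>" for S using assms continuous_on_subset by blast
  have int: "\<phi> integrable_on {c..d}" for c d by (rule integrable_continuous_real[OF cont])
  have comb: "a \<le> b \<Longrightarrow> b \<le> c \<Longrightarrow> integral {a..c} \<phi> = integral {a..b} \<phi> + integral {b..c} \<phi>" for a b c
    using Henstock_Kurzweil_Integration.integral_combine[of a b c \<phi>] int by simp
  have P: "P y = integral {a..y} \<phi> - integral {a..0} \<phi>" if "a \<le> 0" "a \<le> y" for a y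
  proof (cases "0 \<le> y")
    case True
    then have "integral {y..0} \<phi> = 0" by (cases "y = 0") auto
    moreover have "integral {a..y} \<phi> = integral {a..0} \<phi> + integral {0..y} \<phi>"
      using that True by (intro comb)
    ultimately show ?thesis unfolding P_def by simp
  next
    case False
    then have "integral {a..0} \<phi> = integral {a..y} \<phi> + integral {y..0} \<phi>"
      using that by (intro comb) auto
    moreover have "integral {0..y} \<phi> = 0" using False by simp
    ultimately show ?thesis unfolding P_def by simp
  qed
  have D: "(P has_vector_derivative \<phi> x) (at x)" for x
  proof -
    define a where "a = min x 0 - 1"
    have "((\<lambda>y. integral {a..y} \<phi> - integral {a..0} \<phi>) has_vector_derivative \<phi> x - 0) (at x within {a..x + 1})"
      by (intro has_vector_derivative_diff has_vector_derivative_const integral_has_vector_derivative cont)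
        (auto simp: a_def)
    then have "((\<lambda>y. integral {a..y} \<phi> - integral {a..0} \<phi>) has_vector_derivative \<phi> x) (at x within {a<..<x + 1})"
      by (auto intro: has_vector_derivative_within_subset)
    moreover have "x \<in> {a<..<x+1}" by (auto simp: a_def)
    ultimately have "((\<lambda>y. integral {a..y} \<phi> - integral {a..0} \<phi>) has_vector_derivative \<phi> x) (at x)"
      by (simp only: has_vector_derivative_within_open[of x "{a<..<x+1}"] open_greaterThanLessThan)
    then show ?thesis
      by (rule has_vector_derivative_transform_within_open[of _ _ _ "{a<..<x+1}"])
        (auto simp: a_def intro!: P[symmetric])
  qed
  have I: "integral {c..d} \<phi> = P d - P c" if "c \<le> d" for c d
    by (intro integral_unique fundamental_theorem_of_calculus that)
      (auto intro: has_vector_derivative_at_within D)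
  show ?thesis
  proof (intro exI[of _ P] conjI allI impI)
    show "(P has_vector_derivative \<phi> x) (at x)" for x by (rule D)
    show "integral {c..d} \<phi> = P d - P c" if "c \<le> d" for c d by (rule I[OF that])
  qed
qed

lemma integral_shift_real:
  fixes \<phi> :: "real \<Rightarrow> 'a::banach"
  assumes "continuous_on UNIV \<phi>"
  shows "integral {c..d} (\<lambda>x. \<phi> (x + u)) = integral {c + u..d + u} \<phi>"
proof (cases "c \<le> d")
  case True
  obtain P where P: "(\<forall>x. (P has_vector_derivative \<phi> x) (at x)) \<and>
      (\<forall>c d. c \<le> d \<longrightarrow> integral {c..d} \<phi> = P d - P c)"
    using continuous_antiderivative[OF assms] ..
  note P = P[THEN conjunct1, rule_format] P[THEN conjunct2, rule_format]
  have "((\<lambda>x. \<phi> (x + u)) has_integral P (d + u) - P (c + u)) {c..d}"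
  proof (rule fundamental_theorem_of_calculus[OF True])
    fix x
    have "((P \<circ> (\<lambda>x. x + u)) has_vector_derivative 1 *\<^sub>R \<phi> (x + u)) (at x)"
      by (rule vector_diff_chain_at) (auto intro!: derivative_eq_intros P)
    then show "((\<lambda>x. P (x + u)) has_vector_derivative \<phi> (x + u)) (at x within {c..d})"
      by (auto simp: o_def intro: has_vector_derivative_at_within)
  qed
  then show ?thesis using P(2)[of "c + u" "d + u"] True by (simp add: integral_unique)
qed simp

lemma has_integral_log_substitution:
  fixes \<phi> :: "real \<Rightarrow> 'a::banach"
  assumes "continuous_on UNIV \<phi>" and k: "k > 0" and ab: "0 < a" "a \<le> b"
  shows "((\<lambda>t. (1 / t) *\<^sub>R \<phi> (k * ln t)) has_integral (1 / k) *\<^sub>R integral {k * ln a..k * ln b} \<phi>) {a..b}"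
proof -
  obtain P where P: "(\<forall>x. (P has_vector_derivative \<phi> x) (at x)) \<and>
      (\<forall>c d. c \<le> d \<longrightarrow> integral {c..d} \<phi> = P d - P c)"
    using continuous_antiderivative[OF assms(1)] ..
  note P = P[THEN conjunct1, rule_format] P[THEN conjunct2, rule_format]
  have "((\<lambda>t. (1 / t) *\<^sub>R \<phi> (k * ln t)) has_integral
      (1 / k) *\<^sub>R P (k * ln b) - (1 / k) *\<^sub>R P (k * ln a)) {a..b}"
  proof (rule fundamental_theorem_of_calculus[OF ab(2)])
    fix x assume "x \<in> {a..b}"
    then have x: "x > 0" using ab by auto
    have "((P \<circ> (\<lambda>t. k * ln t)) has_vector_derivative (k * (1 / x)) *\<^sub>R \<phi> (k * ln x)) (at x)"
      using x by (intro vector_diff_chain_at P)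
        (auto intro!: derivative_eq_intros simp flip: has_real_derivative_iff_has_vector_derivative)
    then have "((\<lambda>t. (1 / k) *\<^sub>R (P \<circ> (\<lambda>t. k * ln t)) t) has_vector_derivative
        (1 / k) *\<^sub>R (k * (1 / x)) *\<^sub>R \<phi> (k * ln x)) (at x)"
      by (rule bounded_linear.has_vector_derivative[OF bounded_linear_scaleR_right])
    then show "((\<lambda>t. (1 / k) *\<^sub>R P (k * ln t)) has_vector_derivative (1 / x) *\<^sub>R \<phi> (k * ln x))
        (at x within {a..b})"
      using k by (auto simp: o_def intro: has_vector_derivative_at_within)
  qed
  moreover have "k * ln a \<le> k * ln b" using ab k by simp
  ultimately show ?thesis by (simp add: P(2) scaleR_diff_right)
qed

text \<open>Otherwise a vector orthogonal to \<open>V\<close>, but not to the integral, gives a contradiction.\<close>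

lemma integral_in_closed_subspace:
  fixes \<phi> :: "real \<Rightarrow> 'a::{real_inner, banach}"
  assumes V: "subspace V" "closed V" and \<phi>: "\<phi> integrable_on S" "\<And>x. \<phi> x \<in> V"
  shows "integral S \<phi> \<in> V"
proof (rule ccontr)
  assume "integral S \<phi> \<notin> V"
  then obtain g where g: "inner (integral S \<phi>) g \<noteq> 0" "\<forall>v\<in>V. inner v g = 0"
    using orthogonal_vector_exists[OF V] by blast
  have "integral S (\<lambda>x. inner (\<phi> x) g) = inner (integral S \<phi>) g"
    using integral_linear[OF \<phi>(1) bounded_linear_inner_left] by (simp add: o_def)
  with g \<phi>(2) show False by simp
qed

section \<open>The square of the integrated family\<close>

text \<open>The kernel \<open>u / (2 sinh u)\<close>, extended continuously to \<open>0\<close>.\<close>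

definition sinh_kernel :: "real \<Rightarrow> real"
  where "sinh_kernel u = (if u = 0 then 1 / 2 else u / (exp u - exp (- u)))"

lemma sinh_kernel_abs: "sinh_kernel \<bar>u\<bar> = sinh_kernel u"
proof -
  have "u / (exp u - exp (- u)) = (- u) / (exp (- u) - exp u)"
    by (metis minus_diff_eq minus_divide_divide)
  then show ?thesis by (auto simp: sinh_kernel_def abs_if)
qed

lemma sinh_kernel_pos: "sinh_kernel u > 0"
  unfolding sinh_kernel_abs[of u, symmetric] by (auto simp: sinh_kernel_def)

text \<open>The additional factor \<open>1 + \<bar>u\<bar>\<close> absorbs the growth in \<open>u\<close> of the error in \<open>inner_integral_bound\<close>. The constant
comes from the crude bound \<open>e\<^sup>v = (e\<^sup>v\<^sup>/\<^sup>4)\<^sup>4 \<ge> (1 + v/4)\<^sup>4\<close>, whose top coefficient is \<open>1/256\<close>.\<close>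

lemma sinh_kernel_decay: "sinh_kernel u * (1 + \<bar>u\<bar>) \<le> 256 / (1 + u\<^sup>2)"
proof (cases "u = 0")
  case False
  define v where "v = \<bar>u\<bar>"
  have v: "v > 0" using False by (simp add: v_def)
  define w where "w = v / 4"
  have w: "w > 0" "v = 4 * w" using v by (simp_all add: w_def)
  have "(1 + w) ^ 4 \<le> exp w ^ 4" using w(1) exp_ge_add_one_self[of w] by (intro power_mono) auto
  also have "\<dots> = exp v" by (simp add: w(2) flip: exp_of_nat_mult)
  finally have "(1 + w) ^ 4 \<le> exp v" .
  moreover have "(1 + w) ^ 4 = 1 + 4 * w + 6 * w^2 + 4 * w^3 + w^4" by algebra
  moreover have "exp (- v) \<le> 1" using v by simp
  ultimately have "4 * w + 6 * w^2 + 4 * w^3 + w^4 \<le> exp v - exp (- v)" by linarith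
  moreover have lin: "4 * w + 16 * p + 64 * q + 256 * r \<le> 256 * E"
    if "4 * w + 6 * p + 4 * q + r \<le> E" "0 \<le> p" "0 \<le> q" for p q r E :: real
    using that w(1) by linarith
  ultimately have "4 * w + 16 * w^2 + 64 * w^3 + 256 * w^4 \<le> 256 * (exp v - exp (- v))"
    using w(1) by (intro lin) auto
  moreover have "v * (1 + v) * (1 + v\<^sup>2) = 4 * w + 16 * w^2 + 64 * w^3 + 256 * w^4"
    unfolding w(2) by algebra
  ultimately have 1: "v * (1 + v) * (1 + v\<^sup>2) \<le> 256 * (exp v - exp (- v))" by (simp only:)
  have pos: "exp v - exp (- v) > 0" "1 + v\<^sup>2 > 0" using v by (auto simp: add_pos_nonneg)
  have k: "sinh_kernel \<bar>u\<bar> = v / (exp v - exp (- v))"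
    unfolding v_def[symmetric] sinh_kernel_def using v by simp
  have "sinh_kernel u * (1 + \<bar>u\<bar>) = v * (1 + v) / (exp v - exp (- v))"
    unfolding k[unfolded sinh_kernel_abs] v_def[symmetric] by simp
  also have "\<dots> \<le> 256 / (1 + v\<^sup>2)"
    using 1 pos by (subst pos_divide_le_eq[OF pos(1)], subst times_divide_eq_left, subst pos_le_divide_eq[OF pos(2)])
  finally show ?thesis by (simp add: v_def)
qed (simp add: sinh_kernel_def)

lemma continuous_on_sinh_kernel: "continuous_on UNIV sinh_kernel"
proof -
  have "isCont sinh_kernel u" for u
  proof (cases "u = 0")
    case True
    have "((\<lambda>u::real. exp u - exp (- u)) has_real_derivative 2) (at 0)"
      by (auto intro!: derivative_eq_intros)
    then have "((\<lambda>u::real. (exp u - exp (- u)) / u) \<longlongrightarrow> 2) (at 0)"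
      by (simp add: has_field_derivative_iff)
    then have "((\<lambda>u::real. inverse ((exp u - exp (- u)) / u)) \<longlongrightarrow> inverse 2) (at 0)"
      by (intro tendsto_inverse) auto
    moreover have "eventually (\<lambda>u. inverse ((exp u - exp (- u)) / u) = sinh_kernel u) (at (0::real))"
      unfolding eventually_at_filter by (intro always_eventually) (auto simp: sinh_kernel_def)
    ultimately have "(sinh_kernel \<longlongrightarrow> inverse 2) (at 0)" by (rule Lim_transform_eventually)
    then show ?thesis using True by (simp add: isCont_def sinh_kernel_def inverse_eq_divide)
  next
    case False
    have "isCont (\<lambda>u. u / (exp u - exp (- u))) u" using False by (intro continuous_intros) auto
    moreover have ev: "eventually (\<lambda>u. u / (exp u - exp (- u)) = sinh_kernel u) (nhds u)"
      using t1_space_nhds[OF False] by eventually_elim (auto simp: sinh_kernel_def)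
    ultimately show ?thesis using isCont_cong[OF ev] by simp
  qed
  then show ?thesis by (simp add: continuous_at_imp_continuous_on)
qed

lemma integral_inverse_1_plus_square_le:
  assumes "(m::real) \<ge> 0"
  shows "((\<lambda>u. 256 / (1 + u\<^sup>2)) has_integral 512 * arctan m) {-m..m}" "512 * arctan m \<le> 1024"
proof -
  have "((\<lambda>u. 256 * arctan u) has_vector_derivative 256 / (1 + u\<^sup>2)) (at u within {-m..m})" for u
    by (rule has_vector_derivative_at_within)
      (auto intro!: derivative_eq_intros simp: divide_inverse
        simp flip: has_real_derivative_iff_has_vector_derivative)
  then have "((\<lambda>u. 256 / (1 + u\<^sup>2)) has_integral 256 * arctan m - 256 * arctan (-m)) {-m..m}"
    using assms by (intro fundamental_theorem_of_calculus) auto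
  then show "((\<lambda>u. 256 / (1 + u\<^sup>2)) has_integral 512 * arctan m) {-m..m}"
    by (simp add: arctan_minus)
  show "512 * arctan m \<le> 1024" using arctan_ubound[of m] pi_less_4 by simp
qed

lemma sinh_kernel_integral_converges:
  obtains \<kappa> where "\<kappa> > 0" "(\<lambda>m. integral {- real m..real m} sinh_kernel) \<longlonglongrightarrow> \<kappa>"
proof -
  have int: "sinh_kernel integrable_on {c..d}" for c d
    by (intro integrable_continuous_real continuous_on_subset[OF continuous_on_sinh_kernel]) auto
  define \<kappa>m where "\<kappa>m m = integral {- real m..real m} sinh_kernel" for m
  have inc: "incseq \<kappa>m"
    unfolding \<kappa>m_def
  proof (intro incseq_SucI integral_subset_le int ballI)
    show "0 \<le> sinh_kernel u" for u using sinh_kernel_pos[of u] by simp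
  qed auto
  have bd: "\<kappa>m m \<le> 1024" for m
  proof -
    note I = integral_inverse_1_plus_square_le(1)[of "real m"]
    have "\<kappa>m m \<le> integral {- real m..real m} (\<lambda>u. 256 / (1 + u\<^sup>2))"
      unfolding \<kappa>m_def
    proof (rule integral_le[OF int])
      show "(\<lambda>u. 256 / (1 + u\<^sup>2)) integrable_on {- real m..real m}" using I by auto
      fix u :: real
      have "sinh_kernel u * 1 \<le> sinh_kernel u * (1 + \<bar>u\<bar>)"
        using sinh_kernel_pos[of u] by (intro mult_left_mono) auto
      also have "\<dots> \<le> 256 / (1 + u\<^sup>2)" by (rule sinh_kernel_decay)
      finally show "sinh_kernel u \<le> 256 / (1 + u\<^sup>2)" by simp
    qed
    then show ?thesis using integral_unique[OF I] integral_inverse_1_plus_square_le(2)[of "real m"] by simp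
  qed
  obtain \<kappa> where \<kappa>: "\<kappa>m \<longlonglongrightarrow> \<kappa>" "\<And>m. \<kappa>m m \<le> \<kappa>"
    using incseq_convergent[OF inc, of 1024] bd by auto
  have "\<exists>u\<in>{-1..1}. \<forall>v\<in>{-1..1}. sinh_kernel u \<le> sinh_kernel v"
    by (intro continuous_attains_inf compact_Icc continuous_on_subset[OF continuous_on_sinh_kernel]) auto
  then obtain u where u: "\<forall>v\<in>{-1..1}. sinh_kernel u \<le> sinh_kernel v" by blast
  have "integral {-1..1} (\<lambda>v::real. sinh_kernel u) \<le> integral {-1..1} sinh_kernel"
    by (intro integral_le int u[rule_format]) auto
  then have "0 < \<kappa>m 1" using sinh_kernel_pos[of u] by (simp add: \<kappa>m_def)
  with \<kappa>(2)[of 1] have "\<kappa> > 0" by simp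
  then show ?thesis using \<kappa>(1) unfolding \<kappa>m_def by (rule that)
qed

context bisectorial
begin

abbreviation V :: "'a set" where "V \<equiv> closure (Range A)"

lemma continuous_Q: "continuous_on S (\<lambda>x. Q x f)"
  and continuous_R: "continuous_on S (\<lambda>x. R x f)"
  by (intro continuous_on_Q continuous_on_R continuous_intros)+

lemma integral_Q_shift:
  "integral {c..d} (\<lambda>u. Q (x + u) f) = integral {c + x..d + x} (\<lambda>x. Q x f)"
  using integral_shift_real[OF continuous_Q, where c = c and d = d and u = x] by (simp add: add.commute)

text \<open>As a function of \<open>u\<close>, the left-hand side inside the norm vanishes at \<open>0\<close> and has derivative
\<open>R(u - n)f - f - R(n + u)f\<close>, so the mean value inequality applies.\<close>

lemma increment_bound:
  assumes w: "\<And>w. w \<in> closed_segment 0 u \<Longrightarrow> norm (R (w - n) f - f - R (n + w) f) \<le> E" and n: "0 \<le> n"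
  shows "norm (integral {-n..n} (\<lambda>x. R x f) - integral {-n..n} (\<lambda>x. R (x + u) f) - u *\<^sub>R f) \<le> \<bar>u\<bar> * E"
proof -
  obtain P where P: "(\<forall>x. (P has_vector_derivative R x f) (at x)) \<and>
      (\<forall>c d. c \<le> d \<longrightarrow> integral {c..d} (\<lambda>x. R x f) = P d - P c)"
    using continuous_antiderivative[OF continuous_R] ..
  note P = P[THEN conjunct1, rule_format] P[THEN conjunct2, rule_format]
  have comp: "((\<lambda>u. P (c + u)) has_vector_derivative R (c + u) f) (at u)" for c u
  proof -
    have "((P \<circ> (\<lambda>u. c + u)) has_vector_derivative 1 *\<^sub>R R (c + u) f) (at u)"
      by (rule vector_diff_chain_at) (auto intro!: derivative_eq_intros P)
    then show ?thesis by (simp add: o_def)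
  qed
  define \<psi> where "\<psi> u = P n - P (-n) - (P (n + u) - P (-n + u)) - u *\<^sub>R f" for u
  have \<psi>: "integral {-n..n} (\<lambda>x. R x f) - integral {-n..n} (\<lambda>x. R (x + u) f) - u *\<^sub>R f = \<psi> u"
    using n by (simp add: integral_shift_real[OF continuous_R] P(2) \<psi>_def)
  have D: "(\<psi> has_vector_derivative R (w - n) f - f - R (n + w) f) (at w)" for w
  proof -
    have "(\<psi> has_vector_derivative 0 - (R (n + w) f - R (-n + w) f) - 1 *\<^sub>R f) (at w)"
      unfolding \<psi>_def
      by (intro has_vector_derivative_diff has_vector_derivative_const comp)
        (auto intro!: derivative_eq_intros)
    then show ?thesis by (simp add: algebra_simps)
  qed
  have "norm (\<psi> u - \<psi> 0) \<le> E * norm (u - 0)"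
  proof (rule differentiable_bound[of "closed_segment 0 u" \<psi>])
    fix w assume "w \<in> closed_segment 0 u"
    show "(\<psi> has_derivative (\<lambda>h. h *\<^sub>R (R (w - n) f - f - R (n + w) f))) (at w within closed_segment 0 u)"
      using D by (simp add: has_vector_derivative_def has_derivative_at_withinI)
    have "norm (R (w - n) f - f - R (n + w) f) \<le> E" by (rule w) fact
    then show "onorm (\<lambda>h. h *\<^sub>R (R (w - n) f - f - R (n + w) f)) \<le> E"
      by (intro onorm_le) (simp add: mult.commute[of E] mult_left_mono)
  qed auto
  then show ?thesis unfolding \<psi> by (simp add: \<psi>_def mult.commute)
qed

text \<open>For bounded \<open>u\<close> the derivative in \<open>increment_bound\<close> is small once \<open>n\<close> is large, since \<open>R(x)f\<close> tends to \<open>f\<close> and to \<open>0\<close>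
at the two ends of the line. For \<open>\<bar>u\<bar>\<close> beyond a large threshold it is merely bounded, which the factor \<open>1 + \<bar>u\<bar>\<close>
compensates.\<close>

lemma inner_integral_bound:
  assumes f: "f \<in> V" and e: "e > 0"
  shows "\<exists>N. \<forall>n\<ge>N. \<forall>u. norm (integral {-n..n} (\<lambda>x. R x f) - integral {-n..n} (\<lambda>x. R (x + u) f) - u *\<^sub>R f)
      \<le> \<bar>u\<bar> * (e * (1 + \<bar>u\<bar>))"
proof -
  define M' where "M' = (2 * K + 1) * norm f"
  have M'0: "M' \<ge> 0" using K_nonneg by (simp add: M'_def)
  \<comment> \<open>the threshold for \<open>u\<close>: beyond it, \<open>e (1 + \<bar>u\<bar>)\<close> exceeds the trivial bound \<open>M'\<close>\<close>
  define U where "U = M' / e + 1"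
  have U: "U > 0" "M' \<le> e * U" using M'0 e by (auto simp: U_def field_simps add_nonneg_pos)
  have "eventually (\<lambda>x. dist (R x f) f < e / 2) at_bot"
    using e by (intro tendstoD[OF tendsto_R_at_bot]) simp
  then obtain a where a: "\<And>x. x \<le> a \<Longrightarrow> norm (R x f - f) < e / 2"
    unfolding eventually_at_bot_linorder dist_norm by blast
  have "eventually (\<lambda>x. dist (R x f) 0 < e / 2) at_top"
    using e by (intro tendstoD[OF tendsto_R_at_top[OF f]]) simp
  then obtain b where b: "\<And>x. x \<ge> b \<Longrightarrow> norm (R x f) < e / 2"
    unfolding eventually_at_top_linorder by auto
  define N where "N = max 0 (max (U - a) (b + U))"
  show ?thesis
  proof (intro exI[of _ N] allI impI)
    fix n u assume n: "N \<le> n"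
    show "norm (integral {-n..n} (\<lambda>x. R x f) - integral {-n..n} (\<lambda>x. R (x + u) f) - u *\<^sub>R f)
      \<le> \<bar>u\<bar> * (e * (1 + \<bar>u\<bar>))"
    proof (rule increment_bound)
      show "0 \<le> n" using n by (simp add: N_def)
      fix w assume "w \<in> closed_segment 0 u"
      then have w: "\<bar>w\<bar> \<le> \<bar>u\<bar>" by (auto simp: closed_segment_eq_real_ivl split: if_splits)
      show "norm (R (w - n) f - f - R (n + w) f) \<le> e * (1 + \<bar>u\<bar>)"
      proof (cases "\<bar>u\<bar> \<le> U")
        case True
        have "norm (R (w - n) f - f) < e / 2" using n w True by (intro a) (auto simp: N_def)
        moreover have "norm (R (n + w) f) < e / 2" using n w True by (intro b) (auto simp: N_def)
        ultimately have "norm (R (w - n) f - f - R (n + w) f) \<le> e"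
          using norm_triangle_ineq4[of "R (w - n) f - f" "R (n + w) f"] by simp
        also have "e * 1 \<le> e * (1 + \<bar>u\<bar>)" using e by (intro mult_left_mono) auto
        finally show ?thesis by simp
      next
        case False
        have "norm (R (w - n) f - f - R (n + w) f) \<le> norm (R (w - n) f) + norm f + norm (R (n + w) f)"
          using norm_triangle_ineq4[of "R (w - n) f - f" "R (n + w) f"] norm_triangle_ineq4[of "R (w - n) f" f]
          by simp
        also have "\<dots> \<le> M'" using norm_R[of "w - n" f] norm_R[of "n + w" f]
          by (simp add: M'_def algebra_simps)
        also have "\<dots> \<le> e * U" by (rule U)
        also have "\<dots> \<le> e * (1 + \<bar>u\<bar>)" using False e by (intro mult_left_mono) auto
        finally show ?thesis .
      qed
    qed
  qed
qed

lemma sinh_kernel_Q_Q: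
  assumes "u \<noteq> 0"
  shows "integral {c..d} (\<lambda>x. Q x (Q (x + u) f))
    = (1 / (exp u - exp (- u))) *\<^sub>R (integral {c..d} (\<lambda>x. R x f) - integral {c..d} (\<lambda>x. R (x + u) f))"
proof -
  have ne: "exp u - exp (- u) \<noteq> 0" using assms by simp
  have "R x f - R (x + u) f = (exp u - exp (- u)) *\<^sub>R Q x (Q (x + u) f)" for x
    using R_diff[of x f "x + u"] by (simp add: Q_Q_commute[of "x + u"])
  then have *: "Q x (Q (x + u) f) = (1 / (exp u - exp (- u))) *\<^sub>R (R x f - R (x + u) f)" for x
    using ne by simp
  have "integral {c..d} (\<lambda>x. R x f - R (x + u) f)
      = integral {c..d} (\<lambda>x. R x f) - integral {c..d} (\<lambda>x. R (x + u) f)"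
    by (intro Henstock_Kurzweil_Integration.integral_diff integrable_continuous_real
        continuous_on_R continuous_intros)
  then show ?thesis by (simp add: *)
qed

text \<open>By partial fractions the inner integral is \<open>sinh_kernel u / u\<close> times the difference of integrals in
\<open>inner_integral_bound\<close>. The estimate is uniform in \<open>m\<close>, so that \<open>m\<close> may tend to infinity before \<open>n\<close>.\<close>

lemma double_integral_estimate:
  assumes f: "f \<in> V" and e: "e > 0"
  shows "\<exists>N. \<forall>n\<ge>N. \<forall>m\<ge>0. norm (integral {-m..m} (\<lambda>u. integral {-n..n} (\<lambda>x. Q x (Q (x + u) f)))
      - integral {-m..m} sinh_kernel *\<^sub>R f) \<le> 1024 * e"
proof -
  obtain N where N: "\<And>n u. n \<ge> N \<Longrightarrow>
      norm (integral {-n..n} (\<lambda>x. R x f) - integral {-n..n} (\<lambda>x. R (x + u) f) - u *\<^sub>R f)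
      \<le> \<bar>u\<bar> * (e * (1 + \<bar>u\<bar>))"
    using inner_integral_bound[OF f e] by blast
  show ?thesis
  proof (intro exI[of _ N] allI impI)
    fix n m :: real assume n: "N \<le> n" and m: "0 \<le> m"
    define g where "g u = integral {-n..n} (\<lambda>x. Q x (Q (x + u) f))" for u
    have g: "continuous_on S g" for S
    proof -
      have "continuous_on (S \<times> cbox (-n) n) (\<lambda>(u, x). Q x (Q (x + u) f))"
        by (simp add: case_prod_unfold) (intro continuous_on_Q continuous_intros)
      from integral_continuous_on_param[OF this] show ?thesis
        by (simp add: g_def[abs_def])
    qed
    have ik: "sinh_kernel integrable_on {-m..m}"
      by (intro integrable_continuous_real continuous_on_subset[OF continuous_on_sinh_kernel]) auto
    have ikf: "(\<lambda>u. sinh_kernel u *\<^sub>R f) integrable_on {-m..m}"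
      using integrable_linear[OF ik bounded_linear_scaleR_left, of f] by (simp add: o_def)
    have ig: "g integrable_on {-m..m}" by (intro integrable_continuous_real g)
    \<comment> \<open>the partial fraction formula needs \<open>u \<noteq> 0\<close>; a single point does not affect the integral\<close>
    define D where "D u = (if u = 0 then 0 else g u - sinh_kernel u *\<^sub>R f)" for u
    have iD: "D integrable_on {-m..m}"
      by (rule integrable_spike[OF Henstock_Kurzweil_Integration.integrable_diff[OF ig ikf], of "{0}"])
        (auto simp: D_def)
    have "integral {-m..m} g - integral {-m..m} sinh_kernel *\<^sub>R f
        = integral {-m..m} (\<lambda>u. g u - sinh_kernel u *\<^sub>R f)"
      using integral_linear[OF ik bounded_linear_scaleR_left, of f]
      by (simp add: Henstock_Kurzweil_Integration.integral_diff[OF ig ikf] o_def)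
    also have "\<dots> = integral {-m..m} D"
      by (rule integral_spike[of "{0}"]) (auto simp: D_def)
    finally have eq: "integral {-m..m} g - integral {-m..m} sinh_kernel *\<^sub>R f = integral {-m..m} D" .
    note I = has_integral_mult_right[OF integral_inverse_1_plus_square_le(1)[OF m], of e]
    have "norm (integral {-m..m} D) \<le> integral {-m..m} (\<lambda>u. e * (256 / (1 + u\<^sup>2)))"
    proof (rule integral_norm_bound_integral[OF iD])
      show "(\<lambda>u. e * (256 / (1 + u\<^sup>2))) integrable_on {-m..m}" using I by auto
      fix u :: real
      show "norm (D u) \<le> e * (256 / (1 + u\<^sup>2))"
      proof (cases "u = 0")
        case False
        define s where "s = exp u - exp (- u)"
        have "g u - sinh_kernel u *\<^sub>R f = (1 / s) *\<^sub>R (integral {-n..n} (\<lambda>x. R x f)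
            - integral {-n..n} (\<lambda>x. R (x + u) f) - u *\<^sub>R f)"
          using False by (simp add: g_def sinh_kernel_Q_Q sinh_kernel_def s_def scaleR_diff_right)
        then have "norm (D u) = \<bar>1 / s\<bar> * norm (integral {-n..n} (\<lambda>x. R x f)
            - integral {-n..n} (\<lambda>x. R (x + u) f) - u *\<^sub>R f)"
          using False by (simp only: D_def norm_scaleR if_False)
        also have "\<dots> \<le> \<bar>1 / s\<bar> * (\<bar>u\<bar> * (e * (1 + \<bar>u\<bar>)))"
          by (intro mult_left_mono N n) auto
        also have "\<bar>1 / s\<bar> * \<bar>u\<bar> = \<bar>sinh_kernel u\<bar>"
          using False by (simp add: sinh_kernel_def s_def)
        then have "\<bar>1 / s\<bar> * (\<bar>u\<bar> * (e * (1 + \<bar>u\<bar>))) = e * (sinh_kernel u * (1 + \<bar>u\<bar>))"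
          using sinh_kernel_pos[of u] by (metis abs_of_pos mult.assoc mult.left_commute)
        also have "\<dots> \<le> e * (256 / (1 + u\<^sup>2))"
          using e sinh_kernel_decay[of u] by (intro mult_left_mono) auto
        finally show ?thesis .
      qed (use e in \<open>simp add: D_def\<close>)
    qed
    also have "\<dots> = e * (512 * arctan m)" using I by (rule integral_unique)
    also have "\<dots> \<le> e * 1024"
      using e integral_inverse_1_plus_square_le(2)[OF m] by (intro mult_left_mono) auto
    finally have "norm (integral {-m..m} g - integral {-m..m} sinh_kernel *\<^sub>R f) \<le> 1024 * e"
      unfolding eq by (simp only: mult.commute[of 1024])
    then show "norm (integral {-m..m} (\<lambda>u. integral {-n..n} (\<lambda>x. Q x (Q (x + u) f)))
      - integral {-m..m} sinh_kernel *\<^sub>R f) \<le> 1024 * e"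
      unfolding g_def[abs_def] .
  qed
qed

lemma double_integral_swap:
  "integral {-m..m} (\<lambda>u. integral {-n..n} (\<lambda>x. Q x (Q (x + u) f)))
   = integral {-n..n} (\<lambda>x. Q x (integral {x - m..x + m} (\<lambda>y. Q y f)))"
proof -
  have "continuous_on (cbox (-m, -n) (m, n)) (\<lambda>(u, x). Q x (Q (x + u) f))"
    by (simp add: case_prod_unfold) (intro continuous_on_Q continuous_intros)
  from integral_swap_continuous[OF this]
  have "integral {-m..m} (\<lambda>u. integral {-n..n} (\<lambda>x. Q x (Q (x + u) f)))
   = integral {-n..n} (\<lambda>x. integral {-m..m} (\<lambda>u. Q x (Q (x + u) f)))" by simp
  moreover have "integral {-m..m} (\<lambda>u. Q x (Q (x + u) f)) = Q x (integral {x - m..x + m} (\<lambda>y. Q y f))" for x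
  proof -
    have "(\<lambda>u. Q (x + u) f) integrable_on {-m..m}"
      by (intro integrable_continuous_real continuous_on_Q continuous_intros)
    from integral_linear[OF this Q_bounded_linear[of x]] show ?thesis
      unfolding o_def integral_Q_shift by (simp add: add.commute)
  qed
  ultimately show ?thesis by simp
qed

text \<open>After exchanging the integrations, the inner integral runs over \<open>[x - m, x + m]\<close>. It converges to \<open>g\<close> uniformly for
\<open>x\<close> in \<open>[-n, n]\<close>.\<close>

lemma tendsto_double_integral:
  assumes G: "((\<lambda>(c, d). integral {c..d} (\<lambda>x. Q x f)) \<longlongrightarrow> g) (at_bot \<times>\<^sub>F at_top)" and n: "0 \<le> n"
  shows "((\<lambda>m. integral {-m..m} (\<lambda>u. integral {-n..n} (\<lambda>x. Q x (Q (x + u) f))))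
     \<longlongrightarrow> integral {-n..n} (\<lambda>x. Q x g)) at_top"
proof (rule tendstoI)
  fix e :: real assume e: "e > 0"
  define e' where "e' = e / (2 * (n * K + 1))"
  have pos: "n * K + 1 > 0" using n K_nonneg by (simp add: add_nonneg_pos)
  have e': "e' > 0" "2 * n * K * e' < e"
  proof -
    show "e' > 0" using e pos by (simp add: e'_def)
    then have "2 * (n * K) * e' < 2 * (n * K + 1) * e'" by (intro mult_strict_right_mono) auto
    also have "\<dots> = e" using pos by (simp add: e'_def)
    finally show "2 * n * K * e' < e" by (simp add: mult_ac)
  qed
  have "eventually (\<lambda>p. dist ((\<lambda>(c, d). integral {c..d} (\<lambda>x. Q x f)) p) g < e') (at_bot \<times>\<^sub>F at_top)"
    using tendstoD[OF G e'(1)] .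
  then obtain P1 P2 where P: "eventually P1 at_bot" "eventually P2 at_top"
    "\<And>c d. P1 c \<Longrightarrow> P2 d \<Longrightarrow> dist (integral {c..d} (\<lambda>x. Q x f)) g < e'"
    unfolding eventually_prod_filter by auto
  then obtain a b where ab: "\<And>c. c \<le> a \<Longrightarrow> P1 c" "\<And>d. d \<ge> b \<Longrightarrow> P2 d"
    unfolding eventually_at_bot_linorder eventually_at_top_linorder by blast
  show "eventually (\<lambda>m. dist (integral {-m..m} (\<lambda>u. integral {-n..n} (\<lambda>x. Q x (Q (x + u) f))))
      (integral {-n..n} (\<lambda>x. Q x g)) < e) at_top"
    using eventually_ge_at_top[of "max (n - a) (b + n)"]
  proof eventually_elim
    case (elim m)
    let ?h = "\<lambda>x. integral {x - m..x + m} (\<lambda>y. Q y f)"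
    have cont: "continuous_on {-n..n} ?h"
    proof -
      have "continuous_on ({-n..n} \<times> cbox (-m) m) (\<lambda>(x, u). Q (x + u) f)"
        by (simp add: case_prod_unfold) (intro continuous_on_Q continuous_intros)
      from integral_continuous_on_param[OF this] show ?thesis
        by (simp add: integral_Q_shift add.commute)
    qed
    have "integral {-n..n} (\<lambda>x. Q x (?h x)) - integral {-n..n} (\<lambda>x. Q x g)
        = integral {-n..n} (\<lambda>x. Q x (?h x) - Q x g)"
      by (intro Henstock_Kurzweil_Integration.integral_diff[symmetric] integrable_continuous_real
          continuous_on_Q continuous_intros cont)
    also have "norm \<dots> \<le> integral {-n..n} (\<lambda>x. K * e')"
    proof (rule integral_norm_bound_integral)
      show "(\<lambda>x. Q x (?h x) - Q x g) integrable_on {-n..n}"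
        by (intro integrable_continuous_real continuous_on_Q continuous_intros cont)
      fix x assume x: "x \<in> {-n..n}"
      have "norm (Q x (?h x) - Q x g) \<le> K * norm (?h x - g)"
        using norm_Q[of x "?h x - g"] by (simp add: linear_diff[OF Q_linear])
      also have "norm (?h x - g) \<le> e'"
        using P(3)[OF ab(1) ab(2), of "x - m" "x + m"] x elim by (auto simp: dist_norm)
      finally show "norm (Q x (?h x) - Q x g) \<le> K * e'"
        using K_nonneg by (simp add: mult_left_mono)
    qed auto
    also have "\<dots> = 2 * n * K * e'" using n by simp
    finally show ?case using e'(2) by (simp add: double_integral_swap dist_norm)
  qed
qed

text \<open>Compute the limit of the double integral of \<open>Q(x) Q(x + u) f\<close> in two ways: letting \<open>m\<close> and then \<open>n\<close> tend to
infinity gives \<open>G (G f)\<close> by \<open>tendsto_double_integral\<close>, and the integral of the kernel times \<open>f\<close> by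
\<open>double_integral_estimate\<close>.\<close>

lemma integrated_family_square:
  assumes G: "\<And>f. f \<in> V \<Longrightarrow> ((\<lambda>(c, d). integral {c..d} (\<lambda>x. Q x f)) \<longlongrightarrow> G f) (at_bot \<times>\<^sub>F at_top)"
  shows "\<exists>\<kappa>>0. \<forall>f\<in>V. G f \<in> V \<and> G (G f) = \<kappa> *\<^sub>R f"
proof -
  obtain \<kappa> where \<kappa>: "\<kappa> > 0" "(\<lambda>m. integral {- real m..real m} sinh_kernel) \<longlonglongrightarrow> \<kappa>"
    by (rule sinh_kernel_integral_converges)
  have lim: "filterlim (\<lambda>n::real. (-n, n)) (at_bot \<times>\<^sub>F at_top) at_top"
    by (intro filterlim_Pair filterlim_ident filterlim_uminus_at_bot_at_top)
  have sym: "((\<lambda>n. integral {-n..n} (\<lambda>x. Q x f)) \<longlongrightarrow> G f) at_top" if "f \<in> V" for f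
    using filterlim_compose[OF G[OF that] lim] by simp
  have GV: "G f \<in> V" if "f \<in> V" for f
  proof (rule Lim_in_closed_set[OF closed_closure _ _ sym[OF that]])
    have "integral {-n..n} (\<lambda>x. Q x f) \<in> V" for n
      using Q_in_range closure_subset
      by (intro integral_in_closed_subspace[OF subspace_closure_range closed_closure]
          integrable_continuous_real continuous_Q) blast
    then show "eventually (\<lambda>n. integral {-n..n} (\<lambda>x. Q x f) \<in> V) at_top" by simp
  qed simp
  have "G (G f) = \<kappa> *\<^sub>R f" if f: "f \<in> V" for f
  proof (rule tendsto_unique[OF _ sym[OF GV[OF f]]])
    show "((\<lambda>n. integral {-n..n} (\<lambda>x. Q x (G f))) \<longlongrightarrow> \<kappa> *\<^sub>R f) at_top"
    proof (rule tendstoI)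
      fix e :: real assume e: "e > 0"
      obtain N where N: "\<And>n m. n \<ge> N \<Longrightarrow> m \<ge> 0 \<Longrightarrow>
        norm (integral {-m..m} (\<lambda>u. integral {-n..n} (\<lambda>x. Q x (Q (x + u) f)))
          - integral {-m..m} sinh_kernel *\<^sub>R f) \<le> 1024 * (e / 2048)"
        using double_integral_estimate[OF f, of "e / 2048"] e by auto
      show "eventually (\<lambda>n. dist (integral {-n..n} (\<lambda>x. Q x (G f))) (\<kappa> *\<^sub>R f) < e) at_top"
        using eventually_ge_at_top[of "max 0 N"]
      proof eventually_elim
        case (elim n)
        have "((\<lambda>m. norm (integral {-real m..real m} (\<lambda>u. integral {-n..n} (\<lambda>x. Q x (Q (x + u) f)))
          - integral {-real m..real m} sinh_kernel *\<^sub>R f)) \<longlongrightarrow>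
          norm (integral {-n..n} (\<lambda>x. Q x (G f)) - \<kappa> *\<^sub>R f)) sequentially"
          using elim by (intro tendsto_intros \<kappa>
              filterlim_compose[OF tendsto_double_integral[OF G[OF f]] filterlim_real_sequentially]) auto
        then have "norm (integral {-n..n} (\<lambda>x. Q x (G f)) - \<kappa> *\<^sub>R f) \<le> 1024 * (e / 2048)"
          by (rule tendsto_upperbound) (use N elim in \<open>auto intro!: always_eventually\<close>)
        then show ?case using e by (simp add: dist_norm)
      qed
    qed
  qed simp
  with \<kappa>(1) GV show ?thesis by (intro exI[of _ \<kappa>]) simp
qed

end

section \<open>The operator BD\<close>

lemma mem_op_mult_graph: "(u, w) \<in> op_graph B \<circ>\<^sub>o D \<longleftrightarrow> (\<exists>v. (u, v) \<in> D \<and> w = B v)"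
  by (auto simp: op_mult_def op_graph_def)

locale accretive_product =
  fixes D :: "'a::chilbert operator" and B :: "'a \<Rightarrow> 'a" and \<delta> :: real
  assumes D: "self_adjoint D" and B: "bounded_clinear B" and \<delta>: "\<delta> > 0"
    and accretive: "(u, v) \<in> D \<Longrightarrow> \<delta> * (norm v)\<^sup>2 \<le> inner (B v) v"
begin

abbreviation A :: "'a operator" where "A \<equiv> op_graph B \<circ>\<^sub>o D"

lemma D_linear: "linear_operator D" and D_dense: "closure (Domain D) = UNIV"
  and D_adjoint: "op_adjoint D = D"
  using D by (auto simp: self_adjoint_def)

lemma B_bounded_linear: "bounded_linear B"
  using B by (auto simp: bounded_clinear_def)

lemma D_symmetric:
  assumes "(u, z) \<in> D" "(u', z') \<in> D"
  shows "inner z u' = inner u z'"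
proof -
  have "(u', z') \<in> op_adjoint D" using assms(2) D_adjoint by simp
  then have "cinner z u' = cinner u z'" using assms(1) by (auto simp: op_adjoint_def)
  then show ?thesis by (simp add: cinner_eq_inner)
qed

text \<open>The hypothesis says that \<open>(v, w)\<close> belongs to the adjoint of \<open>D\<close>. Testing with real inner products is
enough because \<open>D\<close> is a complex subspace.\<close>

lemma D_maximal:
  assumes *: "\<And>u z. (u, z) \<in> D \<Longrightarrow> inner z v = inner u w"
  shows "(v, w) \<in> D"
proof -
  have "cinner z v = cinner u w" if uz: "(u, z) \<in> D" for u z
  proof -
    have "inner (\<i> *\<^sub>C z) v = inner (\<i> *\<^sub>C u) w"
      by (rule *[OF linear_operator_scaleC[OF D_linear uz]])
    then show ?thesis using *[OF uz] by (simp add: cinner_eq_inner inner_ii_left)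
  qed
  then have "(v, w) \<in> op_adjoint D" by (auto simp: op_adjoint_def)
  then show ?thesis using D_adjoint by simp
qed

lemma D_closed:
  assumes "\<And>n. (U n, Z n) \<in> D" "U \<longlonglongrightarrow> u" "Z \<longlonglongrightarrow> z"
  shows "(u, z) \<in> D"
proof (rule D_maximal)
  fix x y assume xy: "(x, y) \<in> D"
  have "(\<lambda>n. inner y (U n)) \<longlonglongrightarrow> inner y u" by (intro tendsto_intros assms)
  moreover have "(\<lambda>n. inner y (U n)) = (\<lambda>n. inner x (Z n))"
    using D_symmetric[OF xy assms(1)] by auto
  moreover have "(\<lambda>n. inner x (Z n)) \<longlonglongrightarrow> inner x z" by (intro tendsto_intros assms)
  ultimately show "inner y u = inner x z" by (metis LIMSEQ_unique)
qed

text \<open>The left-hand side is, up to sign, the imaginary part of the quadratic form of \<open>D\<close>.\<close>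

lemma D_form_real: "(u, z) \<in> D \<Longrightarrow> inner u (\<i> *\<^sub>C z) = 0"
  using D_symmetric[of u z "\<i> *\<^sub>C u" "\<i> *\<^sub>C z"] linear_operator_scaleC[OF D_linear, of u z \<i>]
  by (simp add: inner_ii_left[of z u, symmetric] inner_commute[of z] inner_ii_left[of u z])

lemma norm_le_norm_B:
  assumes "(u, z) \<in> D"
  shows "\<delta> * norm z \<le> norm (B z)"
proof (cases "z = 0")
  case False
  have "\<delta> * norm z * norm z \<le> inner (B z) z" using accretive[OF assms] by (simp add: power2_eq_square)
  also have "\<dots> \<le> norm (B z) * norm z" by (rule norm_cauchy_schwarz)
  finally show ?thesis using False by (simp add: mult_le_cancel_right)
qed (simp add: linear_0[OF bounded_linear.linear[OF B_bounded_linear]])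

text \<open>Testing against \<open>iDu\<close> removes \<open>u\<close>, because \<open>D_form_real\<close> makes \<open>u\<close> orthogonal to \<open>iDu\<close>. Only the
accretive term remains.\<close>

lemma norm_D_le:
  assumes "(u, z) \<in> D"
  shows "\<bar>s\<bar> * \<delta> * norm z \<le> norm (u + s *\<^sub>R (\<i> *\<^sub>C B z))"
proof (cases "z = 0")
  case False
  define f where "f = u + s *\<^sub>R (\<i> *\<^sub>C B z)"
  have "inner f (\<i> *\<^sub>C z) = s * inner (B z) z"
    using D_form_real[OF assms] by (simp add: f_def inner_add_left inner_ii_left)
  then have "\<bar>s\<bar> * \<bar>inner (B z) z\<bar> \<le> norm f * norm z"
    using Cauchy_Schwarz_ineq2[of f "\<i> *\<^sub>C z"] by (simp add: abs_mult)
  moreover have "\<bar>s\<bar> * (\<delta> * (norm z)\<^sup>2) \<le> \<bar>s\<bar> * \<bar>inner (B z) z\<bar>"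
    using accretive[OF assms] by (intro mult_left_mono) auto
  ultimately have "(\<bar>s\<bar> * \<delta> * norm z) * norm z \<le> norm f * norm z"
    by (simp add: power2_eq_square mult_ac)
  then show ?thesis using False by (simp add: f_def mult_le_cancel_right)
qed simp

lemma A_linear: "linear_operator A"
proof -
  interpret bounded_linear B by (rule B_bounded_linear)
  have "single_valued A"
    using linear_operator_fun[OF D_linear] by (auto simp: single_valued_def mem_op_mult_graph)
  moreover have "subspace A"
    unfolding subspace_def
  proof (intro conjI ballI allI)
    have "(0, 0) \<in> D" using D_linear by (simp add: linear_operator_def subspace_def zero_prod_def)
    then show "0 \<in> A" unfolding zero_prod_def mem_op_mult_graph using zero by metis
  next
    fix x y assume "x \<in> A" "y \<in> A"
    then obtain u v u' v' where *: "x = (u, B v)" "y = (u', B v')" "(u, v) \<in> D" "(u', v') \<in> D"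
      by (cases x; cases y) (auto simp: mem_op_mult_graph)
    then show "x + y \<in> A"
      using linear_operator_add[OF D_linear *(3,4)] by (auto simp: mem_op_mult_graph add)
  next
    fix c :: real and x assume "x \<in> A"
    then obtain u v where *: "x = (u, B v)" "(u, v) \<in> D"
      by (cases x) (auto simp: mem_op_mult_graph)
    then show "c *\<^sub>R x \<in> A"
      using linear_operator_scaleR[OF D_linear *(2), of c] by (auto simp: mem_op_mult_graph scaleR)
  qed
  moreover have "(c *\<^sub>C u, c *\<^sub>C v) \<in> A" if uv: "(u, v) \<in> A" for c u v
  proof -
    obtain z where z: "(u, z) \<in> D" "v = B z" using uv unfolding mem_op_mult_graph by blast
    have "B (c *\<^sub>C z) = c *\<^sub>C B z" using B by (simp add: bounded_clinear_def)
    then show ?thesis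
      unfolding mem_op_mult_graph using linear_operator_scaleC[OF D_linear z(1), of c] z(2) by metis
  qed
  ultimately show ?thesis by (simp add: linear_operator_def)
qed

text \<open>The range of \<open>I + isBD\<close> is closed by the lower bounds and because \<open>D\<close> is closed. If \<open>g\<close> is orthogonal to it, then
\<open>w = is B*g\<close> lies in the domain of the self-adjoint \<open>D\<close> and \<open>Dw = g\<close>; reality of \<open>(w, Dw)\<close> makes
\<open>Re (Bg, g)\<close> vanish, so \<open>g = 0\<close> by accretivity.\<close>

lemma product_bisectorial: "\<exists>M. bisectorial A M"
proof -
  interpret bounded_linear B by (rule B_bounded_linear)
  obtain K where K: "K > 0" "\<And>x. norm (B x) \<le> norm x * K" using pos_bounded by blast
  define M where "M = 1 + K / \<delta>"
  have M1: "M \<ge> 1" using K \<delta> by (simp add: M_def)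
  have Abound: "norm u \<le> M * norm (u + s *\<^sub>R (\<i> *\<^sub>C B z))" if "(u, z) \<in> D" for u z s
  proof -
    define f where "f = u + s *\<^sub>R (\<i> *\<^sub>C B z)"
    have "\<delta> * (\<bar>s\<bar> * norm (B z)) \<le> \<delta> * (\<bar>s\<bar> * (norm z * K))"
      using K(2)[of z] \<delta> by (intro mult_left_mono) auto
    also have "\<dots> = K * (\<bar>s\<bar> * \<delta> * norm z)" by (simp add: mult_ac)
    also have "\<dots> \<le> K * norm f"
      using norm_D_le[OF that, of s] K(1) by (intro mult_left_mono) (auto simp: f_def)
    finally have "\<bar>s\<bar> * norm (B z) \<le> K / \<delta> * norm f" using \<delta> by (simp add: field_simps)
    moreover have "norm u \<le> norm f + \<bar>s\<bar> * norm (B z)"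
      using norm_triangle_ineq4[of f "s *\<^sub>R (\<i> *\<^sub>C B z)"] by (simp add: f_def)
    ultimately show ?thesis by (simp add: M_def f_def[symmetric] algebra_simps)
  qed
  have Asurj: "\<exists>u z. (u, z) \<in> D \<and> u + s *\<^sub>R (\<i> *\<^sub>C B z) = f" if s: "s \<noteq> 0" for s f
  proof (rule ccontr)
    assume not: "\<not> ?thesis"
    define X where "X = {u + s *\<^sub>R (\<i> *\<^sub>C B z) |u z. (u, z) \<in> D}"
    have D0: "(0, 0) \<in> D" using D_linear by (simp add: linear_operator_def subspace_def zero_prod_def)
    have "subspace X"
      unfolding subspace_def
    proof (intro conjI ballI allI)
      have "0 + s *\<^sub>R (\<i> *\<^sub>C B 0) \<in> X" unfolding X_def using D0 by blast
      then show "0 \<in> X" by (simp add: zero scaleC_zero_right)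
    next
      fix x y assume "x \<in> X" "y \<in> X"
      then obtain u z u' z' where *: "x = u + s *\<^sub>R (\<i> *\<^sub>C B z)" "y = u' + s *\<^sub>R (\<i> *\<^sub>C B z')"
        "(u, z) \<in> D" "(u', z') \<in> D" unfolding X_def by blast
      have "x + y = (u + u') + s *\<^sub>R (\<i> *\<^sub>C B (z + z'))"
        by (simp add: * add scaleC_add_right scaleR_add_right)
      then show "x + y \<in> X" using linear_operator_add[OF D_linear *(3,4)] unfolding X_def by blast
    next
      fix c :: real and x assume "x \<in> X"
      then obtain u z where *: "x = u + s *\<^sub>R (\<i> *\<^sub>C B z)" "(u, z) \<in> D" unfolding X_def by blast
      have "c *\<^sub>R x = c *\<^sub>R u + s *\<^sub>R (\<i> *\<^sub>C B (c *\<^sub>R z))"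
        by (simp add: * scaleR scaleC_scaleR scaleR_add_right)
      then show "c *\<^sub>R x \<in> X"
        using linear_operator_scaleR[OF D_linear *(2), of c] unfolding X_def by blast
    qed
    moreover have "closed X"
      unfolding closed_sequential_limits
    proof (intro allI impI, elim conjE)
      fix F l assume "\<forall>n. F n \<in> X" and l: "F \<longlonglongrightarrow> l"
      then have "\<forall>n. \<exists>u z. F n = u + s *\<^sub>R (\<i> *\<^sub>C B z) \<and> (u, z) \<in> D" unfolding X_def by blast
      then obtain U Z where UZ: "\<And>n. F n = U n + s *\<^sub>R (\<i> *\<^sub>C B (Z n))" "\<And>n. (U n, Z n) \<in> D"
        by metis
      have dF: "F m - F n = (U m - U n) + s *\<^sub>R (\<i> *\<^sub>C B (Z m - Z n))" for m n
        by (simp add: UZ(1) diff scaleC_diff_right scaleR_diff_right)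
      have inD: "(U m - U n, Z m - Z n) \<in> D" for m n
        by (rule linear_operator_diff[OF D_linear UZ(2) UZ(2)])
      have cF: "Cauchy F" using l LIMSEQ_imp_Cauchy by blast
      have "\<bar>s\<bar> * \<delta> * norm (Z m - Z n) \<le> norm (F m - F n)" for m n
        using norm_D_le[OF inD] by (simp add: dF)
      then have Zb: "norm (Z m - Z n) \<le> 1 / (\<bar>s\<bar> * \<delta>) * norm (F m - F n)" for m n
        using s \<delta> by (simp add: pos_le_divide_eq mult.commute)
      have Ub: "norm (U m - U n) \<le> M * norm (F m - F n)" for m n
        using Abound[OF inD] by (simp add: dF)
      have Cau: "Cauchy Y" if Y: "c > 0" "\<And>m n. norm (Y m - Y n) \<le> c * norm (F m - F n)"
        for Y :: "nat \<Rightarrow> 'a" and c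
      proof (rule CauchyI)
        fix e :: real assume "e > 0"
        then obtain N where N: "\<forall>m\<ge>N. \<forall>n\<ge>N. norm (F m - F n) < e / c"
          using CauchyD[OF cF, of "e / c"] Y(1) by auto
        show "\<exists>N. \<forall>m\<ge>N. \<forall>n\<ge>N. norm (Y m - Y n) < e"
        proof (intro exI[of _ N] allI impI)
          fix m n assume "N \<le> m" "N \<le> n"
          then have "c * norm (F m - F n) < e" using N Y(1) by (simp add: pos_less_divide_eq mult.commute)
          then show "norm (Y m - Y n) < e" using Y(2)[of m n] by simp
        qed
      qed
      have "Cauchy Z" by (rule Cau[OF _ Zb]) (use s \<delta> in simp)
      then obtain z where z: "Z \<longlonglongrightarrow> z" by (auto simp: Cauchy_convergent_iff convergent_def)
      have "Cauchy U" by (rule Cau[OF _ Ub]) (use M1 in simp)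
      then obtain u where u: "U \<longlonglongrightarrow> u" by (auto simp: Cauchy_convergent_iff convergent_def)
      have uz: "(u, z) \<in> D" by (rule D_closed[OF UZ(2) u z])
      have ii: "bounded_linear (\<lambda>x::'a. \<i> *\<^sub>C x)"
        by (rule bounded_linear_intro[of _ 1]) (auto simp: scaleC_add_right scaleC_scaleR)
      have "(\<lambda>n. U n + s *\<^sub>R (\<i> *\<^sub>C B (Z n))) \<longlonglongrightarrow> u + s *\<^sub>R (\<i> *\<^sub>C B z)"
        by (intro tendsto_intros u bounded_linear.tendsto[OF ii] tendsto z)
      then have "l = u + s *\<^sub>R (\<i> *\<^sub>C B z)" using l LIMSEQ_unique by (simp add: UZ(1)[symmetric])
      then show "l \<in> X" using uz unfolding X_def by blast
    qed
    moreover have "f \<notin> X" using not unfolding X_def by blast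
    ultimately obtain g where g: "inner f g \<noteq> 0" "\<forall>x\<in>X. inner x g = 0"
      using orthogonal_vector_exists by blast
    obtain B' where B': "\<And>u v. inner (B u) v = inner u (B' v)" and B'c: "bounded_clinear B'"
      using bounded_clinear_adjoint_exists[OF B] by blast
    define w where "w = s *\<^sub>R (\<i> *\<^sub>C B' g)"
    have "(w, g) \<in> D"
    proof (rule D_maximal)
      fix u z assume "(u, z) \<in> D"
      then have "inner (u + s *\<^sub>R (\<i> *\<^sub>C B z)) g = 0" using g(2) unfolding X_def by blast
      moreover have "inner (\<i> *\<^sub>C B z) g = - inner z (\<i> *\<^sub>C B' g)"
        using B'[of z "\<i> *\<^sub>C g"] B'c by (simp add: inner_ii_left bounded_clinear_def)
      ultimately show "inner z w = inner u g" by (simp add: inner_add_left w_def)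
    qed
    then have "inner w (\<i> *\<^sub>C g) = 0" by (rule D_form_real)
    then have "inner (\<i> *\<^sub>C B' g) (\<i> *\<^sub>C g) = 0" using s by (simp add: w_def)
    then have "inner (B' g) g = 0" by (simp add: inner_ii_left)
    moreover have "inner (B g) g = inner (B' g) g" unfolding B' by (rule inner_commute)
    ultimately have "inner (B g) g = 0" by simp
    then have "\<delta> * (norm g)\<^sup>2 \<le> 0" using accretive[OF \<open>(w, g) \<in> D\<close>] by simp
    then have "g = 0" using \<delta> by (simp add: mult_le_0_iff)
    then show False using g(1) by simp
  qed
  have dom: "Domain A = Domain D" by (auto simp: mem_op_mult_graph Domain_iff)
  have "bisectorial A M"
  proof (unfold_locales)
    show "linear_operator A" by (rule A_linear)
    show "closure (Domain A) = UNIV" using D_dense dom by simp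
    show "1 \<le> M" by (rule M1)
    show "norm u \<le> M * norm (u + s *\<^sub>R (\<i> *\<^sub>C v))" if "(u, v) \<in> A" for u v s
      using that Abound unfolding mem_op_mult_graph by blast
    show "\<exists>u v. (u, v) \<in> A \<and> u + s *\<^sub>R (\<i> *\<^sub>C v) = f" if "s \<noteq> 0" for s f
      using Asurj[OF that, of f] unfolding mem_op_mult_graph by blast
  qed
  then show ?thesis ..
qed

end

text \<open>The adjoint of \<open>Q\<^sub>t\<close> is \<open>tD (I + t\<^sup>2 B*DB*D)\<^sup>-\<^sup>1 B*\<close>, which becomes the corresponding operator of \<open>B*D\<close> at
\<open>B*g\<close> after an application of \<open>B*\<close>; accretivity allows that. The proof works with vectors, so that no
adjoint of the unbounded operator \<open>BD\<close> is needed.\<close>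

lemma quo_duality:
  fixes D :: "'a::chilbert operator"
  assumes "accretive_product D B \<delta>" "accretive_product D B' \<delta>"
    and adj: "\<And>u v. inner (B u) v = inner u (B' v)"
    and X: "bisectorial (op_graph B \<circ>\<^sub>o D) M" and Y: "bisectorial (op_graph B' \<circ>\<^sub>o D) M'"
    and t: "t > 0"
  shows "\<delta> * \<bar>inner (bisectorial.quo (op_graph B \<circ>\<^sub>o D) t w) g\<bar>
    \<le> norm w * norm (bisectorial.quo (op_graph B' \<circ>\<^sub>o D) t (B' g))"
proof -
  interpret P: accretive_product D B \<delta> by fact
  interpret P': accretive_product D B' \<delta> by fact
  interpret X: bisectorial "op_graph B \<circ>\<^sub>o D" M by fact
  interpret Y: bisectorial "op_graph B' \<circ>\<^sub>o D" M' by fact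
  have t0: "t \<noteq> 0" using t by simp
  obtain v x where 1: "(X.res t w, v) \<in> op_graph B \<circ>\<^sub>o D" "(v, x) \<in> op_graph B \<circ>\<^sub>o D"
    "X.res t w + t\<^sup>2 *\<^sub>R x = w" "X.quo t w = t *\<^sub>R v"
    by (rule X.res_chain[OF t0])
  obtain p q where 2: "(Y.res t (B' g), p) \<in> op_graph B' \<circ>\<^sub>o D" "(p, q) \<in> op_graph B' \<circ>\<^sub>o D"
    "Y.res t (B' g) + t\<^sup>2 *\<^sub>R q = B' g" "Y.quo t (B' g) = t *\<^sub>R p"
    by (rule Y.res_chain[OF t0])
  define y z where "y = X.res t w" and "z = Y.res t (B' g)"
  obtain y1 v1 where 3: "(y, y1) \<in> D" "v = B y1" "(v, v1) \<in> D" "x = B v1"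
    using 1(1,2) unfolding mem_op_mult_graph y_def by blast
  obtain z1 p1 where 4: "(z, z1) \<in> D" "p = B' z1" "(p, p1) \<in> D" "q = B' p1"
    using 2(1,2) unfolding mem_op_mult_graph z_def by blast
  have "inner y1 q = inner v p1" by (simp add: 3(2) 4(4) adj)
  also have "\<dots> = inner v1 p" using P.D_symmetric[OF 3(3) 4(3)] by simp
  also have "\<dots> = inner x z1" by (simp add: 3(4) 4(2) adj)
  finally have yq: "inner y1 q = inner x z1" .
  have "inner (X.quo t w) g = t * inner y1 (B' g)" by (simp add: 1(4) 3(2) adj)
  also have "B' g = z + t\<^sup>2 *\<^sub>R q" using 2(3) by (simp add: z_def)
  also have "inner y1 (z + t\<^sup>2 *\<^sub>R q) = inner y z1 + t\<^sup>2 * inner x z1"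
    using P.D_symmetric[OF 3(1) 4(1)] yq by (simp add: inner_add_right)
  also have "\<dots> = inner (y + t\<^sup>2 *\<^sub>R x) z1" by (simp add: inner_add_left)
  also have "y + t\<^sup>2 *\<^sub>R x = w" unfolding y_def by (rule 1(3))
  finally have "\<bar>inner (X.quo t w) g\<bar> = t * \<bar>inner w z1\<bar>" using t by (simp add: abs_mult)
  also have "\<dots> \<le> t * (norm w * norm z1)"
    using t Cauchy_Schwarz_ineq2[of w z1] by (intro mult_left_mono) auto
  finally have "\<delta> * \<bar>inner (X.quo t w) g\<bar> \<le> \<delta> * (t * (norm w * norm z1))"
    using P.\<delta> by (intro mult_left_mono) auto
  also have "\<dots> = norm w * (t * (\<delta> * norm z1))" by (simp add: mult_ac)
  also have "\<dots> \<le> norm w * (t * norm (B' z1))"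
    using P'.norm_le_norm_B[OF 4(1)] t by (intro mult_left_mono) auto
  also have "\<dots> = norm w * norm (Y.quo t (B' g))" using t by (simp add: 2(4) 4(2))
  finally show ?thesis .
qed

section \<open>Integrals over the line and the square function estimate\<close>

text \<open>The two ends of the interval tend to infinity independently, as in \<^const>\<open>has_improper_integral\<close>.\<close>

definition has_line_integral :: "(real \<Rightarrow> 'a::real_normed_vector) \<Rightarrow> 'a \<Rightarrow> bool"
  where "has_line_integral \<phi> L \<longleftrightarrow> ((\<lambda>(c, d). integral {c..d} \<phi>) \<longlongrightarrow> L) (at_bot \<times>\<^sub>F at_top)"

lemma has_line_integral_unique:
  "has_line_integral \<phi> L \<Longrightarrow> has_line_integral \<phi> L' \<Longrightarrow> L = L'"
  unfolding has_line_integral_def by (rule tendsto_unique[rotated]) (auto simp: prod_filter_eq_bot)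

lemma has_line_integral_0: "has_line_integral (\<lambda>x. 0) 0"
  by (simp add: has_line_integral_def case_prod_unfold)

lemma has_line_integral_add:
  fixes \<phi> \<psi> :: "real \<Rightarrow> 'a::banach"
  assumes "continuous_on UNIV \<phi>" "continuous_on UNIV \<psi>" "has_line_integral \<phi> L" "has_line_integral \<psi> L'"
  shows "has_line_integral (\<lambda>x. \<phi> x + \<psi> x) (L + L')"
proof -
  have int: "\<phi> integrable_on {c..d}" "\<psi> integrable_on {c..d}" for c d
    using assms(1,2) continuous_on_subset by (blast intro: integrable_continuous_real)+
  show ?thesis using tendsto_add[OF assms(3,4)[unfolded has_line_integral_def]]
    by (simp add: has_line_integral_def case_prod_unfold Henstock_Kurzweil_Integration.integral_add int)
qed

lemma has_line_integral_bounded_linear: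
  fixes \<phi> :: "real \<Rightarrow> 'a::banach"
  assumes "continuous_on UNIV \<phi>" "has_line_integral \<phi> L" "bounded_linear S"
  shows "has_line_integral (\<lambda>x. S (\<phi> x)) (S L)"
proof -
  have int: "\<phi> integrable_on {c..d}" for c d
    using assms(1) continuous_on_subset by (blast intro: integrable_continuous_real)
  have *: "integral {c..d} (\<lambda>x. S (\<phi> x)) = S (integral {c..d} \<phi>)" for c d
    using integral_linear[OF int assms(3)] by (simp add: o_def)
  show ?thesis using bounded_linear.tendsto[OF assms(3) assms(2)[unfolded has_line_integral_def]]
    by (simp add: has_line_integral_def case_prod_unfold *)
qed

text \<open>An integral converges if its square over intervals is dominated by an additive function of the interval
with finite total mass: over the complement of \<open>[-n, n]\<close> the mass tends to \<open>0\<close>.\<close>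

lemma has_line_integral_exists:
  fixes \<phi> :: "real \<Rightarrow> 'a::banach" and w :: "real \<Rightarrow> real"
  assumes \<phi>: "continuous_on UNIV \<phi>" and w: "continuous_on UNIV w" "\<And>x. 0 \<le> w x"
    and W: "\<And>c d. c \<le> d \<Longrightarrow> integral {c..d} w \<le> W"
    and dom: "\<And>c d. c \<le> d \<Longrightarrow> (norm (integral {c..d} \<phi>))\<^sup>2 \<le> \<beta> * integral {c..d} w" and \<beta>: "0 \<le> \<beta>"
  shows "\<exists>L. has_line_integral \<phi> L \<and> (norm L)\<^sup>2 \<le> \<beta> * W"
proof -
  have int\<phi>: "\<phi> integrable_on {c..d}" and intw: "w integrable_on {c..d}" for c d
    using \<phi> w(1) continuous_on_subset by (blast intro: integrable_continuous_real)+
  define a where "a n = integral {- real n..real n} w" for n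
  have mono: "integral {c..d} w \<le> integral {c'..d'} w" if "c' \<le> c" "d \<le> d'" for c d c' d'
    using that by (intro integral_subset_le intw) (auto simp: w(2))
  have "incseq a" unfolding a_def by (intro incseq_SucI mono) auto
  moreover have "a n \<le> W" for n unfolding a_def by (intro W) simp
  ultimately obtain \<alpha> where \<alpha>: "a \<longlonglongrightarrow> \<alpha>" "\<And>n. a n \<le> \<alpha>"
    using incseq_convergent[of a W] by auto
  have le\<alpha>: "integral {c..d} w \<le> \<alpha>" for c d
  proof -
    obtain n where n: "max \<bar>c\<bar> \<bar>d\<bar> \<le> real n" using real_arch_simple by blast
    have "integral {c..d} w \<le> a n" unfolding a_def using n by (intro mono) auto
    then show ?thesis using \<alpha>(2)[of n] by simp
  qed
  define \<epsilon> where "\<epsilon> n = sqrt (\<beta> * (\<alpha> - a n))" for n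
  have "\<epsilon> \<longlonglongrightarrow> sqrt (\<beta> * (\<alpha> - \<alpha>))" unfolding \<epsilon>_def by (intro tendsto_intros \<alpha>(1))
  then have \<epsilon>0: "\<epsilon> \<longlonglongrightarrow> 0" by simp
  define X where "X n = integral {- real n..real n} \<phi>" for n
  have near: "norm (integral {c..d} \<phi> - X n) \<le> 2 * \<epsilon> n" if cd: "c \<le> - real n" "real n \<le> d" for c d n
  proof -
    have split: "integral {c..d} \<psi> = integral {c..- real n} \<psi> + integral {- real n..real n} \<psi>
        + integral {real n..d} \<psi>"
      if "\<And>c d. \<psi> integrable_on {c..d}" for \<psi> :: "real \<Rightarrow> 'b::banach"
    proof -
      have "integral {c..d} \<psi> = integral {c..- real n} \<psi> + integral {- real n..d} \<psi>"
        using cd that by (intro Henstock_Kurzweil_Integration.integral_combine[symmetric]) auto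
      moreover have "integral {- real n..d} \<psi> = integral {- real n..real n} \<psi> + integral {real n..d} \<psi>"
        using cd that by (intro Henstock_Kurzweil_Integration.integral_combine[symmetric]) auto
      ultimately show ?thesis by (simp add: add.assoc)
    qed
    have pos: "0 \<le> integral {c..- real n} w" "0 \<le> integral {real n..d} w"
      using w(2) by (auto intro: integral_nonneg intw)
    have "integral {c..d} w \<le> \<alpha>" by (rule le\<alpha>)
    then have t: "integral {c..- real n} w \<le> \<alpha> - a n" "integral {real n..d} w \<le> \<alpha> - a n"
      using split[of w, OF intw] pos unfolding a_def by linarith+
    have "norm (integral {c..- real n} \<phi>) \<le> \<epsilon> n" unfolding \<epsilon>_def
      using order_trans[OF dom[OF cd(1)] mult_left_mono[OF t(1) \<beta>]] by (intro real_le_rsqrt)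
    moreover have "norm (integral {real n..d} \<phi>) \<le> \<epsilon> n" unfolding \<epsilon>_def
      using order_trans[OF dom[OF cd(2)] mult_left_mono[OF t(2) \<beta>]] by (intro real_le_rsqrt)
    moreover have "integral {c..d} \<phi> - X n = integral {c..- real n} \<phi> + integral {real n..d} \<phi>"
      using split[of \<phi>, OF int\<phi>] by (simp add: X_def)
    ultimately show ?thesis
      using norm_triangle_ineq[of "integral {c..- real n} \<phi>" "integral {real n..d} \<phi>"] by simp
  qed
  have nearX: "norm (X m - X n) \<le> 2 * \<epsilon> n" if "n \<le> m" for m n
    unfolding X_def[of m] using that by (intro near) auto
  have "Cauchy X"
  proof (rule CauchyI)
    fix e :: real assume e: "0 < e"
    then have "eventually (\<lambda>n. \<epsilon> n < e / 4) sequentially" by (intro order_tendstoD(2)[OF \<epsilon>0]) simp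
    then obtain N where N: "\<epsilon> N < e / 4" by (auto simp: eventually_sequentially)
    show "\<exists>N. \<forall>m\<ge>N. \<forall>n\<ge>N. norm (X m - X n) < e"
    proof (intro exI[of _ N] allI impI)
      fix m n assume "N \<le> m" "N \<le> n"
      from nearX[OF this(1)] nearX[OF this(2)] N show "norm (X m - X n) < e"
        using norm_triangle_ineq4[of "X m - X N" "X n - X N"] by simp
    qed
  qed
  then obtain L where L: "X \<longlonglongrightarrow> L" by (auto simp: Cauchy_convergent_iff convergent_def)
  have nearL: "norm (L - X n) \<le> 2 * \<epsilon> n" for n
  proof (rule tendsto_upperbound)
    show "(\<lambda>m. norm (X m - X n)) \<longlonglongrightarrow> norm (L - X n)" by (intro tendsto_intros L)
    show "eventually (\<lambda>m. norm (X m - X n) \<le> 2 * \<epsilon> n) sequentially"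
      using eventually_ge_at_top[of n] by eventually_elim (rule nearX)
  qed simp
  have "has_line_integral \<phi> L" unfolding has_line_integral_def
  proof (rule tendstoI)
    fix e :: real assume e: "0 < e"
    then have "eventually (\<lambda>n. \<epsilon> n < e / 4) sequentially" by (intro order_tendstoD(2)[OF \<epsilon>0]) simp
    then obtain N where N: "\<epsilon> N < e / 4" by (auto simp: eventually_sequentially)
    have "eventually (\<lambda>p. fst p \<le> - real N \<and> real N \<le> snd p) (at_bot \<times>\<^sub>F at_top)"
      using eventually_prodI[OF eventually_le_at_bot[of "- real N"] eventually_ge_at_top[of "real N"]] .
    then show "eventually (\<lambda>p. dist (case p of (c, d) \<Rightarrow> integral {c..d} \<phi>) L < e) (at_bot \<times>\<^sub>F at_top)"
    proof eventually_elim
      case (elim p)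
      then have "norm (integral {fst p..snd p} \<phi> - X N) \<le> 2 * \<epsilon> N" by (intro near) auto
      then have "norm (integral {fst p..snd p} \<phi> - L) < e"
        using nearL[of N] N norm_triangle_ineq4[of "integral {fst p..snd p} \<phi> - X N" "L - X N"] by simp
      then show ?case by (simp add: case_prod_unfold dist_norm)
    qed
  qed
  moreover have "(norm L)\<^sup>2 \<le> \<beta> * W"
  proof (rule tendsto_upperbound)
    show "(\<lambda>n. (norm (X n))\<^sup>2) \<longlonglongrightarrow> (norm L)\<^sup>2" by (intro tendsto_intros L)
    have "(norm (X n))\<^sup>2 \<le> \<beta> * W" for n
      using dom[of "- real n" "real n"] mult_left_mono[OF W[of "- real n" "real n"] \<beta>] by (simp add: X_def)
    then show "eventually (\<lambda>n. (norm (X n))\<^sup>2 \<le> \<beta> * W) sequentially" by simp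
  qed simp
  ultimately show ?thesis by blast
qed

lemma weighted_young:
  fixes x y C :: real
  assumes "C > 0"
  shows "2 * (x * y) \<le> C * x\<^sup>2 + y\<^sup>2 / C"
proof -
  have "0 \<le> (C * x - y)\<^sup>2 / C" using assms by simp
  also have "\<dots> = C * x\<^sup>2 + y\<^sup>2 / C - 2 * (x * y)"
    using assms by (simp add: power2_eq_square field_simps)
  finally show ?thesis by simp
qed

context bisectorial
begin

abbreviation Q3 :: "real \<Rightarrow> 'a \<Rightarrow> 'a" where "Q3 x f \<equiv> Q x (Q x (Q x f))"

lemma continuous_Q3: "continuous_on S (\<lambda>x. Q3 x f)"
  by (intro continuous_on_Q continuous_intros)

text \<open>With \<open>F\<close> the integral on the left, \<open>\<parallel>F\<parallel>\<^sup>2\<close> is the integral of \<open>(Q\<^sup>3 f, F)\<close>. The weight in Young's inequality is chosen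
such that the dual square function contributes exactly \<open>\<parallel>F\<parallel>\<^sup>2\<close>, half of what is on the left; it is
then absorbed.\<close>

lemma cubed_integral_dominated:
  assumes dual: "\<And>x w g. \<bar>inner (Q x w) g\<bar> \<le> norm w * \<psi> x g"
    and \<psi>: "\<And>g. continuous_on UNIV (\<lambda>x. \<psi> x g)" "\<And>x g. 0 \<le> \<psi> x g"
    and dual_square: "\<And>g c d. c \<le> d \<Longrightarrow> integral {c..d} (\<lambda>x. (\<psi> x g)\<^sup>2) \<le> C2 * (norm g)\<^sup>2"
    and C2: "C2 > 0" and cd: "c \<le> d"
  shows "(norm (integral {c..d} (\<lambda>x. Q3 x f)))\<^sup>2 \<le> C2 * K\<^sup>2 * integral {c..d} (\<lambda>x. (norm (Q x f))\<^sup>2)"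
proof -
  define F where "F = integral {c..d} (\<lambda>x. Q3 x f)"
  have c1: "(\<lambda>x. Q3 x f) integrable_on {c..d}" by (intro integrable_continuous_real continuous_Q3)
  have c2: "(\<lambda>x. (norm (Q x f))\<^sup>2) integrable_on {c..d}"
    by (intro integrable_continuous_real continuous_intros continuous_Q)
  have c3: "(\<lambda>x. (\<psi> x F)\<^sup>2) integrable_on {c..d}"
    by (intro integrable_continuous_real continuous_intros continuous_on_subset[OF \<psi>(1)]) simp
  have i1: "((\<lambda>x. 2 * inner (Q3 x f) F) has_integral 2 * inner F F) {c..d}"
    using has_integral_linear[OF integrable_integral[OF c1] bounded_linear_inner_left[of F]]
    by (intro has_integral_mult_right) (simp add: F_def o_def)
  have i2: "((\<lambda>x. C2 * (K\<^sup>2 * (norm (Q x f))\<^sup>2) + (\<psi> x F)\<^sup>2 / C2) has_integral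
     C2 * (K\<^sup>2 * integral {c..d} (\<lambda>x. (norm (Q x f))\<^sup>2)) + integral {c..d} (\<lambda>x. (\<psi> x F)\<^sup>2) / C2) {c..d}"
    by (intro has_integral_add has_integral_mult_right has_integral_divide integrable_integral c2 c3)
  have "2 * inner F F \<le> C2 * (K\<^sup>2 * integral {c..d} (\<lambda>x. (norm (Q x f))\<^sup>2))
      + integral {c..d} (\<lambda>x. (\<psi> x F)\<^sup>2) / C2"
  proof (rule has_integral_le[OF i1 i2])
    fix x
    have "inner (Q3 x f) F \<le> norm (Q x (Q x f)) * \<psi> x F" using dual[of x "Q x (Q x f)" F] by simp
    also have "\<dots> \<le> (K * norm (Q x f)) * \<psi> x F" by (intro mult_right_mono norm_Q \<psi>(2))
    also have "2 * \<dots> \<le> C2 * (K * norm (Q x f))\<^sup>2 + (\<psi> x F)\<^sup>2 / C2" by (rule weighted_young[OF C2])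
    finally show "2 * inner (Q3 x f) F \<le> C2 * (K\<^sup>2 * (norm (Q x f))\<^sup>2) + (\<psi> x F)\<^sup>2 / C2"
      by (simp add: power_mult_distrib)
  qed
  also have "integral {c..d} (\<lambda>x. (\<psi> x F)\<^sup>2) / C2 \<le> (C2 * (norm F)\<^sup>2) / C2"
    using C2 by (intro divide_right_mono dual_square cd) simp
  also have "\<dots> = inner F F" using C2 by (simp add: power2_norm_eq_inner)
  finally show ?thesis unfolding F_def[symmetric] by (simp add: power2_norm_eq_inner)
qed

lemma cubed_integral_operator:
  assumes square: "\<And>u c d. c \<le> d \<Longrightarrow> integral {c..d} (\<lambda>x. (norm (Q x u))\<^sup>2) \<le> C1 * (norm u)\<^sup>2"
    and dual: "\<And>x w g. \<bar>inner (Q x w) g\<bar> \<le> norm w * \<psi> x g"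
    and \<psi>: "\<And>g. continuous_on UNIV (\<lambda>x. \<psi> x g)" "\<And>x g. 0 \<le> \<psi> x g"
    and dual_square: "\<And>g c d. c \<le> d \<Longrightarrow> integral {c..d} (\<lambda>x. (\<psi> x g)\<^sup>2) \<le> C2 * (norm g)\<^sup>2"
    and C2: "C2 > 0"
  shows "\<exists>T. bounded_clinear T \<and> (\<forall>f. has_line_integral (\<lambda>x. Q3 x f) (T f))"
proof -
  have ex: "\<exists>L. has_line_integral (\<lambda>x. Q3 x f) L \<and> (norm L)\<^sup>2 \<le> (C2 * K\<^sup>2) * (C1 * (norm f)\<^sup>2)" for f
  proof (rule has_line_integral_exists[where w = "\<lambda>x. (norm (Q x f))\<^sup>2"])
    show "continuous_on UNIV (\<lambda>x. Q3 x f)" by (rule continuous_Q3)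
    show "continuous_on UNIV (\<lambda>x. (norm (Q x f))\<^sup>2)" by (intro continuous_intros continuous_Q)
    show "(norm (integral {c..d} (\<lambda>x. Q3 x f)))\<^sup>2 \<le> C2 * K\<^sup>2 * integral {c..d} (\<lambda>x. (norm (Q x f))\<^sup>2)"
      if "c \<le> d" for c d by (rule cubed_integral_dominated[OF dual \<psi> dual_square C2 that])
  qed (use C2 in \<open>auto intro: square\<close>)
  then obtain T where T: "\<And>f. has_line_integral (\<lambda>x. Q3 x f) (T f)"
    "\<And>f. (norm (T f))\<^sup>2 \<le> (C2 * K\<^sup>2) * (C1 * (norm f)\<^sup>2)" by metis
  have "T (f + g) = T f + T g" for f g
    using has_line_integral_add[OF continuous_Q3 continuous_Q3 T(1)[of f] T(1)[of g]]
    by (intro has_line_integral_unique[OF T(1)]) (simp add: linear_add[OF Q_linear])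
  moreover have "T (r *\<^sub>R f) = r *\<^sub>R T f" for r f
    using has_line_integral_bounded_linear[OF continuous_Q3 T(1)[of f] bounded_linear_scaleR_right[of r]]
    by (intro has_line_integral_unique[OF T(1)]) (simp add: linear_scale[OF Q_linear])
  moreover have "norm (T f) \<le> norm f * sqrt (C2 * K\<^sup>2 * \<bar>C1\<bar>)" for f
  proof -
    have "(norm (T f))\<^sup>2 \<le> (C2 * K\<^sup>2) * (C1 * (norm f)\<^sup>2)" by (rule T)
    also have "\<dots> \<le> (C2 * K\<^sup>2) * (\<bar>C1\<bar> * (norm f)\<^sup>2)"
      using C2 by (intro mult_left_mono mult_right_mono) auto
    also have "\<dots> = (norm f * sqrt (C2 * K\<^sup>2 * \<bar>C1\<bar>))\<^sup>2"
      using C2 by (simp add: power_mult_distrib)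
    finally show ?thesis by (rule power2_le_imp_le) (use C2 in auto)
  qed
  ultimately have "bounded_linear T" by (rule bounded_linear_intro)
  moreover have "T (\<i> *\<^sub>C f) = \<i> *\<^sub>C T f" for f
  proof (rule has_line_integral_unique[OF T(1)])
    have ii: "bounded_linear (\<lambda>x::'a. \<i> *\<^sub>C x)"
      by (rule bounded_linear_intro[of _ 1]) (auto simp: scaleC_add_right scaleC_scaleR)
    have "Q x (\<i> *\<^sub>C g) = \<i> *\<^sub>C Q x g" for x g
      using bounded_clinear_quo[of "exp x"] by (simp add: Q_def bounded_clinear_def)
    then show "has_line_integral (\<lambda>x. Q3 x (\<i> *\<^sub>C f)) (\<i> *\<^sub>C T f)"
      using has_line_integral_bounded_linear[OF continuous_Q3 T(1)[of f] ii] by simp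
  qed
  ultimately show ?thesis using T(1) bounded_clinearI by blast
qed

text \<open>The boundary terms in \<open>integral_Q_cubed\<close> tend to \<open>0\<close> at both ends, on the closure of the range of \<open>A\<close>.\<close>

lemma has_line_integral_Q:
  assumes L: "has_line_integral (\<lambda>x. Q3 x f) L" and f: "f \<in> V"
  shows "has_line_integral (\<lambda>x. Q x f) (8 *\<^sub>R L)"
proof -
  define E where "E x = (1/8) *\<^sub>R Q x f - (1/4) *\<^sub>R R x (Q x f)" for x
  have Elim: "(E \<longlongrightarrow> 0) F" if "((\<lambda>x. Q x f) \<longlongrightarrow> 0) F" for F
  proof -
    have "((\<lambda>x. R x (Q x f)) \<longlongrightarrow> 0) F"
      by (rule tendsto_strong[where ?p0.0 = 0, OF R_linear norm_R that])
        (simp add: linear_0[OF R_linear])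
    from tendsto_diff[OF tendsto_scaleR[OF tendsto_const that, of "1/8"] tendsto_scaleR[OF tendsto_const this, of "1/4"]]
    show ?thesis by (simp add: E_def[abs_def])
  qed
  have "((\<lambda>p. E (snd p)) \<longlongrightarrow> 0) (at_bot \<times>\<^sub>F at_top)"
    by (rule filterlim_compose[OF Elim[OF tendsto_Q_at_top[OF f]] filterlim_snd])
  moreover have "((\<lambda>p. E (fst p)) \<longlongrightarrow> 0) (at_bot \<times>\<^sub>F at_top)"
    by (rule filterlim_compose[OF Elim[OF tendsto_Q_at_bot] filterlim_fst])
  ultimately have "((\<lambda>p. 8 *\<^sub>R ((case p of (c, d) \<Rightarrow> integral {c..d} (\<lambda>x. Q3 x f)) - (E (snd p) - E (fst p))))
      \<longlongrightarrow> 8 *\<^sub>R (L - (0 - 0))) (at_bot \<times>\<^sub>F at_top)"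
    using L unfolding has_line_integral_def by (intro tendsto_intros)
  then have "((\<lambda>p. 8 *\<^sub>R ((case p of (c, d) \<Rightarrow> integral {c..d} (\<lambda>x. Q3 x f)) - (E (snd p) - E (fst p))))
      \<longlongrightarrow> 8 *\<^sub>R L) (at_bot \<times>\<^sub>F at_top)" by simp
  then show ?thesis unfolding has_line_integral_def
  proof (rule Lim_transform_eventually)
    have "eventually (\<lambda>p. fst p \<le> 0 \<and> 0 \<le> snd p) ((at_bot :: real filter) \<times>\<^sub>F (at_top :: real filter))"
      using eventually_prodI[OF eventually_le_at_bot[of "0::real"] eventually_ge_at_top[of "0::real"]] .
    then show "eventually (\<lambda>p. 8 *\<^sub>R ((case p of (c, d) \<Rightarrow> integral {c..d} (\<lambda>x. Q3 x f)) - (E (snd p) - E (fst p)))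
       = (case p of (c, d) \<Rightarrow> integral {c..d} (\<lambda>x. Q x f))) (at_bot \<times>\<^sub>F at_top)"
    proof eventually_elim
      case (elim p)
      then have "fst p \<le> snd p" by simp
      from integral_Q_cubed[OF this, of f]
      show ?case unfolding E_def case_prod_unfold by simp
    qed
  qed
qed

end

section \<open>The sign operator\<close>

lemma op_app_op_graph [simp]: "op_app (op_graph S) u = S u"
  by (simp add: op_app_def op_graph_def)

lemma exp_nat_mult_ln: "t > 0 \<Longrightarrow> exp (real k * ln t) = t ^ k"
  by (simp add: exp_of_nat_mult)

lemma has_improper_integral_unique:
  "has_improper_integral \<phi> g \<Longrightarrow> has_improper_integral \<phi> g' \<Longrightarrow> g = g'"
  unfolding has_improper_integral_def
  by (elim conjE, rule tendsto_unique[rotated]) (auto simp: prod_filter_eq_bot trivial_limit_at_right_real)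

lemma has_improper_integral_log_substitution:
  fixes \<phi> :: "real \<Rightarrow> 'a::banach"
  assumes \<phi>: "continuous_on UNIV \<phi>" "has_line_integral \<phi> L" and k: "k > 0"
    and \<psi>: "\<And>t. t > 0 \<Longrightarrow> \<psi> t = (1 / t) *\<^sub>R \<phi> (k * ln t)"
  shows "has_improper_integral \<psi> ((1 / k) *\<^sub>R L)"
proof -
  have I: "(\<psi> has_integral (1 / k) *\<^sub>R integral {k * ln a..k * ln b} \<phi>) {a..b}" if "0 < a" "a \<le> b" for a b
  proof (rule has_integral_eq[OF _ has_integral_log_substitution[OF \<phi>(1) k that]])
    show "(1 / t) *\<^sub>R \<phi> (k * ln t) = \<psi> t" if "t \<in> {a..b}" for t
      using that \<open>0 < a\<close> by (simp add: \<psi>)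
  qed
  have "\<psi> integrable_on {a..b}" if "0 < a" for a b
  proof (cases "a \<le> b")
    case True
    then show ?thesis using I[OF that] by blast
  next
    case False
    then show ?thesis by (simp add: integrable_on_empty)
  qed
  moreover have "((\<lambda>(a, b). integral {a..b} \<psi>) \<longlongrightarrow> (1 / k) *\<^sub>R L) (at_right 0 \<times>\<^sub>F at_top)"
  proof -
    have kln: "filterlim (\<lambda>a. k * ln a) at_bot (at_right 0)" "filterlim (\<lambda>b. k * ln b) at_top at_top"
      using k by (auto intro: filterlim_tendsto_pos_mult_at_bot filterlim_tendsto_pos_mult_at_top
          tendsto_const ln_at_0 ln_at_top)
    have "filterlim (\<lambda>p. (k * ln (fst p), k * ln (snd p))) (at_bot \<times>\<^sub>F at_top) (at_right 0 \<times>\<^sub>F at_top)"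
      by (intro filterlim_Pair filterlim_compose[OF kln(1)] filterlim_compose[OF kln(2)]
          filterlim_fst filterlim_snd)
    from tendsto_scaleR[OF tendsto_const filterlim_compose[OF \<phi>(2)[unfolded has_line_integral_def] this]]
    have "((\<lambda>p. (1 / k) *\<^sub>R integral {k * ln (fst p)..k * ln (snd p)} \<phi>) \<longlongrightarrow> (1 / k) *\<^sub>R L)
        (at_right 0 \<times>\<^sub>F at_top)" by simp
    then show ?thesis
    proof (rule Lim_transform_eventually)
      have "eventually (\<lambda>p. fst p \<in> {0<..<1} \<and> 1 \<le> snd p) (at_right (0::real) \<times>\<^sub>F (at_top :: real filter))"
        by (intro eventually_prodI eventually_at_right_real eventually_ge_at_top) simp
      then show "eventually (\<lambda>p. (1 / k) *\<^sub>R integral {k * ln (fst p)..k * ln (snd p)} \<phi>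
          = (case p of (a, b) \<Rightarrow> integral {a..b} \<psi>)) (at_right 0 \<times>\<^sub>F at_top)"
      proof eventually_elim
        case (elim p)
        then have "0 < fst p" "fst p \<le> snd p" by auto
        from integral_unique[OF I[OF this]] show ?case by (simp add: case_prod_unfold)
      qed
    qed
  qed
  ultimately show ?thesis by (simp add: has_improper_integral_def)
qed

text \<open>Passes from the Lebesgue integral over the half-line to integrals over compact intervals of the
logarithmic variable.\<close>

lemma square_function_log_substitution:
  fixes w :: "real \<Rightarrow> real"
  assumes w: "continuous_on UNIV w" "\<And>x. 0 \<le> w x" and k: "k > 0" and C: "C \<ge> 0" and cd: "c \<le> d"
    and nn: "(\<integral>\<^sup>+ t \<in> {0<..}. ennreal (v t) \<partial>lborel) \<le> ennreal C"
    and v: "\<And>t. t > 0 \<Longrightarrow> v t = w (k * ln t) / t"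
  shows "integral {c..d} w \<le> k * C"
proof -
  define a b where "a = exp (c / k)" and "b = exp (d / k)"
  have ab: "0 < a" "a \<le> b" "k * ln a = c" "k * ln b = d"
    using k cd by (auto simp: a_def b_def divide_right_mono)
  have I: "((\<lambda>t. (1 / t) *\<^sub>R w (k * ln t)) has_integral (1 / k) *\<^sub>R integral {c..d} w) {a..b}"
    using has_integral_log_substitution[OF w(1) k ab(1,2)] ab(3,4) by simp
  have "ennreal ((1 / k) *\<^sub>R integral {c..d} w)
      = (\<integral>\<^sup>+ t. ennreal ((1 / t) *\<^sub>R w (k * ln t)) * indicator {a..b} t \<partial>lborel)"
    by (rule nn_integral_has_integral_lebesgue'[OF _ I, symmetric]) (use ab(1) w(2) in auto)
  also have "\<dots> \<le> (\<integral>\<^sup>+ t \<in> {0<..}. ennreal (v t) \<partial>lborel)"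
    using ab(1) by (intro nn_integral_mono) (auto simp: v indicator_def)
  also note nn
  finally have "(1 / k) * integral {c..d} w \<le> C" using C by (simp add: ennreal_le_iff)
  then show ?thesis using k by (simp add: field_simps)
qed

text \<open>With \<open>v = u\<^sup>k\<close> the integrand has an elementary antiderivative, the scalar case of \<open>integral_Q_cubed\<close>. It
vanishes at \<open>0\<close> and tends to \<open>\<pi> / (16 k)\<close> at infinity.\<close>

lemma sgn_const_pos:
  assumes k: "k > 0"
  shows "sgn_const k > 0"
proof -
  define f where "f u = u ^ (3 * k - 1) / (1 + u ^ (2 * k)) ^ 3" for u :: real
  define F where "F v = (arctan v + v / (1 + v\<^sup>2) - 2 * (v / (1 + v\<^sup>2)\<^sup>2)) / (8 * real k)" for v
  have pos: "1 + v\<^sup>2 > 0" for v :: real by (simp add: add_pos_nonneg)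
  have dF: "(F has_real_derivative v\<^sup>2 / (real k * (1 + v\<^sup>2) ^ 3)) (at v)" for v
  proof -
    have ne: "1 + v\<^sup>2 \<noteq> 0" using pos[of v] by simp
    have d1: "((\<lambda>v. v / (1 + v\<^sup>2)) has_real_derivative (2 - (1 + v\<^sup>2)) / (1 + v\<^sup>2)\<^sup>2) (at v)"
    proof (rule DERIV_cong)
      show "((\<lambda>v. v / (1 + v\<^sup>2)) has_real_derivative
          (1 * (1 + v\<^sup>2) - v * (2 * v)) / ((1 + v\<^sup>2) * (1 + v\<^sup>2))) (at v)"
        using ne by (intro DERIV_divide DERIV_ident) (auto intro!: derivative_eq_intros)
    qed (simp add: power2_eq_square)
    have d2: "((\<lambda>v. v / (1 + v\<^sup>2)\<^sup>2) has_real_derivative (4 - 3 * (1 + v\<^sup>2)) / (1 + v\<^sup>2) ^ 3) (at v)"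
    proof (rule DERIV_cong)
      show "((\<lambda>v. v / (1 + v\<^sup>2)\<^sup>2) has_real_derivative
          (1 * (1 + v\<^sup>2)\<^sup>2 - v * (2 * (1 + v\<^sup>2) * (2 * v))) / ((1 + v\<^sup>2)\<^sup>2 * (1 + v\<^sup>2)\<^sup>2)) (at v)"
        using ne by (intro DERIV_divide DERIV_ident) (auto intro!: derivative_eq_intros)
      have "(p\<^sup>2 - 4 * (p - 1) * p) / (p\<^sup>2 * p\<^sup>2) = (4 - 3 * p) / p ^ 3" if "p \<noteq> 0" for p :: real
        using that by (simp add: field_simps power2_eq_square power3_eq_cube)
      from this[OF ne] show "(1 * (1 + v\<^sup>2)\<^sup>2 - v * (2 * (1 + v\<^sup>2) * (2 * v))) / ((1 + v\<^sup>2)\<^sup>2 * (1 + v\<^sup>2)\<^sup>2)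
          = (4 - 3 * (1 + v\<^sup>2)) / (1 + v\<^sup>2) ^ 3"
        by (simp add: power2_eq_square mult_ac)
    qed
    have "(F has_real_derivative (inverse (1 + v\<^sup>2) + (2 - (1 + v\<^sup>2)) / (1 + v\<^sup>2)\<^sup>2
       - 2 * ((4 - 3 * (1 + v\<^sup>2)) / (1 + v\<^sup>2) ^ 3)) / (8 * real k)) (at v)"
      unfolding F_def by (intro DERIV_cdivide DERIV_diff DERIV_add DERIV_arctan d1 d2 DERIV_cmult)
    also have "inverse (1 + v\<^sup>2) + (2 - (1 + v\<^sup>2)) / (1 + v\<^sup>2)\<^sup>2 - 2 * ((4 - 3 * (1 + v\<^sup>2)) / (1 + v\<^sup>2) ^ 3)
       = 8 * v\<^sup>2 / (1 + v\<^sup>2) ^ 3"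
    proof -
      have "inverse p + (2 - p) / p\<^sup>2 - 2 * ((4 - 3 * p) / p ^ 3) = 8 * (p - 1) / p ^ 3" if "p \<noteq> 0" for p :: real
        using that by (simp add: field_simps power2_eq_square power3_eq_cube)
      from this[OF ne] show ?thesis by simp
    qed
    also have "8 * v\<^sup>2 / (1 + v\<^sup>2) ^ 3 / (8 * real k) = v\<^sup>2 / (real k * (1 + v\<^sup>2) ^ 3)"
      using k by (simp add: mult.commute)
    finally show ?thesis .
  qed
  have dG: "((\<lambda>u. F (u ^ k)) has_real_derivative f u) (at u)" for u
  proof -
    have "((\<lambda>u. F (u ^ k)) has_real_derivative
        (u ^ k)\<^sup>2 / (real k * (1 + (u ^ k)\<^sup>2) ^ 3) * (real k * u ^ (k - 1))) (at u)"
      by (rule DERIV_chain2[OF dF]) (auto intro!: derivative_eq_intros)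
    also have "(u ^ k)\<^sup>2 / (real k * (1 + (u ^ k)\<^sup>2) ^ 3) * (real k * u ^ (k - 1))
        = ((u ^ k)\<^sup>2 * u ^ (k - 1)) / (1 + (u ^ k)\<^sup>2) ^ 3" using k by simp
    also have "(u ^ k)\<^sup>2 * u ^ (k - 1) = u ^ (3 * k - 1)"
      using k by (simp flip: power_mult power_add)
    also have "(u ^ k)\<^sup>2 = u ^ (2 * k)" by (simp add: mult.commute flip: power_mult)
    finally show ?thesis by (simp add: f_def)
  qed
  have small: "((\<lambda>v::real. v / (1 + v\<^sup>2)) \<longlongrightarrow> 0) at_top" "((\<lambda>v::real. v / (1 + v\<^sup>2)\<^sup>2) \<longlongrightarrow> 0) at_top"
  proof -
    have inv: "((\<lambda>v::real. inverse v) \<longlongrightarrow> 0) at_top" by (rule tendsto_inverse_0_at_top[OF filterlim_ident])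
    have 1: "v / (1 + v\<^sup>2) \<le> inverse v" if "v > 0" for v :: real
      using that pos[of v] by (simp add: field_simps power2_eq_square)
    have "v / (1 + v\<^sup>2)\<^sup>2 \<le> v / (1 + v\<^sup>2)" if "v > 0" for v :: real
    proof -
      have "(1 + v\<^sup>2) * 1 \<le> (1 + v\<^sup>2) * (1 + v\<^sup>2)" using pos[of v] by (intro mult_left_mono) auto
      then show ?thesis using that pos[of v] by (intro divide_left_mono) (auto simp: power2_eq_square)
    qed
    note 2 = order_trans[OF this 1]
    have ev: "eventually (\<lambda>v::real. v > 0) at_top" by (rule eventually_gt_at_top)
    show "((\<lambda>v::real. v / (1 + v\<^sup>2)) \<longlongrightarrow> 0) at_top"
      by (rule Lim_null_comparison[OF _ inv], rule eventually_mono[OF ev]) (use 1 pos in auto)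
    show "((\<lambda>v::real. v / (1 + v\<^sup>2)\<^sup>2) \<longlongrightarrow> 0) at_top"
      by (rule Lim_null_comparison[OF _ inv], rule eventually_mono[OF ev]) (use 2 pos in auto)
  qed
  define T where "T = (pi / 2 + 0 - 2 * 0) / (8 * real k)"
  have "(F \<longlongrightarrow> T) at_top"
    unfolding F_def T_def using k by (intro tendsto_intros small tendsto_arctan_at_top) auto
  then have lim: "((\<lambda>u. F (u ^ k)) \<longlongrightarrow> T) at_top"
    by (rule filterlim_compose) (rule filterlim_pow_at_top[OF k filterlim_ident])
  have nonneg: "0 \<le> f u" if "0 \<le> u" for u using that by (simp add: f_def)
  have meas: "f \<in> borel_measurable borel" unfolding f_def by measurable
  have "(\<integral>\<^sup>+u. ennreal (f u) * indicator {0..} u \<partial>lborel) = ennreal (T - F (0 ^ k))"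
    by (rule nn_integral_FTC_atLeast[OF meas dG nonneg lim])
  also have "F (0 ^ k) = 0" using k by (simp add: F_def zero_power)
  finally have "(\<integral>\<^sup>+u. ennreal (f u * indicator {0..} u) \<partial>lborel) = ennreal T"
    by (simp add: ennreal_mult'' ennreal_indicator)
  then have "((\<lambda>u. f u * indicator {0..} u) has_integral T) UNIV"
    using meas nonneg by (intro nn_integral_has_integral) (auto simp: T_def indicator_def)
  moreover have "(\<lambda>u. f u * indicator {0..} u) = (\<lambda>u. if u \<in> {0..} then f u else 0)"
    by (auto simp: fun_eq_iff)
  ultimately have "(f has_integral T) {0..}" by (simp only: has_integral_restrict_UNIV)
  moreover have negl: "negligible {x \<in> {0..} - {0<..}. f x \<noteq> 0}" "negligible {x \<in> {0<..} - {0..}. f x \<noteq> 0}"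
  proof -
    show "negligible {x \<in> {0..} - {0<..}. f x \<noteq> 0}" by (rule negligible_subset[of "{0}"]) auto
    have "{x \<in> {0<..} - {0..}. f x \<noteq> 0} = {}" by auto
    then show "negligible {x \<in> {0<..} - {0..}. f x \<noteq> 0}" by (simp only: negligible_empty)
  qed
  ultimately have "(f has_integral T) {0<..}"
    by (simp only: has_integral_spike_set_eq[OF negl])
  then have "integral {0<..} f = T" by (rule integral_unique)
  moreover have "T > 0" using k by (simp add: T_def)
  ultimately show ?thesis by (simp add: sgn_const_def f_def[abs_def])
qed

context bisectorial
begin

lemma sq_resolvent_eq:
  assumes "t > 0"
  shows "sq_resolvent k A t = op_graph (res (t ^ k))"
proof -
  have t: "t ^ k \<noteq> 0" using assms by simp
  have eq: "(f, u) \<in> sq_resolvent k A t \<longleftrightarrow>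
     (\<exists>v w. (u, v) \<in> A \<and> (v, w) \<in> A \<and> u + (t ^ k)\<^sup>2 *\<^sub>R w = f)" for f u
    by (auto simp: sq_resolvent_def id_plus_def op_scaleR_def op_mult_def power_even_eq)
  have "(f, u) \<in> sq_resolvent k A t \<longleftrightarrow> u = res (t ^ k) f" for f u
    unfolding eq using res_eq(1) res_chain[OF t, of f] by metis
  then show ?thesis by (auto simp: op_graph_def)
qed

lemma scaled_res_quo: "s \<noteq> 0 \<Longrightarrow> (res s f, y) \<in> op_scaleR s A \<longleftrightarrow> y = quo s f"
proof
  assume s: "s \<noteq> 0"
  have *: "(res s f, (1 / s) *\<^sub>R quo s f) \<in> A" by (rule res_quo_in(1)[OF s])
  show "y = quo s f" if y: "(res s f, y) \<in> op_scaleR s A"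
  proof -
    obtain v where v: "(res s f, v) \<in> A" "y = s *\<^sub>R v" using y by (auto simp: op_scaleR_def)
    have "v = (1 / s) *\<^sub>R quo s f" by (rule linear_operator_fun[OF lin v(1) *])
    then show ?thesis using v(2) s by simp
  qed
  have "(res s f, s *\<^sub>R (1 / s) *\<^sub>R quo s f) \<in> op_scaleR s A" using * unfolding op_scaleR_def by blast
  then show "(res s f, y) \<in> op_scaleR s A" if "y = quo s f" using s that by simp
qed

lemma op_app_quo:
  assumes "t > 0"
  shows "op_app (op_scaleR (t ^ k) A \<circ>\<^sub>o sq_resolvent k A t) f = Q (real k * ln t) f"
proof -
  have t: "t ^ k \<noteq> 0" using assms by simp
  have "op_scaleR (t ^ k) A \<circ>\<^sub>o sq_resolvent k A t = op_graph (quo (t ^ k))"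
    unfolding sq_resolvent_eq[OF assms] op_mult_def using scaled_res_quo[OF t]
    by (auto simp: op_graph_def)
  then show ?thesis using assms by (simp add: Q_def exp_nat_mult_ln)
qed

lemma sgn_integrand_eq:
  assumes "t > 0"
  shows "sgn_integrand k A f t = (1 / t) *\<^sub>R Q3 (real k * ln t) f"
proof -
  define s where "s = t ^ k"
  have s: "s \<noteq> 0" using assms by (simp add: s_def)
  have res3: "(f, g) \<in> sq_resolvent k A t ^^ 3 \<longleftrightarrow> g = res s (res s (res s f))" for f g
    by (auto simp: sq_resolvent_eq[OF assms] s_def numeral_3_eq_3 op_graph_def)
  have sA: "(res s f, y) \<in> op_scaleR s A \<longleftrightarrow> y = quo s f" for f y
    by (rule scaled_res_quo[OF s])
  have c: "quo s (res s f) = res s (quo s f)" for f by (rule quo_res_commute[OF s s])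
  have cube: "(res s (res s (res s f)), y) \<in> op_scaleR s A ^^ 3 \<longleftrightarrow> y = quo s (quo s (quo s f))" for f y
  proof -
    have "(res s (res s (res s f)), y) \<in> op_scaleR s A ^^ 3 \<longleftrightarrow>
      (\<exists>a b. (res s (res s (res s f)), a) \<in> op_scaleR s A \<and> (a, b) \<in> op_scaleR s A \<and> (b, y) \<in> op_scaleR s A)"
      by (auto simp: numeral_3_eq_3)
    then show ?thesis by (simp add: sA c)
  qed
  have "(f, y) \<in> (op_scaleR s A ^^ 3) \<circ>\<^sub>o (sq_resolvent k A t ^^ 3) \<longleftrightarrow> y = quo s (quo s (quo s f))" for f y
    by (simp add: op_mult_def relcomp_unfold res3 cube)
  then have "(op_scaleR s A ^^ 3) \<circ>\<^sub>o (sq_resolvent k A t ^^ 3) = op_graph (\<lambda>f. quo s (quo s (quo s f)))"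
    by (auto simp: op_graph_def)
  then show ?thesis
    using assms by (simp add: sgn_integrand_def Q_def exp_nat_mult_ln s_def)
qed

lemma square_function_bound:
  assumes k: "k > 0" and C: "C \<ge> 0"
    and nn: "(\<integral>\<^sup>+ t \<in> {0<..}. ennreal ((norm (op_app
        (op_scaleR (t ^ k) A \<circ>\<^sub>o sq_resolvent k A t) u))\<^sup>2 / t) \<partial>lborel) \<le> ennreal (C * (norm u)\<^sup>2)"
    and cd: "c \<le> d"
  shows "integral {c..d} (\<lambda>x. (norm (Q x u))\<^sup>2) \<le> real k * (C * (norm u)\<^sup>2)"
  by (rule square_function_log_substitution[OF _ _ _ _ cd nn])
    (use k C in \<open>auto simp: op_app_quo intro!: continuous_intros continuous_Q\<close>)

text \<open>A bounded extension equals \<open>\<gamma> T\<close> on \<open>V\<close> for a positive number \<open>\<gamma>\<close>, and \<open>G = 8 T\<close> squares to a positive multiple of the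
identity there. So a positive multiple of the extension is its own inverse on \<open>V\<close>.\<close>

lemma sgn_bounded_and_invertible:
  assumes k: "k > 0" and T: "bounded_clinear T" "\<And>f. has_line_integral (\<lambda>x. Q3 x f) (T f)"
  shows "(\<exists>S. bounded_extension_sgn k A S) \<and> (\<forall>S. bounded_extension_sgn k A S \<longrightarrow> invertible_on V S)"
proof
  define \<gamma> where "\<gamma> = sgn_const k * (1 / real k)"
  have \<gamma>: "\<gamma> > 0" using k sgn_const_pos by (simp add: \<gamma>_def)
  have imp: "has_improper_integral (sgn_integrand k A f) ((1 / real k) *\<^sub>R T f)" for f
    using k by (intro has_improper_integral_log_substitution[OF continuous_Q3 T(2)] sgn_integrand_eq) auto
  have "bounded_extension_sgn k A (\<lambda>f. \<gamma> *\<^sub>R T f)"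
    unfolding bounded_extension_sgn_def
  proof (intro conjI ballI)
    show "bounded_clinear (\<lambda>f. \<gamma> *\<^sub>R T f)"
      using T(1) bounded_linear_compose[OF bounded_linear_scaleR_right, of T \<gamma>]
      by (simp add: bounded_clinear_def scaleC_scaleR)
    show "\<gamma> *\<^sub>R T n = 0" if "n \<in> null_space A" for n
    proof -
      have "Q3 x n = 0" for x
        by (simp add: Q_null_space[OF that] linear_0[OF Q_linear])
      then show ?thesis
        using has_line_integral_unique[OF T(2)[of n], of 0] by (simp add: has_line_integral_0)
    qed
    show "\<exists>g. has_improper_integral (sgn_integrand k A f) g \<and> \<gamma> *\<^sub>R T f = sgn_const k *\<^sub>R g" for f
      using imp[of f] by (intro exI[of _ "(1 / real k) *\<^sub>R T f"]) (simp add: \<gamma>_def)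
  qed
  then show "\<exists>S. bounded_extension_sgn k A S" by blast
  show "\<forall>S. bounded_extension_sgn k A S \<longrightarrow> invertible_on V S"
  proof (intro allI impI)
    fix S assume S: "bounded_extension_sgn k A S"
    then have Sl: "bounded_linear S" by (simp add: bounded_extension_sgn_def bounded_clinear_def)
    have ST: "S f = \<gamma> *\<^sub>R T f" if f: "f \<in> Domain A \<inter> Range A" for f
    proof -
      have "\<forall>f\<in>Domain A \<inter> Range A. \<exists>g. has_improper_integral (sgn_integrand k A f) g \<and> S f = sgn_const k *\<^sub>R g"
        using S unfolding bounded_extension_sgn_def by (elim conjE)
      then obtain g where g: "has_improper_integral (sgn_integrand k A f) g" "S f = sgn_const k *\<^sub>R g"
        using f by blast
      show ?thesis using has_improper_integral_unique[OF g(1) imp] by (simp add: \<gamma>_def g(2))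
    qed
    have Tl: "bounded_linear T" using T(1) by (simp add: bounded_clinear_def)
    have "closed {f. S f = \<gamma> *\<^sub>R T f}"
      by (intro closed_Collect_eq continuous_intros linear_continuous_on Sl Tl)
    then have "closure (Domain A \<inter> Range A) \<subseteq> {f. S f = \<gamma> *\<^sub>R T f}"
      using ST by (intro closure_minimal) auto
    then have SV: "S f = \<gamma> *\<^sub>R T f" if "f \<in> V" for f using that by (auto simp: dense_domain_range)
    have G: "((\<lambda>(c, d). integral {c..d} (\<lambda>x. Q x f)) \<longlongrightarrow> 8 *\<^sub>R T f) (at_bot \<times>\<^sub>F at_top)"
      if "f \<in> V" for f
      by (rule has_line_integral_Q[OF T(2) that, unfolded has_line_integral_def])
    obtain \<kappa> where \<kappa>: "\<kappa> > 0" "\<And>f. f \<in> V \<Longrightarrow> 8 *\<^sub>R T f \<in> V"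
      "\<And>f. f \<in> V \<Longrightarrow> 8 *\<^sub>R T (8 *\<^sub>R T f) = \<kappa> *\<^sub>R f"
      using integrated_family_square[of "\<lambda>f. 8 *\<^sub>R T f", OF G] by auto
    define c where "c = \<gamma> / 8"
    have Sc: "S f = c *\<^sub>R (8 *\<^sub>R T f)" if "f \<in> V" for f using SV[OF that] by (simp add: c_def)
    have SinV: "S f \<in> V" if "f \<in> V" for f
      unfolding Sc[OF that] by (rule subspace_scale[OF subspace_closure_range \<kappa>(2)[OF that]])
    define \<mu> where "\<mu> = c * c * \<kappa>"
    have \<mu>: "\<mu> > 0" using \<gamma> \<kappa>(1) by (simp add: \<mu>_def c_def)
    have SS: "S (S f) = \<mu> *\<^sub>R f" if "f \<in> V" for f
    proof -
      have "S (S f) = c *\<^sub>R S (8 *\<^sub>R T f)" unfolding Sc[OF that]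
        by (rule linear_scale[OF bounded_linear.linear[OF Sl]])
      also have "\<dots> = c *\<^sub>R c *\<^sub>R (8 *\<^sub>R T (8 *\<^sub>R T f))" by (simp only: Sc[OF \<kappa>(2)[OF that]])
      finally show ?thesis unfolding \<kappa>(3)[OF that] \<mu>_def by simp
    qed
    have "bij_betw S V V"
    proof (rule bij_betwI[where g = "\<lambda>f. (1 / \<mu>) *\<^sub>R S f"])
      show "S \<in> V \<rightarrow> V" using SinV by auto
      show "(\<lambda>f. (1 / \<mu>) *\<^sub>R S f) \<in> V \<rightarrow> V" using SinV subspace_scale[OF subspace_closure_range] by auto
      show "(1 / \<mu>) *\<^sub>R S (S f) = f" if "f \<in> V" for f using SS[OF that] \<mu> by simp
      show "S ((1 / \<mu>) *\<^sub>R S f) = f" if "f \<in> V" for f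
        using SS[OF that] \<mu> by (simp add: linear_scale[OF bounded_linear.linear[OF Sl]])
    qed
    moreover have "\<exists>M. \<forall>v\<in>V. norm v \<le> M * norm (S v)"
    proof -
      obtain B where B: "\<And>x. norm (S x) \<le> norm x * B" using bounded_linear.bounded[OF Sl] by blast
      have "norm v \<le> (B / \<mu>) * norm (S v)" if "v \<in> V" for v
      proof -
        have "\<mu> * norm v = norm (S (S v))" using SS[OF that] \<mu> by simp
        also have "\<dots> \<le> norm (S v) * B" by (rule B)
        finally show ?thesis using \<mu> by (simp add: field_simps)
      qed
      then show ?thesis by blast
    qed
    ultimately show "invertible_on V S" by (simp add: invertible_on_def)
  qed
qed

end

theorem proposition1p2:
  fixes D :: "'a::chilbert operator" and B :: "'a \<Rightarrow> 'a"
    and k :: nat and \<delta> C :: real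
  assumes "k > 0"
    and "self_adjoint D"
    and "bounded_clinear B"
    and "\<delta> > 0"
    and "\<And>u. u \<in> Domain D \<Longrightarrow>
      Re (cinner (op_app (op_graph B \<circ>\<^sub>o D) u) (op_app D u)) \<ge> \<delta> * (norm (op_app D u))\<^sup>2"
    and "\<And>u. (\<integral>\<^sup>+ t \<in> {0<..}. ennreal ((norm (op_app
        (op_scaleR (t ^ k) (op_graph B \<circ>\<^sub>o D) \<circ>\<^sub>o sq_resolvent k (op_graph B \<circ>\<^sub>o D) t)
        u))\<^sup>2 / t) \<partial>lborel) \<le> ennreal (C * (norm u)\<^sup>2)"
    and "\<And>u. (\<integral>\<^sup>+ t \<in> {0<..}. ennreal ((norm (op_app
        (op_scaleR (t ^ k) (op_adjoint (op_graph B) \<circ>\<^sub>o D)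
          \<circ>\<^sub>o sq_resolvent k (op_adjoint (op_graph B) \<circ>\<^sub>o D) t)
        u))\<^sup>2 / t) \<partial>lborel) \<le> ennreal (C * (norm u)\<^sup>2)"
  shows "(\<exists>S. bounded_extension_sgn k (op_graph B \<circ>\<^sub>o D) S) \<and>
    (\<forall>S. bounded_extension_sgn k (op_graph B \<circ>\<^sub>o D) S \<longrightarrow>
      invertible_on (closure (Range (op_graph B \<circ>\<^sub>o D))) S)"
proof -
  obtain B' where "bounded_clinear B' \<and> (\<forall>u v. inner (B u) v = inner u (B' v))"
    using bounded_clinear_adjoint_exists[OF assms(3)] ..
  then have B': "bounded_clinear B'" "\<And>u v. inner (B u) v = inner u (B' v)" by blast+
  have adj: "op_adjoint (op_graph B) = op_graph B'"
    by (rule op_adjoint_op_graph[OF assms(3) B'(2)])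
  have lin: "linear_operator D" using assms(2) by (simp add: self_adjoint_def)
  have acc: "\<delta> * (norm v)\<^sup>2 \<le> inner (B v) v" if uv: "(u, v) \<in> D" for u v
  proof -
    have "op_app D u = v" by (rule op_app_eq[OF lin uv])
    moreover have "op_app (op_graph B \<circ>\<^sub>o D) u = B v"
      unfolding op_app_def mem_op_mult_graph
    proof (rule the_equality)
      show "\<exists>z. (u, z) \<in> D \<and> B v = B z" using uv by blast
      show "w = B v" if "\<exists>z. (u, z) \<in> D \<and> w = B z" for w
        using that linear_operator_fun[OF lin uv] by blast
    qed
    moreover have "u \<in> Domain D" using uv by (rule DomainI)
    ultimately show ?thesis using assms(5)[of u] by (simp add: Re_cinner)
  qed
  interpret P: accretive_product D B \<delta> by unfold_locales (fact assms(2-4) acc)+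
  have acc': "\<delta> * (norm v)\<^sup>2 \<le> inner (B' v) v" if "(u, v) \<in> D" for u v
    using acc[OF that] unfolding B'(2) by (subst inner_commute)
  interpret P': accretive_product D B' \<delta> by unfold_locales (fact assms(2,4) B'(1) acc')+
  obtain M where "bisectorial (op_graph B \<circ>\<^sub>o D) M" using P.product_bisectorial ..
  then interpret X: bisectorial "op_graph B \<circ>\<^sub>o D" M .
  obtain M' where "bisectorial (op_graph B' \<circ>\<^sub>o D) M'" using P'.product_bisectorial ..
  then interpret Y: bisectorial "op_graph B' \<circ>\<^sub>o D" M' .
  \<comment> \<open>\<^const>\<open>ennreal\<close> sends a negative bound to \<open>0\<close>, so it may be replaced by \<open>0\<close>\<close>
  define C' where "C' = max C 0"
  have C': "C' \<ge> 0" by (simp add: C'_def)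
  have CC': "ennreal (C * (norm u)\<^sup>2) \<le> ennreal (C' * (norm u)\<^sup>2)" for u :: 'a
    by (intro ennreal_leI mult_right_mono) (auto simp: C'_def)
  have sqX: "integral {c..d} (\<lambda>x. (norm (X.Q x u))\<^sup>2) \<le> real k * C' * (norm u)\<^sup>2" if "c \<le> d" for u c d
    using X.square_function_bound[OF assms(1) C' order_trans[OF assms(6) CC'] that, of u] by (simp add: mult.assoc)
  have sqY: "integral {c..d} (\<lambda>x. (norm (Y.Q x u))\<^sup>2) \<le> real k * C' * (norm u)\<^sup>2" if "c \<le> d" for u c d
    using Y.square_function_bound[OF assms(1) C' order_trans[OF assms(7)[unfolded adj] CC'] that, of u]
    by (simp add: mult.assoc)
  obtain b where b: "\<And>x. norm (B' x) \<le> norm x * b"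
    using bounded_linear.bounded[OF P'.B_bounded_linear] by blast
  define \<psi> where "\<psi> x g = norm (Y.Q x (B' g)) / \<delta>" for x g
  \<comment> \<open>\<open>+ 1\<close> makes the constant positive, as the weight in Young's inequality has to be\<close>
  define C2 where "C2 = real k * C' * b\<^sup>2 / \<delta>\<^sup>2 + 1"
  have "\<exists>T. bounded_clinear T \<and> (\<forall>f. has_line_integral (\<lambda>x. X.Q3 x f) (T f))"
  proof (rule X.cubed_integral_operator[OF sqX, where \<psi> = \<psi> and ?C2.0 = C2])
    show "\<bar>inner (X.Q x w) g\<bar> \<le> norm w * \<psi> x g" for x w g
      using quo_duality[OF P.accretive_product_axioms P'.accretive_product_axioms B'(2)
          X.bisectorial_axioms Y.bisectorial_axioms, of "exp x" w g] assms(4)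
      by (simp add: X.Q_def Y.Q_def \<psi>_def field_simps)
    show "continuous_on UNIV (\<lambda>x. \<psi> x g)" for g
      unfolding \<psi>_def using assms(4) by (intro continuous_intros Y.continuous_Q) auto
    show "0 \<le> \<psi> x g" for x g using assms(4) by (simp add: \<psi>_def)
    show "0 < C2" using C' by (simp add: C2_def add_nonneg_pos)
    show "integral {c..d} (\<lambda>x. (\<psi> x g)\<^sup>2) \<le> C2 * (norm g)\<^sup>2" if "c \<le> d" for g c d
    proof -
      have "integral {c..d} (\<lambda>x. (\<psi> x g)\<^sup>2) = integral {c..d} (\<lambda>x. (norm (Y.Q x (B' g)))\<^sup>2) / \<delta>\<^sup>2"
        by (simp add: \<psi>_def power_divide)
      also have "\<dots> \<le> real k * C' * (norm (B' g))\<^sup>2 / \<delta>\<^sup>2"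
        by (intro divide_right_mono sqY that) simp
      also have "\<dots> \<le> real k * C' * (norm g * b)\<^sup>2 / \<delta>\<^sup>2"
        using C' b[of g] by (intro divide_right_mono mult_left_mono power_mono) auto
      also have "\<dots> = (real k * C' * b\<^sup>2 / \<delta>\<^sup>2) * (norm g)\<^sup>2" by (simp add: power_mult_distrib mult_ac)
      also have "\<dots> \<le> C2 * (norm g)\<^sup>2" unfolding C2_def by (intro mult_right_mono) auto
      finally show ?thesis .
    qed
  qed
  then obtain T where "bounded_clinear T" "\<And>f. has_line_integral (\<lambda>x. X.Q3 x f) (T f)" by blast
  then show ?thesis by (rule X.sgn_bounded_and_invertible[OF assms(1)])
qed

end
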